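(* Let $\nu\in[0,1)$ and let $A_{\nu,\infty}$ be the minimal operator generated by $\tau_\nu=-\frac{d^2}{dx^2}+\frac{\nu^2-1/4}{x^2}$ in $L^2(\mathbb R_+)$. Let $\{\mathbb C,\Gamma_0^{\nu,\infty},\Gamma_1^{\nu,\infty}\}$ be the boundary triplet for $A_{\nu,\infty}^*$ given by $\Gamma_0^{\nu,\infty}f=[f,x^{1/2+\nu}]_0$ and $\Gamma_1^{\nu,\infty}f=-(2\nu)^{-1}[f,x^{1/2-\nu}]_0$ if $\nu\in(0,1)$, $\Gamma_1^{0,\infty}f=[f,x^{1/2}\log(x)]_0$ if $\nu=0$. Then: (i) The domain of the Friedrichs extension $(A_{\nu,\infty})_F$ of $A_{\nu,\infty}$ is $$\operatorname{dom}((A_{\nu,\infty})_F)=\ker(\Gamma_0^{\nu,\infty})=\{f\in\operatorname{dom}(A_{\nu,\infty}^* ): [f,x^{1/2+\nu}]_0=0\}.$$ (ii) The domain of the Krein extension $(A_{\nu,\infty})_K$ of $A_{\nu,\infty}$ is $$\operatorname{dom}((A_{\nu,\infty})_K)=\begin{cases}\{f\in\operatorname{dom}(A_{\nu,\infty}^* ): [f,x^{1/2-\nu}]_0=0\}, & \nu\in(0,1),\\ \{f\in\operatorname{dom}(A_{0,\infty}^* ): [f,x^{1/2}]_0=0\}=\ker(\Gamma_0^{0,\infty}), & \nu=0.\end{cases}$$ In particular, for $\nu=0$ the Friedrichs and Krein extensions coincide: $(A_{0,\infty})_F=(A_{0,\infty})_K$.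
   Context: $\mathbb R_+=(0,\infty)$. The maximal operator generated by $\tau_\nu$ in $L^2(\mathbb R_+)$ acts as $\tau_\nu$ on all $f\in L^2(\mathbb R_+)$ with $f,f'$ locally absolutely continuous on $(0,\infty)$ and $\tau_\nu f\in L^2(\mathbb R_+)$; the minimal operator $A_{\nu,\infty}$ is the closure of its restriction to functions with compact support in $(0,\infty)$, and $A_{\nu,\infty}^*$ is the maximal operator. $[f,g]_x=f(x)\overline{g'(x)}-f'(x)\overline{g(x)}$ and $[f,g]_0=\lim_{x\to0^+}[f,g]_x$. For a densely defined nonnegative symmetric operator $A$, the Friedrichs extension $A_F$ and the Krein extension $A_K$ are the maximal and minimal nonnegative self-adjoint extensions: $(A_F+x)^{-1}\le(\widetilde A+x)^{-1}\le(A_K+x)^{-1}$ for all $x>0$ and all nonnegative self-adjoint extensions $\widetilde A$ of $A$. Boundary triplet: $\{\mathcal H,\Gamma_0,\Gamma_1\}$ is a boundary triplet for $A^*$ if $\mathcal H$ is a Hilbert space, $\Gamma_0,\Gamma_1:\operatorname{dom}(A^* )\to\mathcal H$ are linear, $(A^*f,g)-(f,A^*g)=(\Gamma_1f,\Gamma_0g)_{\mathcal H}-(\Gamma_0f,\Gamma_1g)_{\mathcal H}$ for all $f,g\in\operatorname{dom}(A^* )$, and $f\mapsto(\Gamma_0f,\Gamma_1f)$ is surjective onto $\mathcal H\oplus\mathcal H$. *)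

theory Defs
  imports "HOL-Analysis.Analysis"
begin

section \<open>The complex Hilbert space of square-integrable functions on the open half-line\<close>

abbreviation half_line :: "real measure"
  where "half_line \<equiv> lebesgue_on {0<..}"

definition square_integrable :: "(real \<Rightarrow> complex) \<Rightarrow> bool"
  where "square_integrable f \<longleftrightarrow>
    f \<in> borel_measurable half_line \<and> integrable half_line (\<lambda>x. (norm (f x))\<^sup>2)"

lemma square_integrable_0: "square_integrable (\<lambda>x. 0)"
  by (simp add: square_integrable_def)

lemma square_integrable_add:
  assumes "square_integrable f" "square_integrable g"
  shows "square_integrable (\<lambda>x. f x + g x)"
proof -
  have "integrable half_line (\<lambda>x. 2 * (norm (f x))\<^sup>2 + 2 * (norm (g x))\<^sup>2)"
    using assms by (auto simp: square_integrable_def)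
  moreover have "(norm (f x + g x))\<^sup>2 \<le> 2 * (norm (f x))\<^sup>2 + 2 * (norm (g x))\<^sup>2" for x
  proof -
    have "(norm (f x + g x))\<^sup>2 \<le> (norm (f x) + norm (g x))\<^sup>2"
      by (intro power_mono norm_triangle_ineq) simp
    also have "\<dots> \<le> 2 * (norm (f x))\<^sup>2 + 2 * (norm (g x))\<^sup>2"
      using zero_le_power2[of "norm (f x) - norm (g x)"]
      by (simp add: power2_eq_square algebra_simps)
    finally show ?thesis .
  qed
  ultimately have "integrable half_line (\<lambda>x. (norm (f x + g x))\<^sup>2)"
    using assms by (elim Bochner_Integration.integrable_bound) (auto simp: square_integrable_def)
  then show ?thesis
    using assms by (auto simp: square_integrable_def)
qed

lemma square_integrable_scale:
  assumes "square_integrable f"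
  shows "square_integrable (\<lambda>x. c * f x)"
  using assms by (auto simp: square_integrable_def norm_mult power_mult_distrib)

lemma borel_measurable_cnj [measurable (raw)]:
  fixes f :: "'a \<Rightarrow> complex"
  assumes "f \<in> borel_measurable M"
  shows "(\<lambda>x. cnj (f x)) \<in> borel_measurable M"
  by (rule measurable_compose[OF assms])
    (intro borel_measurable_continuous_onI continuous_intros)

lemma integrable_mult_cnj:
  assumes "square_integrable f" "square_integrable g"
  shows "integrable half_line (\<lambda>x. f x * cnj (g x))"
proof -
  have "integrable half_line (\<lambda>x. (norm (f x))\<^sup>2 + (norm (g x))\<^sup>2)"
    using assms by (auto simp: square_integrable_def)
  moreover have "norm (f x * cnj (g x)) \<le> (norm (f x))\<^sup>2 + (norm (g x))\<^sup>2" for x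
  proof -
    have "2 * (norm (f x) * norm (g x)) \<le> (norm (f x))\<^sup>2 + (norm (g x))\<^sup>2"
      using zero_le_power2[of "norm (f x) - norm (g x)"]
      by (simp add: power2_eq_square algebra_simps)
    moreover have "0 \<le> norm (f x) * norm (g x)"
      by simp
    ultimately show ?thesis
      unfolding norm_mult complex_mod_cnj by linarith
  qed
  ultimately show ?thesis
    using assms by (elim Bochner_Integration.integrable_bound) (auto simp: square_integrable_def)
qed

quotient_type l2 = "real \<Rightarrow> complex" / partial:
  "\<lambda>f g. square_integrable f \<and> square_integrable g \<and> (AE x in half_line. f x = g x)"
proof (rule part_equivpI)
  show "\<exists>f. square_integrable f \<and> square_integrable f \<and> (AE x in half_line. f x = f x)"
    using square_integrable_0 by auto
  show "symp (\<lambda>f g. square_integrable f \<and> square_integrable g \<and> (AE x in half_line. f x = g x))"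
    by (auto simp: symp_def)
  show "transp (\<lambda>f g. square_integrable f \<and> square_integrable g \<and> (AE x in half_line. f x = g x))"
    by (auto simp: transp_def)
qed

text \<open>The inner product is linear in its first argument.\<close>

lift_definition cinner :: "l2 \<Rightarrow> l2 \<Rightarrow> complex"
  is "\<lambda>f g. \<integral>x. f x * cnj (g x) \<partial>half_line"
  by (intro integral_cong_AE) (auto simp: square_integrable_def)

lift_definition scaleC :: "complex \<Rightarrow> l2 \<Rightarrow> l2"
  is "\<lambda>c f x. c * f x"
  by (auto intro: square_integrable_scale)

instantiation l2 :: real_vector
begin

lift_definition zero_l2 :: l2 is "\<lambda>x. 0"
  by (simp add: square_integrable_0)

lift_definition plus_l2 :: "l2 \<Rightarrow> l2 \<Rightarrow> l2" is "\<lambda>f g x. f x + g x"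
  by (auto intro: square_integrable_add)

definition uminus_l2 :: "l2 \<Rightarrow> l2" where "uminus_l2 u = scaleC (-1) u"

definition minus_l2 :: "l2 \<Rightarrow> l2 \<Rightarrow> l2" where "minus_l2 u v = u + (- v)"

definition scaleR_l2 :: "real \<Rightarrow> l2 \<Rightarrow> l2" where "scaleR_l2 r u = scaleC (of_real r) u"

instance
proof
  fix u v w :: l2 and a b :: real
  show "u + v + w = u + (v + w)"
    by transfer (auto intro!: square_integrable_add simp: add.assoc)
  show "u + v = v + u"
    by transfer (auto intro!: square_integrable_add simp: add.commute)
  show "0 + u = u"
    by transfer auto
  show "- u + u = 0"
    unfolding uminus_l2_def
    by transfer (auto intro!: square_integrable_add square_integrable_0
        square_integrable_scale[of _ "-1", simplified])
  show "u - v = u + - v"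
    by (simp add: minus_l2_def)
  show "a *\<^sub>R (u + v) = a *\<^sub>R u + a *\<^sub>R v"
    unfolding scaleR_l2_def
    by transfer (auto intro!: square_integrable_add square_integrable_scale simp: distrib_left)
  show "(a + b) *\<^sub>R u = a *\<^sub>R u + b *\<^sub>R u"
    unfolding scaleR_l2_def
    by transfer (auto intro!: square_integrable_add
        square_integrable_scale[of _ "of_real a + of_real b"]
        square_integrable_scale simp: distrib_right)
  show "a *\<^sub>R b *\<^sub>R u = (a * b) *\<^sub>R u"
    unfolding scaleR_l2_def
    by transfer (auto intro!: square_integrable_scale
        square_integrable_scale[of _ "of_real a * of_real b"] simp: mult.assoc)
  show "1 *\<^sub>R u = u"
    unfolding scaleR_l2_def by transfer auto
qed

end

instantiation l2 :: real_inner
begin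

definition inner_l2 :: "l2 \<Rightarrow> l2 \<Rightarrow> real" where "inner_l2 u v = Re (cinner u v)"

definition norm_l2 :: "l2 \<Rightarrow> real" where "norm_l2 u = sqrt (inner u u)"

definition sgn_l2 :: "l2 \<Rightarrow> l2" where "sgn_l2 u = u /\<^sub>R norm u"

definition dist_l2 :: "l2 \<Rightarrow> l2 \<Rightarrow> real" where "dist_l2 u v = norm (u - v)"

definition uniformity_l2 :: "(l2 \<times> l2) filter"
  where "uniformity_l2 = (INF e\<in>{0<..}. principal {(u, v). dist u v < e})"

definition open_l2 :: "l2 set \<Rightarrow> bool"
  where "open_l2 U \<longleftrightarrow> (\<forall>u\<in>U. eventually (\<lambda>(u', v). u' = u \<longrightarrow> v \<in> U) uniformity)"

instance
proof
  fix u v w :: l2 and r :: real and U :: "l2 set"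
  show "sgn u = u /\<^sub>R norm u"
    by (simp add: sgn_l2_def)
  show "dist u v = norm (u - v)"
    by (simp add: dist_l2_def)
  show "uniformity = (INF e\<in>{0<..}. principal {(u :: l2, v). dist u v < e})"
    by (simp add: uniformity_l2_def)
  show "open U \<longleftrightarrow> (\<forall>u\<in>U. eventually (\<lambda>(u', v). u' = u \<longrightarrow> v \<in> U) uniformity)"
    by (simp add: open_l2_def)
  show "norm u = sqrt (inner u u)"
    by (simp add: norm_l2_def)
  have cnj: "cinner v u = cnj (cinner u v)"
  proof transfer
    fix f g :: "real \<Rightarrow> complex"
    show "(\<integral>x. f x * cnj (g x) \<partial>half_line) = cnj (\<integral>x. g x * cnj (f x) \<partial>half_line)"
      unfolding Bochner_Integration.integral_cnj[symmetric] by (simp add: mult.commute)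
  qed
  then show "inner u v = inner v u"
    by (simp add: inner_l2_def)
  have "cinner (u + v) w = cinner u w + cinner v w"
    by transfer (auto simp: distrib_right integrable_mult_cnj)
  then show "inner (u + v) w = inner u w + inner v w"
    by (simp add: inner_l2_def)
  have "cinner (scaleC (of_real r) u) v = of_real r * cinner u v"
    by transfer (simp add: mult.assoc)
  then show "inner (r *\<^sub>R u) v = r * inner u v"
    by (simp add: inner_l2_def scaleR_l2_def)
  have sq: "Re (\<integral>x. f x * cnj (f x) \<partial>half_line) = (\<integral>x. (norm (f x))\<^sup>2 \<partial>half_line)" for f
    unfolding complex_norm_square[symmetric]
    by (metis Re_complex_of_real integral_complex_of_real)
  show "0 \<le> inner u u"
    unfolding inner_l2_def by transfer (simp add: sq)
  show "inner u u = 0 \<longleftrightarrow> u = 0"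
    unfolding inner_l2_def
  proof transfer
    fix f :: "real \<Rightarrow> complex"
    assume "square_integrable f \<and> square_integrable f \<and> (AE x in half_line. f x = f x)"
    then have f: "square_integrable f"
      by simp
    then have "(\<integral>x. (norm (f x))\<^sup>2 \<partial>half_line) = 0 \<longleftrightarrow> (AE x in half_line. (norm (f x))\<^sup>2 = 0)"
      by (intro integral_nonneg_eq_0_iff_AE) (auto simp: square_integrable_def)
    with f show "Re (\<integral>x. f x * cnj (f x) \<partial>half_line) = 0 \<longleftrightarrow>
        square_integrable f \<and> square_integrable (\<lambda>x. 0) \<and> (AE x in half_line. f x = 0)"
      by (simp add: sq square_integrable_0)
  qed
qed

end

section \<open>Unbounded operators\<close>

text \<open>An operator is represented by its graph, so that \<open>A \<subseteq> B\<close> says that \<open>B\<close> extends \<open>A\<close>,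
  the domain is \<^const>\<open>Domain\<close>, and the closure of an operator is the topological closure of its
  graph in the product space.\<close>

type_synonym l2_op = "(l2 \<times> l2) set"

definition linear_op :: "l2_op \<Rightarrow> bool"
  where "linear_op A \<longleftrightarrow> single_valued A \<and> (0, 0) \<in> A \<and>
    (\<forall>u v u' v'. (u, v) \<in> A \<longrightarrow> (u', v') \<in> A \<longrightarrow> (u + u', v + v') \<in> A) \<and>
    (\<forall>c u v. (u, v) \<in> A \<longrightarrow> (scaleC c u, scaleC c v) \<in> A)"

definition adjoint_op :: "l2_op \<Rightarrow> l2_op"
  where "adjoint_op A = {(g, h). \<forall>(u, v)\<in>A. cinner v g = cinner u h}"

definition self_adjoint_op :: "l2_op \<Rightarrow> bool"
  where "self_adjoint_op A \<longleftrightarrow>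
    linear_op A \<and> closure (Domain A) = UNIV \<and> adjoint_op A = A"

definition nonneg_op :: "l2_op \<Rightarrow> bool"
  where "nonneg_op A \<longleftrightarrow> (\<forall>(u, v)\<in>A. cinner v u \<in> \<real>\<^sub>\<ge>\<^sub>0)"

definition nonneg_self_adjoint_extension :: "l2_op \<Rightarrow> l2_op \<Rightarrow> bool"
  where "nonneg_self_adjoint_extension A B \<longleftrightarrow> A \<subseteq> B \<and> self_adjoint_op B \<and> nonneg_op B"

text \<open>The graph of \<open>(A + x)\<^sup>-\<^sup>1\<close>.\<close>

definition shifted_inverse :: "l2_op \<Rightarrow> real \<Rightarrow> l2_op"
  where "shifted_inverse A x = {(v + x *\<^sub>R u, u) | u v. (u, v) \<in> A}"

text \<open>The order of everywhere defined operators by their quadratic forms. The resolvents at \<open>-x\<close>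
  of nonnegative self-adjoint operators are everywhere defined, so below \<open>op_le\<close> only compares them.\<close>

definition op_le :: "l2_op \<Rightarrow> l2_op \<Rightarrow> bool"
  where "op_le S T \<longleftrightarrow> Domain S = UNIV \<and> Domain T = UNIV \<and>
    (\<forall>u v w. (u, v) \<in> S \<longrightarrow> (u, w) \<in> T \<longrightarrow> cinner w u - cinner v u \<in> \<real>\<^sub>\<ge>\<^sub>0)"

definition is_friedrichs_extension :: "l2_op \<Rightarrow> l2_op \<Rightarrow> bool"
  where "is_friedrichs_extension A B \<longleftrightarrow> nonneg_self_adjoint_extension A B \<and>
    (\<forall>C. nonneg_self_adjoint_extension A C \<longrightarrow>
      (\<forall>x>0. op_le (shifted_inverse B x) (shifted_inverse C x)))"

definition is_krein_extension :: "l2_op \<Rightarrow> l2_op \<Rightarrow> bool"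
  where "is_krein_extension A B \<longleftrightarrow> nonneg_self_adjoint_extension A B \<and>
    (\<forall>C. nonneg_self_adjoint_extension A C \<longrightarrow>
      (\<forall>x>0. op_le (shifted_inverse C x) (shifted_inverse B x)))"

text \<open>Extremal extensions are unique because \<open>op_le\<close> is antisymmetric on single-valued graphs
  over a complex space; they exist for densely defined nonnegative symmetric operators.\<close>

definition friedrichs_extension :: "l2_op \<Rightarrow> l2_op"
  where "friedrichs_extension A = (THE B. is_friedrichs_extension A B)"

definition krein_extension :: "l2_op \<Rightarrow> l2_op"
  where "krein_extension A = (THE B. is_krein_extension A B)"

definition ker_on :: "l2 set \<Rightarrow> (l2 \<Rightarrow> complex) \<Rightarrow> l2 set"
  where "ker_on D \<Gamma> = {u \<in> D. \<Gamma> u = 0}"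

text \<open>Boundary triplets with boundary space \<open>\<complex>\<close>, whose inner product is \<open>a * cnj b\<close>. The first
  argument is the adjoint of the symmetric operator; the maps matter only on its domain.\<close>

definition boundary_triplet :: "l2_op \<Rightarrow> (l2 \<Rightarrow> complex) \<Rightarrow> (l2 \<Rightarrow> complex) \<Rightarrow> bool"
  where "boundary_triplet T \<Gamma>\<^sub>0 \<Gamma>\<^sub>1 \<longleftrightarrow>
    (\<forall>\<Gamma>\<in>{\<Gamma>\<^sub>0, \<Gamma>\<^sub>1}. \<forall>u\<in>Domain T. \<forall>v\<in>Domain T. \<forall>c.
      \<Gamma> (u + v) = \<Gamma> u + \<Gamma> v \<and> \<Gamma> (scaleC c u) = c * \<Gamma> u) \<and>
    (\<forall>(f, f')\<in>T. \<forall>(g, g')\<in>T.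
      cinner f' g - cinner f g' = \<Gamma>\<^sub>1 f * cnj (\<Gamma>\<^sub>0 g) - \<Gamma>\<^sub>0 f * cnj (\<Gamma>\<^sub>1 g)) \<and>
    (\<lambda>u. (\<Gamma>\<^sub>0 u, \<Gamma>\<^sub>1 u)) ` Domain T = UNIV"

section \<open>The Bessel operator on the half-line\<close>

definition absolutely_continuous_on_interval :: "real \<Rightarrow> real \<Rightarrow> (real \<Rightarrow> complex) \<Rightarrow> bool"
  where "absolutely_continuous_on_interval a b f \<longleftrightarrow>
    (\<forall>\<epsilon>>0. \<exists>\<delta>>0. \<forall>(n::nat) s t.
      (\<forall>i<n. a \<le> s i \<and> s i \<le> t i \<and> t i \<le> b) \<longrightarrow>
      (\<forall>i<n. \<forall>j<n. i \<noteq> j \<longrightarrow> {s i<..<t i} \<inter> {s j<..<t j} = {}) \<longrightarrow>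
      (\<Sum>i<n. t i - s i) < \<delta> \<longrightarrow> (\<Sum>i<n. norm (f (t i) - f (s i))) < \<epsilon>)"

definition locally_absolutely_continuous :: "(real \<Rightarrow> complex) \<Rightarrow> bool"
  where "locally_absolutely_continuous f \<longleftrightarrow>
    (\<forall>a b. 0 < a \<longrightarrow> a \<le> b \<longrightarrow> absolutely_continuous_on_interval a b f)"

text \<open>\<open>bessel_pair \<nu> f g\<close>: the function \<open>f\<close> satisfies the conditions defining the maximal domain,
  and \<open>g = \<tau>\<^sub>\<nu> f\<close>, where \<open>\<tau>\<^sub>\<nu> = - d\<^sup>2/dx\<^sup>2 + (\<nu>\<^sup>2 - 1/4) / x\<^sup>2\<close>. Here \<open>f1\<close> is \<open>f'\<close>; being
  continuous, it is the derivative of \<open>f\<close> at every point, whereas \<open>f2\<close> is \<open>f''\<close>, which exists only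
  almost everywhere (absolute continuity of \<open>f1\<close> ensures this).\<close>

definition bessel_pair :: "real \<Rightarrow> (real \<Rightarrow> complex) \<Rightarrow> (real \<Rightarrow> complex) \<Rightarrow> bool"
  where "bessel_pair \<nu> f g \<longleftrightarrow>
    square_integrable f \<and> square_integrable g \<and> locally_absolutely_continuous f \<and>
    (\<exists>f1 f2. (\<forall>x>0. (f has_vector_derivative f1 x) (at x)) \<and>
      locally_absolutely_continuous f1 \<and>
      (AE x in half_line. (f1 has_vector_derivative f2 x) (at x)) \<and>
      (\<forall>x>0. g x = - f2 x + of_real ((\<nu>\<^sup>2 - 1/4) / x\<^sup>2) * f x))"

definition bessel_minimal :: "real \<Rightarrow> l2_op"
  where "bessel_minimal \<nu> = closure
    {(abs_l2 f, abs_l2 g) | f g. bessel_pair \<nu> f g \<and>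
      (\<exists>K. compact K \<and> K \<subseteq> {0<..} \<and> (\<forall>x>0. x \<notin> K \<longrightarrow> f x = 0))}"

text \<open>The continuous representative is unique on \<open>(0, \<infinity>)\<close>; for elements of the maximal domain it is
  continuously differentiable there.\<close>

definition continuous_rep :: "l2 \<Rightarrow> real \<Rightarrow> complex"
  where "continuous_rep u =
    (SOME f. square_integrable f \<and> abs_l2 f = u \<and> continuous_on {0<..} f)"

definition lagrange_bracket :: "(real \<Rightarrow> complex) \<Rightarrow> (real \<Rightarrow> complex) \<Rightarrow> real \<Rightarrow> complex"
  where "lagrange_bracket f g x =
    f x * cnj (vector_derivative g (at x)) - vector_derivative f (at x) * cnj (g x)"

definition bracket_0 :: "l2 \<Rightarrow> (real \<Rightarrow> real) \<Rightarrow> complex"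
  where "bracket_0 u g =
    Lim (at_right 0) (lagrange_bracket (continuous_rep u) (\<lambda>x. of_real (g x)))"

definition bessel_Gamma0 :: "real \<Rightarrow> l2 \<Rightarrow> complex"
  where "bessel_Gamma0 \<nu> u = bracket_0 u (\<lambda>x. x powr (1/2 + \<nu>))"

definition bessel_Gamma1 :: "real \<Rightarrow> l2 \<Rightarrow> complex"
  where "bessel_Gamma1 \<nu> u =
    (if \<nu> = 0 then bracket_0 u (\<lambda>x. x powr (1/2) * ln x)
     else - (of_real (inverse (2 * \<nu>)) * bracket_0 u (\<lambda>x. x powr (1/2 - \<nu>))))"

end

theory Submission
  imports Defs "HOL-Real_Asymp.Real_Asymp"
begin

text \<open>The first step identifies the adjoint of the minimal operator with the maximal one
  (\<open>adjoint_bessel_minimal\<close>). If \<open>v = A\<^sup>* u\<close> and \<open>F'' = q u - v\<close>, where \<open>q\<close> is the potential, then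
  \<open>u - F\<close> is orthogonal to the second derivative of every test function with compact support, hence
  affine, and \<open>u\<close> inherits the regularity of \<open>F\<close>. As the maximal domain is described by absolute
  continuity and derivatives almost everywhere, this rests on the fundamental theorem of calculus
  for absolutely continuous functions (\<open>absolutely_continuous_FTC\<close>) and on the differentiation
  theorem for indefinite integrals (\<open>integral_has_vector_derivative_AE\<close>).

  For \<open>f\<close> in the maximal domain, \<open>f'\<close> is square integrable at infinity, so infinity contributes
  nothing to Green's identity. Near the origin the bracket of \<open>f\<close> with a solution \<open>p\<close> of
  \<open>\<tau>\<^sub>\<nu> p = 0\<close> has the integrable derivative \<open>\<tau>\<^sub>\<nu> f \<cdot> p\<close>, so it has a limit. All boundary terms can be
  expressed by the brackets with two independent solutions, which gives the boundary triplet.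

  Since \<open>\<tau>\<^sub>\<nu> = D\<^sup>* D\<close> with \<open>D f = p (f / p)'\<close> for each of the solutions \<open>p = x powr (1/2 \<plusminus> \<nu>)\<close>,
  the restriction of the maximal operator by the condition \<open>[f, p]\<^sub>0 = 0\<close> has a nonnegative form:
  the condition makes the boundary term of the factorization vanish (\<open>bessel_form_nonneg\<close>).
  Self-adjointness of the restriction is a general fact on boundary triplets.

  For extremality let \<open>C\<close> be any nonnegative self-adjoint extension. It contains every function with
  vanishing boundary values. If \<open>\<nu> > 0\<close>, subtract from a function \<open>u\<close> with \<open>[u, x powr (1/2 + \<nu>)]\<^sub>0 = 0\<close>
  a multiple of \<open>x powr (1/2 + \<nu>) \<cdot> \<eta> (r x)\<close>, with \<open>\<eta>\<close> equal to \<open>1\<close> at the origin: the difference has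
  vanishing boundary values, and by scaling the subtracted term tends to zero in the form norm as
  \<open>r \<rightarrow> \<infinity>\<close>. Nonnegativity of \<open>C\<close> on the vectors so obtained is the resolvent inequality
  (\<open>friedrichs_dominates\<close>). With \<open>1/2 - \<nu>\<close> instead, the form and the image of the subtracted term tend
  to zero as \<open>r \<rightarrow> 0\<close>, which is what the Krein extension requires (\<open>krein_dominates\<close>). If \<open>\<nu> = 0\<close>, for
  every boundary condition other than \<open>\<Gamma>\<^sub>0 f = 0\<close> an explicit function makes the form negative, so
  there is only one nonnegative self-adjoint extension
  (\<open>bessel_borderline_unique_extension\<close>).

  The resolvents of \<open>C\<close> are everywhere defined because the space is complete
  (\<open>l2_Cauchy_convergent\<close>); completeness also gives the density of the domain.\<close>


section \<open>The Hilbert space\<close>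

lemma l2_cases:
  obtains f where "square_integrable f" "u = abs_l2 f"
  by (induction u rule: l2.abs_induct) auto

lemma abs_l2_eq_iff:
  assumes "square_integrable f" "square_integrable g"
  shows "abs_l2 f = abs_l2 g \<longleftrightarrow> (AE x in half_line. f x = g x)"
  using Quotient_rel[OF Quotient_l2, of f g] assms by simp

lemma cinner_abs_l2:
  assumes "square_integrable f" "square_integrable g"
  shows "cinner (abs_l2 f) (abs_l2 g) = (\<integral>x. f x * cnj (g x) \<partial>half_line)"
  using assms by (simp add: cinner.abs_eq)

lemma add_abs_l2:
  assumes "square_integrable f" "square_integrable g"
  shows "abs_l2 f + abs_l2 g = abs_l2 (\<lambda>x. f x + g x)"
  using assms by (simp add: plus_l2.abs_eq)

lemma scaleC_abs_l2:
  assumes "square_integrable f"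
  shows "scaleC c (abs_l2 f) = abs_l2 (\<lambda>x. c * f x)"
  using assms by (simp add: scaleC.abs_eq)

lemma square_integrable_diff:
  assumes "square_integrable f" "square_integrable g"
  shows "square_integrable (\<lambda>x. f x - g x)"
  using square_integrable_add[OF assms(1) square_integrable_scale[OF assms(2), of "-1"]] by simp

lemma diff_abs_l2:
  assumes "square_integrable f" "square_integrable g"
  shows "abs_l2 f - abs_l2 g = abs_l2 (\<lambda>x. f x - g x)"
  unfolding minus_l2_def uminus_l2_def using assms
  by (simp add: scaleC_abs_l2 add_abs_l2 square_integrable_scale[of g "-1", simplified])

lemma cinner_commute: "cinner v u = cnj (cinner u v)"
proof -
  obtain f g where "square_integrable f" "u = abs_l2 f" "square_integrable g" "v = abs_l2 g"
    by (metis l2_cases)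
  then show ?thesis
    by (simp add: cinner_abs_l2 Bochner_Integration.integral_cnj[symmetric] mult.commute)
qed

lemma cinner_add_left: "cinner (u + v) w = cinner u w + cinner v w"
proof -
  obtain f g h where "square_integrable f" "u = abs_l2 f" "square_integrable g" "v = abs_l2 g"
      "square_integrable h" "w = abs_l2 h"
    by (metis l2_cases)
  then show ?thesis
    by (simp add: add_abs_l2 square_integrable_add cinner_abs_l2 distrib_right integrable_mult_cnj)
qed

lemma cinner_scaleC_left: "cinner (scaleC c u) v = c * cinner u v"
proof -
  obtain f g where "square_integrable f" "u = abs_l2 f" "square_integrable g" "v = abs_l2 g"
    by (metis l2_cases)
  then show ?thesis
    by (simp add: scaleC_abs_l2 cinner_abs_l2 square_integrable_scale mult.assoc)
qed

lemma cinner_add_right: "cinner w (u + v) = cinner w u + cinner w v"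
  by (metis cinner_add_left cinner_commute complex_cnj_add)

lemma cinner_scaleC_right: "cinner u (scaleC c v) = cnj c * cinner u v"
  by (metis cinner_scaleC_left cinner_commute complex_cnj_mult)

lemma scaleR_eq_scaleC: "r *\<^sub>R u = scaleC (of_real r) u" for u :: l2
  by (rule scaleR_l2_def)

lemma cinner_scaleR_left: "cinner (r *\<^sub>R u) v = of_real r * cinner u v"
  by (simp add: scaleR_eq_scaleC cinner_scaleC_left)

lemma cinner_scaleR_right: "cinner u (r *\<^sub>R v) = of_real r * cinner u v"
  by (simp add: scaleR_eq_scaleC cinner_scaleC_right)

lemma cinner_minus_left: "cinner (- u) v = - cinner u v"
  using cinner_scaleR_left[of "-1"] by simp

lemma cinner_minus_right: "cinner u (- v) = - cinner u v"
  using cinner_scaleR_right[of _ "-1"] by simp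

lemma cinner_diff_left: "cinner (u - v) w = cinner u w - cinner v w"
  using cinner_add_left[of u "- v"] by (simp add: cinner_minus_left)

lemma cinner_diff_right: "cinner w (u - v) = cinner w u - cinner w v"
  using cinner_add_right[of w u "- v"] by (simp add: cinner_minus_right)

lemma cinner_zero_left [simp]: "cinner 0 v = 0"
  using cinner_scaleR_left[of 0] by simp

lemma cinner_zero_right [simp]: "cinner u 0 = 0"
  using cinner_scaleR_right[of _ 0] by simp

lemmas cinner_linear = cinner_add_left cinner_add_right cinner_diff_left cinner_diff_right
  cinner_minus_left cinner_minus_right cinner_scaleR_left cinner_scaleR_right

lemma scaleC_add_right: "scaleC c (u + v) = scaleC c u + scaleC c v"
proof -
  obtain f g where "square_integrable f" "u = abs_l2 f" "square_integrable g" "v = abs_l2 g"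
    by (metis l2_cases)
  then show ?thesis
    by (simp add: scaleC_abs_l2 add_abs_l2 square_integrable_scale square_integrable_add distrib_left)
qed

lemma scaleC_scaleC: "scaleC c (scaleC d u) = scaleC (c * d) u"
proof -
  obtain f where "square_integrable f" "u = abs_l2 f"
    by (metis l2_cases)
  then show ?thesis
    by (simp add: scaleC_abs_l2 square_integrable_scale mult.assoc)
qed

lemma scaleC_scaleR_commute: "scaleC c (r *\<^sub>R u) = r *\<^sub>R scaleC c u"
  by (simp add: scaleR_eq_scaleC scaleC_scaleC mult.commute)

lemma scaleC_one [simp]: "scaleC 1 u = u"
  using scaleR_eq_scaleC[of 1 u] by simp

lemma cinner_self: "cinner u u = of_real ((norm u)\<^sup>2)"
proof (rule complex_eqI)
  show "Re (cinner u u) = Re (of_real ((norm u)\<^sup>2))"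
    using power2_norm_eq_inner[of u] by (simp add: inner_l2_def)
  show "Im (cinner u u) = Im (of_real ((norm u)\<^sup>2))"
    using arg_cong[OF cinner_commute[of u u], of Im] by simp
qed

lemma norm_scaleC: "norm (scaleC c u) = norm c * norm u"
proof -
  have "complex_of_real ((norm (scaleC c u))\<^sup>2) = (c * cnj c) * of_real ((norm u)\<^sup>2)"
    unfolding cinner_self[symmetric] cinner_scaleC_left cinner_scaleC_right by simp
  also have "\<dots> = of_real ((norm c * norm u)\<^sup>2)"
    by (simp only: complex_norm_square[symmetric] of_real_mult[symmetric] power_mult_distrib)
  finally have "complex_of_real ((norm (scaleC c u))\<^sup>2) = of_real ((norm c * norm u)\<^sup>2)" .
  then have "(norm (scaleC c u))\<^sup>2 = (norm c * norm u)\<^sup>2"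
    by (simp only: of_real_eq_iff)
  then show ?thesis
    by (simp add: power2_eq_iff_nonneg)
qed

text \<open>The real and the imaginary part are estimated separately, which costs a factor \<open>2\<close>.\<close>

lemma norm_cinner_le: "norm (cinner u v) \<le> 2 * (norm u * norm v)"
proof -
  have "Re (cinner u v) = inner u v"
    by (simp add: inner_l2_def)
  moreover have "Im (cinner u v) = inner (scaleC (- \<i>) u) v"
    by (simp add: inner_l2_def cinner_scaleC_left)
  moreover have "\<bar>inner u v\<bar> \<le> norm u * norm v"
    by (rule Cauchy_Schwarz_ineq2)
  moreover have "\<bar>inner (scaleC (- \<i>) u) v\<bar> \<le> norm u * norm v"
    using Cauchy_Schwarz_ineq2[of "scaleC (- \<i>) u" v] by (simp add: norm_scaleC)
  ultimately show ?thesis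
    using cmod_le[of "cinner u v"] by linarith
qed

lemma bounded_bilinear_cinner: "bounded_bilinear cinner"
proof
  show "\<exists>K. \<forall>a b. norm (cinner a b) \<le> norm a * norm b * K"
    by (rule exI[of _ 2]) (simp add: norm_cinner_le mult.commute)
qed (simp_all add: cinner_linear scaleR_conv_of_real)

lemmas tendsto_cinner [tendsto_intros] = bounded_bilinear.tendsto[OF bounded_bilinear_cinner]

lemma norm_abs_l2:
  assumes "square_integrable f"
  shows "(norm (abs_l2 f))\<^sup>2 = (\<integral>x. (norm (f x))\<^sup>2 \<partial>half_line)"
proof -
  have "complex_of_real ((norm (abs_l2 f))\<^sup>2) = (\<integral>x. complex_of_real ((norm (f x))\<^sup>2) \<partial>half_line)"
    unfolding cinner_self[symmetric] cinner_abs_l2[OF assms assms] complex_norm_square[symmetric] ..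
  also have "\<dots> = of_real (\<integral>x. (norm (f x))\<^sup>2 \<partial>half_line)"
    by (rule integral_complex_of_real)
  finally show ?thesis
    by (simp only: of_real_eq_iff)
qed

lemma nn_integral_norm_abs_l2:
  assumes "square_integrable f"
  shows "(\<integral>\<^sup>+x. ennreal ((norm (f x))\<^sup>2) \<partial>half_line) = ennreal ((norm (abs_l2 f))\<^sup>2)"
  using assms by (subst nn_integral_eq_integral) (auto simp: square_integrable_def norm_abs_l2)

text \<open>Riesz--Fischer. Along a subsequence the squared increments are summable even after
  multiplication with \<open>2 ^ n\<close>, so by monotone convergence the increments decay geometrically at
  almost every point and the subsequence converges almost everywhere; Fatou's lemma identifies
  the pointwise limit as the limit in the mean.\<close>

lemma AE_convergent_of_fast_Cauchy:
  fixes f :: "nat \<Rightarrow> real \<Rightarrow> complex"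
  assumes sq: "\<And>n. square_integrable (f n)"
    and fast: "\<And>n. norm (abs_l2 (f (Suc n)) - abs_l2 (f n)) \<le> (1/2) ^ n"
  shows "AE x in half_line. convergent (\<lambda>n. f n x)"
proof -
  let ?d = "\<lambda>n x. f (Suc n) x - f n x"
  have d: "square_integrable (?d n)" for n
    by (intro square_integrable_diff sq)
  have [measurable]: "f n \<in> borel_measurable half_line" for n
    using sq by (auto simp: square_integrable_def)
  have "(\<integral>\<^sup>+x. (\<Sum>n. ennreal (2 ^ n * (norm (?d n x))\<^sup>2)) \<partial>half_line)
      = (\<Sum>n. \<integral>\<^sup>+x. ennreal (2 ^ n * (norm (?d n x))\<^sup>2) \<partial>half_line)"
    by (rule nn_integral_suminf) simp
  also have "\<dots> = (\<Sum>n. ennreal (2 ^ n * (norm (abs_l2 (?d n)))\<^sup>2))"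
    by (simp add: ennreal_mult nn_integral_cmult nn_integral_norm_abs_l2[OF d])
  also have "\<dots> \<le> (\<Sum>n. ennreal ((1/2) ^ n))"
  proof (intro suminf_le ennreal_leI)
    fix n
    have "(norm (abs_l2 (?d n)))\<^sup>2 \<le> ((1/2) ^ n)\<^sup>2"
      using fast[of n] by (intro power_mono) (simp_all add: diff_abs_l2 sq)
    then have "2 ^ n * (norm (abs_l2 (?d n)))\<^sup>2 \<le> 2 ^ n * ((1/2) ^ n)\<^sup>2"
      by simp
    also have "\<dots> = (1/2) ^ n"
      by (simp add: power2_eq_square power_divide)
    finally show "2 ^ n * (norm (abs_l2 (?d n)))\<^sup>2 \<le> (1/2) ^ n" .
  qed auto
  also have "(\<Sum>n. ennreal ((1/2) ^ n)) = ennreal 2"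
    using geometric_sums[of "1/2::real"] by (intro suminf_ennreal_eq) auto
  finally have "(\<integral>\<^sup>+x. (\<Sum>n. ennreal (2 ^ n * (norm (?d n x))\<^sup>2)) \<partial>half_line) \<noteq> \<infinity>"
    by (auto simp: top_unique)
  then have "AE x in half_line. (\<Sum>n. ennreal (2 ^ n * (norm (?d n x))\<^sup>2)) \<noteq> \<infinity>"
    by (intro nn_integral_noteq_infinite) auto
  then show ?thesis
  proof (rule AE_mp, intro AE_I2 impI)
    fix x
    assume *: "(\<Sum>n. ennreal (2 ^ n * (norm (?d n x))\<^sup>2)) \<noteq> \<infinity>"
    have "summable (\<lambda>n. 2 ^ n * (norm (?d n x))\<^sup>2)"
      using * by (intro summable_suminf_not_top) auto
    then have "summable (\<lambda>n. norm (?d n x))"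
    proof (rule summable_comparison_test'[OF summable_add])
      show "summable (\<lambda>n. (1/2::real) ^ n)"
        by (simp add: summable_geometric)
      fix n :: nat
      let ?a = "(1/2) ^ n :: real" and ?b = "norm (?d n x)"
      have "2 * ?b \<le> ?a + 2 ^ n * ?b\<^sup>2"
      proof -
        have "0 \<le> 2 ^ n * (?a - ?b)\<^sup>2"
          by simp
        also have "\<dots> = ?a - 2 * ?b + 2 ^ n * ?b\<^sup>2"
          by (simp add: power2_eq_square algebra_simps power_divide)
        finally show ?thesis by simp
      qed
      then show "norm ?b \<le> 2 ^ n * ?b\<^sup>2 + ?a"
        using norm_ge_zero[of "?d n x"] by (simp del: norm_ge_zero)
    qed
    then have "summable (\<lambda>n. ?d n x)"
      by (rule summable_norm_cancel)
    then have "convergent (\<lambda>n. \<Sum>i<n. ?d i x)"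
      by (simp add: summable_iff_convergent)
    then have "convergent (\<lambda>n. f n x - f 0 x)"
      by (simp add: sum_lessThan_telescope[of "\<lambda>i. f i x"])
    from convergent_add[OF this convergent_const[of "f 0 x"]] show "convergent (\<lambda>n. f n x)"
      by simp
  qed
qed

lemma l2_Cauchy_convergent:
  fixes X :: "nat \<Rightarrow> l2"
  assumes "Cauchy X"
  shows "convergent X"
proof -
  have "\<exists>N. \<forall>m\<ge>N. \<forall>n\<ge>N. norm (X m - X n) \<le> (1/2) ^ k" for k
    using CauchyD[OF assms, of "(1/2) ^ k"] by (auto intro: less_imp_le)
  then obtain N where N: "\<And>k m n. m \<ge> N k \<Longrightarrow> n \<ge> N k \<Longrightarrow> norm (X m - X n) \<le> (1/2) ^ k"
    by metis
  \<comment> \<open>sums of the thresholds, to make the subsequence strictly increasing\<close>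
  define r where "r k = (\<Sum>j\<le>k. N j + 1)" for k
  have rN: "r k \<ge> N k" for k
    unfolding r_def using member_le_sum[of k "{..k}" "\<lambda>j. N j + 1"] by simp
  have "strict_mono r"
    by (rule strict_monoI_Suc) (simp add: r_def)
  then have rr: "r j \<ge> N k" if "j \<ge> k" for j k
    using rN[of k] that by (meson order_trans strict_mono_less_eq)
  have "\<exists>f. square_integrable f \<and> X (r k) = abs_l2 f" for k
    by (metis l2_cases)
  then obtain f where sq: "\<And>k. square_integrable (f k)" and f: "\<And>k. X (r k) = abs_l2 (f k)"
    by metis
  have [measurable]: "f n \<in> borel_measurable half_line" for n
    using sq by (auto simp: square_integrable_def)
  have close: "norm (abs_l2 (f j) - abs_l2 (f k)) \<le> (1/2) ^ k" if "j \<ge> k" for j k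
    using N[OF rr[OF that] rN] by (simp add: f)
  have conv: "AE x in half_line. convergent (\<lambda>n. f n x)"
    by (intro AE_convergent_of_fast_Cauchy sq close) simp
  define g where "g x = lim (\<lambda>n. f n x)" for x
  have [measurable]: "g \<in> borel_measurable half_line"
    unfolding g_def by measurable
  have lim: "AE x in half_line. (\<lambda>n. f n x) \<longlonglongrightarrow> g x"
    using conv by eventually_elim (simp add: g_def convergent_LIMSEQ_iff)
  have fatou: "(\<integral>\<^sup>+x. ennreal ((norm (g x - f k x))\<^sup>2) \<partial>half_line) \<le> ennreal (((1/2) ^ k)\<^sup>2)" for k
  proof -
    have "(\<integral>\<^sup>+x. ennreal ((norm (g x - f k x))\<^sup>2) \<partial>half_line)
        = (\<integral>\<^sup>+x. liminf (\<lambda>j. ennreal ((norm (f j x - f k x))\<^sup>2)) \<partial>half_line)"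
    proof (intro nn_integral_cong_AE, use lim in eventually_elim)
      fix x
      assume "(\<lambda>n. f n x) \<longlonglongrightarrow> g x"
      then have "(\<lambda>j. ennreal ((norm (f j x - f k x))\<^sup>2)) \<longlonglongrightarrow> ennreal ((norm (g x - f k x))\<^sup>2)"
        by (intro tendsto_intros)
      then show "ennreal ((norm (g x - f k x))\<^sup>2) = liminf (\<lambda>j. ennreal ((norm (f j x - f k x))\<^sup>2))"
        by (intro lim_imp_Liminf[symmetric]) auto
    qed
    also have "\<dots> \<le> liminf (\<lambda>j. \<integral>\<^sup>+x. ennreal ((norm (f j x - f k x))\<^sup>2) \<partial>half_line)"
      by (intro nn_integral_liminf) simp
    also have "\<dots> = liminf (\<lambda>j. ennreal ((norm (abs_l2 (f j) - abs_l2 (f k)))\<^sup>2))"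
      by (simp add: nn_integral_norm_abs_l2 square_integrable_diff sq diff_abs_l2)
    also have "\<dots> \<le> limsup (\<lambda>j. ennreal ((norm (abs_l2 (f j) - abs_l2 (f k)))\<^sup>2))"
      by (rule Liminf_le_Limsup) simp
    also have "\<dots> \<le> ennreal (((1/2) ^ k)\<^sup>2)"
    proof (rule Limsup_bounded, rule eventually_sequentiallyI[of k])
      fix j assume "k \<le> j"
      show "ennreal ((norm (abs_l2 (f j) - abs_l2 (f k)))\<^sup>2) \<le> ennreal (((1/2) ^ k)\<^sup>2)"
        by (intro ennreal_leI power_mono close \<open>k \<le> j\<close>) simp
    qed
    finally show ?thesis .
  qed
  have sqd: "square_integrable (\<lambda>x. g x - f k x)" for k
    unfolding square_integrable_def
  proof (intro conjI integrableI_bounded)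
    show "(\<integral>\<^sup>+x. ennreal (norm ((norm (g x - f k x))\<^sup>2)) \<partial>half_line) < \<infinity>"
      using le_less_trans[OF fatou[of k] ennreal_less_top] by simp
  qed auto
  have sqg: "square_integrable g"
    using square_integrable_add[OF sqd[of 0] sq[of 0]] by simp
  have "norm (abs_l2 g - X (r k)) \<le> (1/2) ^ k" for k
  proof -
    have "ennreal ((norm (abs_l2 g - X (r k)))\<^sup>2) \<le> ennreal (((1/2) ^ k)\<^sup>2)"
      using fatou[of k] nn_integral_norm_abs_l2[OF sqd[of k]] by (simp add: f diff_abs_l2 sqg sq)
    then have "(norm (abs_l2 g - X (r k)))\<^sup>2 \<le> ((1/2) ^ k)\<^sup>2"
      by (subst (asm) ennreal_le_iff) simp_all
    then show ?thesis
      by (rule power2_le_imp_le) simp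
  qed
  then have "\<forall>\<^sub>F k in sequentially. norm (X (r k) - abs_l2 g) \<le> (1/2) ^ k"
    by (simp add: norm_minus_commute)
  then have "(\<lambda>k. X (r k) - abs_l2 g) \<longlonglongrightarrow> 0"
    by (rule Lim_null_comparison) (simp add: LIMSEQ_power_zero)
  then have "(\<lambda>k. X (r k)) \<longlonglongrightarrow> abs_l2 g"
    by (rule LIM_zero_cancel)
  then have "(X \<circ> r) \<longlonglongrightarrow> abs_l2 g"
    by (simp only: o_def)
  from Cauchy_converges_subseq[OF assms \<open>strict_mono r\<close> this] show ?thesis
    by (rule convergentI)
qed

instance l2 :: complete_space
  by standard (rule l2_Cauchy_convergent)

text \<open>A minimizing sequence for the distance to a closed subspace is Cauchy by the parallelogram
  identity.\<close>

lemma closed_subspace_projection: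
  fixes M :: "'a :: {real_inner, complete_space} set"
  assumes M: "subspace M" "closed M"
  obtains p where "p \<in> M" "\<And>m. m \<in> M \<Longrightarrow> inner (h - p) m = 0"
proof -
  define d where "d = Inf ((\<lambda>m. (norm (h - m))\<^sup>2) ` M)"
  have "M \<noteq> {}"
    using M(1) subspace_0 by blast
  have bdd: "bdd_below ((\<lambda>m. (norm (h - m))\<^sup>2) ` M)"
    by (rule bdd_belowI[of _ 0]) auto
  have d_le: "d \<le> (norm (h - m))\<^sup>2" if "m \<in> M" for m
    unfolding d_def using that bdd by (intro cInf_lower) auto
  have "\<exists>m\<in>M. (norm (h - m))\<^sup>2 < d + inverse (real (Suc n))" for n
    using cInf_lessD[of "(\<lambda>m. (norm (h - m))\<^sup>2) ` M" "d + inverse (real (Suc n))"] \<open>M \<noteq> {}\<close>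
    unfolding d_def by auto
  then obtain X where XM: "\<And>n. X n \<in> M" and X: "\<And>n. (norm (h - X n))\<^sup>2 < d + inverse (real (Suc n))"
    by metis
  have par: "(norm (X m - X n))\<^sup>2 \<le> 2 * (inverse (real (Suc m)) + inverse (real (Suc n)))" for m n
  proof -
    have "(1/2) *\<^sub>R (X m + X n) \<in> M"
      by (intro subspace_scale subspace_add M XM)
    from d_le[OF this] have "4 * d \<le> (2 * norm (h - (1/2) *\<^sub>R (X m + X n)))\<^sup>2"
      by (simp add: power_mult_distrib)
    also have "2 * norm (h - (1/2) *\<^sub>R (X m + X n)) = norm (2 *\<^sub>R (h - (1/2) *\<^sub>R (X m + X n)))"
      by simp
    also have "2 *\<^sub>R (h - (1/2) *\<^sub>R (X m + X n)) = (h - X m) + (h - X n)"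
      by (simp add: algebra_simps scaleR_2)
    finally have "4 * d \<le> (norm ((h - X m) + (h - X n)))\<^sup>2" .
    moreover have "(norm ((h - X m) + (h - X n)))\<^sup>2 + (norm (X m - X n))\<^sup>2
        = 2 * (norm (h - X m))\<^sup>2 + 2 * (norm (h - X n))\<^sup>2"
      by (simp add: power2_norm_eq_inner inner_diff_left inner_diff_right inner_add_left
          inner_add_right inner_commute)
    ultimately show ?thesis
      using X[of m] X[of n] by (simp add: algebra_simps)
  qed
  have "Cauchy X"
  proof (rule metric_CauchyI)
    fix e :: real
    assume "0 < e"
    then obtain N where N: "inverse (real (Suc N)) < e\<^sup>2 / 4"
      using reals_Archimedean[of "e\<^sup>2 / 4"] by auto
    show "\<exists>N. \<forall>m\<ge>N. \<forall>n\<ge>N. dist (X m) (X n) < e"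
    proof (intro exI[of _ N] allI impI)
      fix m n
      assume "N \<le> m" "N \<le> n"
      then have "inverse (real (Suc m)) \<le> inverse (real (Suc N))"
        "inverse (real (Suc n)) \<le> inverse (real (Suc N))"
        by (auto intro!: le_imp_inverse_le)
      then have "2 * (inverse (real (Suc m)) + inverse (real (Suc n)))
          \<le> 2 * (inverse (real (Suc N)) + inverse (real (Suc N)))"
        by (intro mult_left_mono add_mono) simp_all
      also have "\<dots> < e\<^sup>2"
        using N by (simp only: mult_2[symmetric] less_divide_eq_numeral1)
      finally have "(norm (X m - X n))\<^sup>2 < e\<^sup>2"
        using par[of m n] by (rule le_less_trans[rotated])
      then show "dist (X m) (X n) < e"
        using \<open>0 < e\<close> by (simp add: dist_norm power2_less_imp_less)
    qed
  qed
  then obtain p where p: "X \<longlonglongrightarrow> p"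
    using Cauchy_convergent convergent_def by blast
  have "p \<in> M"
    using closed_sequentially[OF M(2)] XM p by blast
  have "(norm (h - p))\<^sup>2 \<le> d + 0"
  proof (rule LIMSEQ_le)
    show "(\<lambda>n. (norm (h - X n))\<^sup>2) \<longlonglongrightarrow> (norm (h - p))\<^sup>2"
      by (intro tendsto_intros p)
    show "(\<lambda>n. d + inverse (real (Suc n))) \<longlonglongrightarrow> d + 0"
      by (intro tendsto_intros LIMSEQ_inverse_real_of_nat)
  qed (use X less_imp_le in blast)
  then have min: "(norm (h - p))\<^sup>2 \<le> (norm (h - m))\<^sup>2" if "m \<in> M" for m
    using d_le[OF that] by linarith
  have "inner (h - p) m = 0" if "m \<in> M" for m
  proof (cases "m = 0")
    case False
    define t where "t = inner (h - p) m / inner m m"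
    have "p + t *\<^sub>R m \<in> M"
      by (intro subspace_add subspace_scale M \<open>p \<in> M\<close> that)
    from min[OF this] have "(norm (h - p))\<^sup>2 \<le> (norm ((h - p) - t *\<^sub>R m))\<^sup>2"
      by (simp add: algebra_simps)
    also have "\<dots> = (norm (h - p))\<^sup>2 - 2 * t * inner (h - p) m + t\<^sup>2 * inner m m"
      using dot_norm_neg[of "h - p" "t *\<^sub>R m"]
      by (simp add: power_mult_distrib power2_norm_eq_inner[of m])
    also have "\<dots> = (norm (h - p))\<^sup>2 - (inner (h - p) m)\<^sup>2 / inner m m"
      using False by (simp add: t_def power2_eq_square field_simps)
    finally have "(inner (h - p) m)\<^sup>2 / inner m m \<le> 0"
      by simp
    moreover have "inner m m > 0"
      using False by simp
    ultimately show ?thesis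
      by (simp add: divide_le_0_iff)
  qed simp
  with \<open>p \<in> M\<close> show ?thesis
    using that by blast
qed

text \<open>The projection is orthogonal for the real inner product; orthogonality to \<open>\<i> m\<close> as well makes
  it orthogonal for the complex one.\<close>

lemma subspace_eq_UNIV_if_orthogonal_trivial:
  fixes M :: "l2 set"
  assumes M: "subspace M" "closed M" and scaleC: "\<And>c u. u \<in> M \<Longrightarrow> scaleC c u \<in> M"
    and trivial: "\<And>w. (\<And>m. m \<in> M \<Longrightarrow> cinner m w = 0) \<Longrightarrow> w = 0"
  shows "M = UNIV"
proof (intro equalityI subsetI UNIV_I)
  fix h
  obtain p where p: "p \<in> M" "\<And>m. m \<in> M \<Longrightarrow> inner (h - p) m = 0"
    using closed_subspace_projection[OF M] by metis
  have "cinner m (h - p) = 0" if "m \<in> M" for m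
  proof (rule complex_eqI)
    have "inner m (h - p) = 0"
      using p(2)[OF that] by (simp add: inner_commute)
    then show "Re (cinner m (h - p)) = Re 0"
      by (simp add: inner_l2_def)
    have "inner (scaleC (- \<i>) m) (h - p) = 0"
      using p(2)[OF scaleC[OF that]] by (metis inner_commute)
    then show "Im (cinner m (h - p)) = Im 0"
      by (simp add: inner_l2_def cinner_scaleC_left)
  qed
  then have "h - p = 0"
    by (rule trivial)
  with p(1) show "h \<in> M"
    by simp
qed

section \<open>Nonnegative self-adjoint extensions\<close>

lemma adjoint_op_iff: "(g, h) \<in> adjoint_op A \<longleftrightarrow> (\<forall>u v. (u, v) \<in> A \<longrightarrow> cinner v g = cinner u h)"
  by (auto simp: adjoint_op_def)

lemma adjoint_op_antimono: "A \<subseteq> B \<Longrightarrow> adjoint_op B \<subseteq> adjoint_op A"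
  by (auto simp: adjoint_op_def)

lemma adjoint_op_eqD:
  assumes "(g, h) \<in> adjoint_op A" "(u, v) \<in> A"
  shows "cinner v g = cinner u h"
  using assms by (auto simp: adjoint_op_iff)

lemma adjoint_op_add:
  assumes "(u, v) \<in> adjoint_op A" "(u', v') \<in> adjoint_op A"
  shows "(u + u', v + v') \<in> adjoint_op A"
  using assms by (auto simp: adjoint_op_iff cinner_linear)

lemma adjoint_op_diff:
  assumes "(u, v) \<in> adjoint_op A" "(u', v') \<in> adjoint_op A"
  shows "(u - u', v - v') \<in> adjoint_op A"
  using assms by (auto simp: adjoint_op_iff cinner_linear)

lemma adjoint_op_scaleC:
  assumes "(u, v) \<in> adjoint_op A"
  shows "(scaleC c u, scaleC c v) \<in> adjoint_op A"
  using assms by (auto simp: adjoint_op_iff cinner_scaleC_right)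

lemma adjoint_op_0: "(0, 0) \<in> adjoint_op A"
  by (auto simp: adjoint_op_iff)

lemma closed_adjoint_op: "closed (adjoint_op A)"
  unfolding closed_sequential_limits
proof (intro allI impI)
  fix X l
  assume X: "(\<forall>n. X n \<in> adjoint_op A) \<and> X \<longlonglongrightarrow> l"
  obtain g h where l: "l = (g, h)"
    by fastforce
  have lim: "(\<lambda>n. fst (X n)) \<longlonglongrightarrow> g" "(\<lambda>n. snd (X n)) \<longlonglongrightarrow> h"
    using X tendsto_fst[of X l] tendsto_snd[of X l] l by auto
  have "cinner v g = cinner u h" if "(u, v) \<in> A" for u v
  proof (rule LIMSEQ_unique)
    show "(\<lambda>n. cinner v (fst (X n))) \<longlonglongrightarrow> cinner v g"
      by (intro tendsto_intros lim)
    have "cinner v (fst (X n)) = cinner u (snd (X n))" for n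
      using X that by (intro adjoint_op_eqD[of _ _ A]) auto
    moreover have "(\<lambda>n. cinner u (snd (X n))) \<longlonglongrightarrow> cinner u h"
      by (intro tendsto_intros lim)
    ultimately show "(\<lambda>n. cinner v (fst (X n))) \<longlonglongrightarrow> cinner u h"
      by simp
  qed
  then show "l \<in> adjoint_op A"
    by (simp add: l adjoint_op_iff)
qed

lemma subset_adjoint_op_commute:
  assumes "A \<subseteq> adjoint_op B"
  shows "B \<subseteq> adjoint_op A"
proof (rule subrelI)
  fix u v
  assume uv: "(u, v) \<in> B"
  show "(u, v) \<in> adjoint_op A"
    unfolding adjoint_op_iff
  proof (intro allI impI)
    fix g h
    assume "(g, h) \<in> A"
    then have "cinner v g = cinner u h"
      using assms uv by (intro adjoint_op_eqD[of g h B]) auto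
    then show "cinner h u = cinner g v"
      by (metis cinner_commute)
  qed
qed

lemma adjoint_op_closure: "adjoint_op (closure A) = adjoint_op A"
proof (rule antisym)
  show "adjoint_op (closure A) \<subseteq> adjoint_op A"
    by (rule adjoint_op_antimono[OF closure_subset])
  have "closure A \<subseteq> adjoint_op (adjoint_op A)"
    by (rule closure_minimal[OF subset_adjoint_op_commute[OF order_refl] closed_adjoint_op])
  then show "adjoint_op A \<subseteq> adjoint_op (closure A)"
    by (rule subset_adjoint_op_commute)
qed

lemma
  assumes "nonneg_self_adjoint_extension A C"
  shows nonneg_extension_subset_adjoint: "C \<subseteq> adjoint_op A"
    and nonneg_extension_minimal: "adjoint_op (adjoint_op A) \<subseteq> C"
    and nonneg_extension_nonneg: "\<And>u v. (u, v) \<in> C \<Longrightarrow> cinner v u \<in> \<real>\<^sub>\<ge>\<^sub>0"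
    and nonneg_extension_diff:
      "\<And>u v u' v'. (u, v) \<in> C \<Longrightarrow> (u', v') \<in> C \<Longrightarrow> (u - u', v - v') \<in> C"
proof -
  have C: "A \<subseteq> C" "adjoint_op C = C" "nonneg_op C"
    using assms by (auto simp: nonneg_self_adjoint_extension_def self_adjoint_op_def)
  show 1: "C \<subseteq> adjoint_op A"
    using adjoint_op_antimono[OF C(1)] C(2) by simp
  show "adjoint_op (adjoint_op A) \<subseteq> C"
    using adjoint_op_antimono[OF 1] C(2) by simp
  show "\<And>u v. (u, v) \<in> C \<Longrightarrow> cinner v u \<in> \<real>\<^sub>\<ge>\<^sub>0"
    using C(3) by (auto simp: nonneg_op_def)
  show "\<And>u v u' v'. (u, v) \<in> C \<Longrightarrow> (u', v') \<in> C \<Longrightarrow> (u - u', v - v') \<in> C"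
    using adjoint_op_diff[of _ _ C] C(2) by simp
qed

text \<open>Self-adjoint operators are maximal among symmetric ones, since passing to the adjoint reverses
  inclusions.\<close>

lemma self_adjoint_subset_eq:
  assumes "self_adjoint_op B" "self_adjoint_op C" "C \<subseteq> B"
  shows "C = B"
  using adjoint_op_antimono[OF assms(3)] assms by (auto simp: self_adjoint_op_def)

lemma nonneg_op_shift_lower_bound:
  assumes "nonneg_op C" "(u, v) \<in> C" "0 < x"
  shows "x * norm u \<le> norm (v + x *\<^sub>R u)"
proof (cases "u = 0")
  case False
  have "cinner v u \<in> \<real>\<^sub>\<ge>\<^sub>0"
    using assms by (auto simp: nonneg_op_def)
  then have "0 \<le> inner v u"
    by (auto simp: inner_l2_def complex_nonneg_Reals_iff)
  then have "x * norm u * norm u \<le> inner (v + x *\<^sub>R u) u"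
    by (simp add: inner_add_left power2_norm_eq_inner[symmetric] power2_eq_square)
  also have "\<dots> \<le> norm (v + x *\<^sub>R u) * norm u"
    by (rule norm_cauchy_schwarz)
  finally show ?thesis
    using False by simp
qed simp

text \<open>The range of \<open>C + x\<close> is closed because \<open>C + x\<close> is bounded below, and a vector orthogonal to
  it is an eigenvector of \<open>C\<close> for the eigenvalue \<open>-x < 0\<close>.\<close>

lemma shifted_nonneg_self_adjoint_surj:
  assumes C: "self_adjoint_op C" "nonneg_op C" and x: "0 < x"
  obtains u v where "(u, v) \<in> C" "v + x *\<^sub>R u = h"
proof -
  have adj: "adjoint_op C = C"
    using C by (simp add: self_adjoint_op_def)
  note diff = adjoint_op_diff[of _ _ C, unfolded adj]
    and add = adjoint_op_add[of _ _ C, unfolded adj]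
    and scale = adjoint_op_scaleC[of _ _ C, unfolded adj]
    and zero = adjoint_op_0[of C, unfolded adj]
  define M where "M = {v + x *\<^sub>R u | u v. (u, v) \<in> C}"
  have M_scaleC: "scaleC c m \<in> M" if "m \<in> M" for c m
  proof -
    obtain u v where "(u, v) \<in> C" "m = v + x *\<^sub>R u"
      using \<open>m \<in> M\<close> unfolding M_def by blast
    then have "(scaleC c u, scaleC c v) \<in> C" "scaleC c m = scaleC c v + x *\<^sub>R scaleC c u"
      using scale by (simp_all add: scaleC_add_right scaleC_scaleR_commute)
    then show ?thesis
      unfolding M_def by blast
  qed
  have "subspace M"
  proof (rule subspaceI)
    show "0 \<in> M"
      unfolding M_def using zero by force
    show "a + b \<in> M" if ab: "a \<in> M" "b \<in> M" for a b
    proof -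
      obtain u v u' v' where "(u, v) \<in> C" "a = v + x *\<^sub>R u" "(u', v') \<in> C" "b = v' + x *\<^sub>R u'"
        using ab unfolding M_def by auto
      then show ?thesis
        unfolding M_def using add[of u v u' v']
        by (intro CollectI exI[of _ "u + u'"] exI[of _ "v + v'"]) (simp add: algebra_simps)
    qed
    show "r *\<^sub>R a \<in> M" if "a \<in> M" for a r
      using M_scaleC[OF that] by (simp add: scaleR_eq_scaleC)
  qed
  moreover have "closed M"
    unfolding closed_sequential_limits
  proof (intro allI impI)
    fix X l
    assume X: "(\<forall>n. X n \<in> M) \<and> X \<longlonglongrightarrow> l"
    then have "\<forall>n. \<exists>u v. (u, v) \<in> C \<and> X n = v + x *\<^sub>R u"
      unfolding M_def by blast
    then obtain U V where UV: "\<And>n. (U n, V n) \<in> C" and XUV: "\<And>n. X n = V n + x *\<^sub>R U n"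
      by metis
    have bound: "x * norm (U m - U n) \<le> norm (X m - X n)" for m n
      using nonneg_op_shift_lower_bound[OF C(2) diff[OF UV UV] x, of m n]
      by (simp add: XUV algebra_simps)
    have "Cauchy X"
      using X by (auto intro: LIMSEQ_imp_Cauchy)
    have "Cauchy U"
    proof (rule CauchyI)
      fix e :: real
      assume "0 < e"
      then obtain N where N: "\<And>m n. m \<ge> N \<Longrightarrow> n \<ge> N \<Longrightarrow> norm (X m - X n) < x * e"
        using CauchyD[OF \<open>Cauchy X\<close>, of "x * e"] x by auto
      have "norm (U m - U n) < e" if "m \<ge> N" "n \<ge> N" for m n
        using le_less_trans[OF bound N[OF that]] x by simp
      then show "\<exists>M. \<forall>m\<ge>M. \<forall>n\<ge>M. norm (U m - U n) < e"
        by blast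
    qed
    then obtain u where u: "U \<longlonglongrightarrow> u"
      using Cauchy_convergent convergent_def by blast
    have "(\<lambda>n. X n - x *\<^sub>R U n) \<longlonglongrightarrow> l - x *\<^sub>R u"
      using X by (intro tendsto_intros u) auto
    then have lim: "(\<lambda>n. (U n, V n)) \<longlonglongrightarrow> (u, l - x *\<^sub>R u)"
      by (intro tendsto_Pair u) (simp add: XUV)
    have "closed C"
      using closed_adjoint_op[of C] adj by simp
    from closed_sequentially[OF this UV lim] have "(u, l - x *\<^sub>R u) \<in> C" .
    then show "l \<in> M"
      unfolding M_def by (intro CollectI exI[of _ u] exI[of _ "l - x *\<^sub>R u"]) simp
  qed
  moreover have "w = 0" if w: "\<And>m. m \<in> M \<Longrightarrow> cinner m w = 0" for w
  proof -
    have "(w, - (x *\<^sub>R w)) \<in> adjoint_op C"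
      unfolding adjoint_op_iff
    proof (intro allI impI)
      fix u v
      assume "(u, v) \<in> C"
      then have "cinner (v + x *\<^sub>R u) w = 0"
        by (intro w) (auto simp: M_def)
      then show "cinner v w = cinner u (- (x *\<^sub>R w))"
        by (simp add: cinner_linear add_eq_0_iff)
    qed
    then have "(w, - (x *\<^sub>R w)) \<in> C"
      by (simp add: adj)
    from nonneg_op_shift_lower_bound[OF C(2) this x] x show ?thesis
      by (simp add: mult_le_0_iff)
  qed
  ultimately have "M = UNIV"
    using M_scaleC by (intro subspace_eq_UNIV_if_orthogonal_trivial) auto
  then have "h \<in> M"
    by simp
  then show thesis
    using that unfolding M_def by auto
qed

lemma Domain_shifted_inverse:
  assumes "nonneg_self_adjoint_extension A C" "0 < x"
  shows "Domain (shifted_inverse C x) = UNIV"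
proof -
  have "h \<in> Domain (shifted_inverse C x)" for h
    using assms shifted_nonneg_self_adjoint_surj[of C x h]
    unfolding nonneg_self_adjoint_extension_def shifted_inverse_def by (metis (mono_tags, lifting) DomainI mem_Collect_eq)
  then show ?thesis
    by auto
qed

text \<open>\<open>dominates_resolvent C B\<close> sharpens \<open>(B + x)\<^sup>-\<^sup>1 \<le> (C + x)\<^sup>-\<^sup>1\<close> for all \<open>x > 0\<close>: the difference
  of the quadratic forms at \<open>h\<close> is bounded below by \<open>x\<close> times the squared norm of the difference of
  the resolvents at \<open>h\<close>. The sharper form rules out equality unless \<open>B = C\<close>, which makes extremal
  extensions unique.\<close>

definition dominates_resolvent :: "l2_op \<Rightarrow> l2_op \<Rightarrow> bool"
  where "dominates_resolvent C B \<longleftrightarrow> (\<forall>x>0. \<forall>u v u' v'. (u, v) \<in> B \<longrightarrow> (u', v') \<in> C \<longrightarrow>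
    v + x *\<^sub>R u = v' + x *\<^sub>R u' \<longrightarrow>
    cinner (u' - u) (v + x *\<^sub>R u) - of_real (x * (norm (u' - u))\<^sup>2) \<in> \<real>\<^sub>\<ge>\<^sub>0)"

lemma dominates_resolvent_op_le:
  assumes B: "nonneg_self_adjoint_extension A B" and C: "nonneg_self_adjoint_extension A C"
    and dom: "dominates_resolvent C B" and x: "0 < x"
  shows "op_le (shifted_inverse B x) (shifted_inverse C x)"
  unfolding op_le_def
proof (intro conjI allI impI)
  fix h p q
  assume "(h, p) \<in> shifted_inverse B x" "(h, q) \<in> shifted_inverse C x"
  then obtain v v' where "(p, v) \<in> B" "h = v + x *\<^sub>R p" "(q, v') \<in> C" "h = v' + x *\<^sub>R q"
    by (auto simp: shifted_inverse_def)
  then have "cinner (q - p) h - of_real (x * (norm (q - p))\<^sup>2) \<in> \<real>\<^sub>\<ge>\<^sub>0"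
    using dom x unfolding dominates_resolvent_def by metis
  then have "cinner (q - p) h - of_real (x * (norm (q - p))\<^sup>2) + of_real (x * (norm (q - p))\<^sup>2) \<in> \<real>\<^sub>\<ge>\<^sub>0"
    using x by (intro nonneg_Reals_add_I) auto
  then show "cinner q h - cinner p h \<in> \<real>\<^sub>\<ge>\<^sub>0"
    by (simp add: cinner_linear)
qed (use Domain_shifted_inverse[OF B x] Domain_shifted_inverse[OF C x] in auto)

lemma dominates_resolvent_op_le_imp_eq:
  assumes B: "nonneg_self_adjoint_extension A B" and C: "nonneg_self_adjoint_extension A C"
    and dom: "dominates_resolvent C B" and le: "op_le (shifted_inverse C 1) (shifted_inverse B 1)"
  shows "B = C"
proof (rule self_adjoint_subset_eq)
  show "self_adjoint_op B" "self_adjoint_op C"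
    using B C by (auto simp: nonneg_self_adjoint_extension_def)
  show "B \<subseteq> C"
  proof (rule subrelI)
    fix u v
    assume uv: "(u, v) \<in> B"
    obtain u' v' where uv': "(u', v') \<in> C" "v' + 1 *\<^sub>R u' = v + 1 *\<^sub>R u"
      using C shifted_nonneg_self_adjoint_surj[of C 1 "v + 1 *\<^sub>R u"]
      unfolding nonneg_self_adjoint_extension_def by (metis zero_less_one)
    let ?h = "v + 1 *\<^sub>R u"
    have "cinner (u' - u) ?h - of_real (1 * (norm (u' - u))\<^sup>2) \<in> \<real>\<^sub>\<ge>\<^sub>0"
      using dom uv uv' unfolding dominates_resolvent_def by (metis zero_less_one)
    moreover have "(?h, u) \<in> shifted_inverse B 1" "(?h, u') \<in> shifted_inverse C 1"
      unfolding shifted_inverse_def using uv uv' by (auto simp del: scaleR_one) (metis scaleR_one)+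
    then have "cinner u ?h - cinner u' ?h \<in> \<real>\<^sub>\<ge>\<^sub>0"
      using le unfolding op_le_def by blast
    ultimately have "0 \<le> Re (cinner u' ?h - cinner u ?h) - (norm (u' - u))\<^sup>2"
        "0 \<le> Re (cinner u ?h - cinner u' ?h)"
      by (simp_all only: complex_nonneg_Reals_iff cinner_diff_left minus_complex.sel
          Re_complex_of_real mult_1)
    then have "(norm (u' - u))\<^sup>2 \<le> 0"
      by (simp only: minus_complex.sel)
    then have "u' = u"
      by simp
    with uv' show "(u, v) \<in> C"
      by simp
  qed
qed

lemma friedrichs_extension_eqI:
  assumes B: "nonneg_self_adjoint_extension A B"
    and dom: "\<And>C. nonneg_self_adjoint_extension A C \<Longrightarrow> dominates_resolvent C B"
  shows "friedrichs_extension A = B"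
  unfolding friedrichs_extension_def
proof (rule the_equality)
  show "is_friedrichs_extension A B"
    unfolding is_friedrichs_extension_def using B dominates_resolvent_op_le[OF B] dom by blast
next
  fix C
  assume "is_friedrichs_extension A C"
  then have "nonneg_self_adjoint_extension A C" "op_le (shifted_inverse C 1) (shifted_inverse B 1)"
    using B unfolding is_friedrichs_extension_def by auto
  then show "C = B"
    using dominates_resolvent_op_le_imp_eq[OF B] dom by metis
qed

lemma krein_extension_eqI:
  assumes B: "nonneg_self_adjoint_extension A B"
    and dom: "\<And>C. nonneg_self_adjoint_extension A C \<Longrightarrow> dominates_resolvent B C"
  shows "krein_extension A = B"
  unfolding krein_extension_def
proof (rule the_equality)
  show "is_krein_extension A B"
    unfolding is_krein_extension_def using B dominates_resolvent_op_le[OF _ B] dom by blast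
next
  fix C
  assume "is_krein_extension A C"
  then have "nonneg_self_adjoint_extension A C" "op_le (shifted_inverse B 1) (shifted_inverse C 1)"
    using B unfolding is_krein_extension_def by auto
  then show "C = B"
    using dominates_resolvent_op_le_imp_eq[OF _ B] dom by metis
qed

lemma dominates_resolvent_refl:
  assumes B: "nonneg_self_adjoint_extension A B"
  shows "dominates_resolvent B B"
  unfolding dominates_resolvent_def
proof (intro allI impI)
  fix x :: real and u v u' v'
  assume x: "0 < x" and uv: "(u, v) \<in> B" "(u', v') \<in> B" "v + x *\<^sub>R u = v' + x *\<^sub>R u'"
  have "(u' - u, v' - v) \<in> B"
    using nonneg_extension_diff[OF B] uv by blast
  from nonneg_op_shift_lower_bound[OF _ this x] B have "x * norm (u' - u) \<le> norm (v' - v + x *\<^sub>R (u' - u))"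
    by (simp add: nonneg_self_adjoint_extension_def)
  also have "v' - v + x *\<^sub>R (u' - u) = 0"
    using uv(3) by (simp add: algebra_simps)
  finally have "u' = u"
    using x by (simp add: mult_le_0_iff)
  then show "cinner (u' - u) (v + x *\<^sub>R u) - of_real (x * (norm (u' - u))\<^sup>2) \<in> \<real>\<^sub>\<ge>\<^sub>0"
    by simp
qed

text \<open>Let \<open>w\<close> be the difference of the resolvents at \<open>h\<close>, so that \<open>A\<^sup>* w = - x w\<close>. Subtracting from
  the resolvent of \<open>C\<close> at \<open>h\<close> the vector \<open>u - e \<in> dom A\<^sup>*\<^sup>*\<close> leaves \<open>w + e \<in> dom C\<close>, and the
  form of \<open>C\<close> at this vector tends to \<open>\<langle>w, h\<rangle> - x \<parallel>w\<parallel>\<^sup>2\<close> as \<open>e\<close> tends to zero in the form norm.\<close>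

lemma friedrichs_dominates:
  assumes B: "nonneg_self_adjoint_extension A B" and C: "nonneg_self_adjoint_extension A C"
    and approx: "\<And>u v. (u, v) \<in> B \<Longrightarrow> \<exists>e e' :: nat \<Rightarrow> l2.
      (\<forall>n. (u - e n, v - e' n) \<in> adjoint_op (adjoint_op A)) \<and> e \<longlonglongrightarrow> 0 \<and>
      (\<lambda>n. cinner (e' n) (e n)) \<longlonglongrightarrow> 0"
  shows "dominates_resolvent C B"
  unfolding dominates_resolvent_def
proof (intro allI impI)
  fix x :: real and u v u' v'
  assume x: "0 < x" and uv: "(u, v) \<in> B" "(u', v') \<in> C" "v + x *\<^sub>R u = v' + x *\<^sub>R u'"
  obtain e e' :: "nat \<Rightarrow> l2" where e: "\<And>n. (u - e n, v - e' n) \<in> adjoint_op (adjoint_op A)"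
      "e \<longlonglongrightarrow> 0" "(\<lambda>n. cinner (e' n) (e n)) \<longlonglongrightarrow> 0"
    using approx[OF uv(1)] by metis
  define h w where "h = v + x *\<^sub>R u" and "w = u' - u"
  have w': "v' - v = - (x *\<^sub>R w)"
    using uv(3) by (simp add: w_def algebra_simps)
  have "(w, v' - v) \<in> adjoint_op A"
    unfolding w_def using uv nonneg_extension_subset_adjoint B C by (intro adjoint_op_diff) blast+
  then have wA: "(w, - (x *\<^sub>R w)) \<in> adjoint_op A"
    by (simp add: w')
  have pos: "cinner h w - x * (norm w)\<^sup>2 - x * cinner w (e n) - x * cinner (e n) w + cinner (e' n) (e n) \<in> \<real>\<^sub>\<ge>\<^sub>0" for n
  proof -
    have "(u' - (u - e n), v' - (v - e' n)) \<in> C"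
      by (rule nonneg_extension_diff[OF C uv(2) subsetD[OF nonneg_extension_minimal[OF C] e(1)]])
    then have "cinner (v' - (v - e' n)) (u' - (u - e n)) \<in> \<real>\<^sub>\<ge>\<^sub>0"
      by (rule nonneg_extension_nonneg[OF C])
    also have "v' - (v - e' n) = e' n - x *\<^sub>R w"
      using w' by (simp add: algebra_simps)
    also have "u' - (u - e n) = w + e n"
      by (simp add: w_def)
    finally have "cinner (e' n - x *\<^sub>R w) (w + e n) \<in> \<real>\<^sub>\<ge>\<^sub>0" .
    moreover have "cinner (e' n) w = cinner h w - x * cinner (e n) w"
      using arg_cong[OF adjoint_op_eqD[OF e(1) wA, of n], of cnj]
      by (simp add: h_def cinner_linear cinner_commute[symmetric] algebra_simps)
    ultimately show ?thesis
      by (simp add: cinner_linear cinner_self[of w] algebra_simps)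
  qed
  have lim: "(\<lambda>n. cinner h w - x * (norm w)\<^sup>2 - x * cinner w (e n) - x * cinner (e n) w + cinner (e' n) (e n))
      \<longlonglongrightarrow> cinner h w - x * (norm w)\<^sup>2 - x * cinner w 0 - x * cinner 0 w + 0"
    by (intro tendsto_add[OF _ e(3)] tendsto_diff tendsto_mult tendsto_const tendsto_cinner e(2))
  have "cinner h w - x * (norm w)\<^sup>2 - x * cinner w 0 - x * cinner 0 w + 0 \<in> \<real>\<^sub>\<ge>\<^sub>0"
    by (rule closed_sequentially[OF closed_nonneg_Reals_complex pos lim])
  then have "cinner w h - x * (norm w)\<^sup>2 \<in> \<real>\<^sub>\<ge>\<^sub>0"
    using cinner_commute[of w h] by (auto simp: complex_nonneg_Reals_iff)
  then show "cinner (u' - u) (v + x *\<^sub>R u) - of_real (x * (norm (u' - u))\<^sup>2) \<in> \<real>\<^sub>\<ge>\<^sub>0"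
    by (simp add: w_def h_def)
qed

text \<open>The dual argument, with \<open>w\<close> replaced by its negative: now the form of \<open>C\<close> at
  \<open>e - w\<close> is expanded and it is \<open>A\<^sup>* e\<close> rather than \<open>e\<close> that tends to zero.\<close>

lemma krein_dominates:
  assumes B: "nonneg_self_adjoint_extension A B" and C: "nonneg_self_adjoint_extension A C"
    and approx: "\<And>u v. (u, v) \<in> B \<Longrightarrow> \<exists>e e' :: nat \<Rightarrow> l2.
      (\<forall>n. (u - e n, v - e' n) \<in> adjoint_op (adjoint_op A)) \<and> e' \<longlonglongrightarrow> 0 \<and>
      (\<lambda>n. cinner (e' n) (e n)) \<longlonglongrightarrow> 0"
  shows "dominates_resolvent B C"
  unfolding dominates_resolvent_def
proof (intro allI impI)
  fix x :: real and u v u' v'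
  assume x: "0 < x" and uv': "(u', v') \<in> C" "(u, v) \<in> B" "v' + x *\<^sub>R u' = v + x *\<^sub>R u"
  obtain e e' :: "nat \<Rightarrow> l2" where e: "\<And>n. (u - e n, v - e' n) \<in> adjoint_op (adjoint_op A)"
      "e' \<longlonglongrightarrow> 0" "(\<lambda>n. cinner (e' n) (e n)) \<longlonglongrightarrow> 0"
    using approx[OF uv'(2)] by metis
  define h w where "h = v + x *\<^sub>R u" and "w = u - u'"
  have w': "v - v' = - (x *\<^sub>R w)"
    using uv'(3) by (simp add: w_def algebra_simps)
  have "(w, v - v') \<in> adjoint_op A"
    unfolding w_def using uv' nonneg_extension_subset_adjoint B C by (intro adjoint_op_diff) blast+
  then have wA: "(w, - (x *\<^sub>R w)) \<in> adjoint_op A"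
    by (simp add: w')
  have pos: "cinner w h - x * (norm w)\<^sup>2 - cinner w (e' n) - cinner (e' n) w + cinner (e' n) (e n) \<in> \<real>\<^sub>\<ge>\<^sub>0" for n
  proof -
    have "(u' - (u - e n), v' - (v - e' n)) \<in> C"
      by (rule nonneg_extension_diff[OF C uv'(1) subsetD[OF nonneg_extension_minimal[OF C] e(1)]])
    then have "cinner (v' - (v - e' n)) (u' - (u - e n)) \<in> \<real>\<^sub>\<ge>\<^sub>0"
      by (rule nonneg_extension_nonneg[OF C])
    also have "v' - (v - e' n) = e' n + x *\<^sub>R w"
      using w' by (simp add: algebra_simps)
    also have "u' - (u - e n) = e n - w"
      by (simp add: w_def)
    finally have "cinner (e' n + x *\<^sub>R w) (e n - w) \<in> \<real>\<^sub>\<ge>\<^sub>0" .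
    moreover have "x * cinner w (e n) = cinner w h - cinner w (e' n)"
      using adjoint_op_eqD[OF e(1) wA, of n]
      by (simp add: h_def cinner_linear algebra_simps)
    ultimately show ?thesis
      by (simp add: cinner_linear cinner_self[of w] algebra_simps)
  qed
  have lim: "(\<lambda>n. cinner w h - x * (norm w)\<^sup>2 - cinner w (e' n) - cinner (e' n) w + cinner (e' n) (e n))
      \<longlonglongrightarrow> cinner w h - x * (norm w)\<^sup>2 - cinner w 0 - cinner 0 w + 0"
    by (intro tendsto_add[OF _ e(3)] tendsto_diff tendsto_mult tendsto_const tendsto_cinner e(2))
  have "cinner w h - x * (norm w)\<^sup>2 - cinner w 0 - cinner 0 w + 0 \<in> \<real>\<^sub>\<ge>\<^sub>0"
    by (rule closed_sequentially[OF closed_nonneg_Reals_complex pos lim])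
  then show "cinner (u - u') (v' + x *\<^sub>R u') - of_real (x * (norm (u - u'))\<^sup>2) \<in> \<real>\<^sub>\<ge>\<^sub>0"
    using uv'(3) by (simp add: w_def h_def)
qed

section \<open>Boundary triplets\<close>

lemma boundary_triplet_swap:
  assumes "boundary_triplet T \<Gamma>\<^sub>0 \<Gamma>\<^sub>1"
  shows "boundary_triplet T \<Gamma>\<^sub>1 (\<lambda>u. - \<Gamma>\<^sub>0 u)"
proof -
  have surj: "(\<lambda>u. (\<Gamma>\<^sub>0 u, \<Gamma>\<^sub>1 u)) ` Domain T = UNIV"
    using assms by (simp add: boundary_triplet_def)
  have "(\<lambda>u. (\<Gamma>\<^sub>1 u, - \<Gamma>\<^sub>0 u)) ` Domain T = (\<lambda>(a, b). (b, - a)) ` (\<lambda>u. (\<Gamma>\<^sub>0 u, \<Gamma>\<^sub>1 u)) ` Domain T"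
    by (simp add: image_image)
  also have "\<dots> = UNIV"
    unfolding surj by (auto simp: image_iff) (metis minus_minus)
  finally show ?thesis
    using assms unfolding boundary_triplet_def by (auto; force)
qed

context
  fixes A :: l2_op and \<Gamma>\<^sub>0 \<Gamma>\<^sub>1
  assumes bt: "boundary_triplet (adjoint_op A) \<Gamma>\<^sub>0 \<Gamma>\<^sub>1"
    and symmetric: "A \<subseteq> adjoint_op A" and dense: "closure (Domain A) = UNIV"
begin

lemma boundary_triplet_green:
  assumes "(f, f') \<in> adjoint_op A" "(g, g') \<in> adjoint_op A"
  shows "cinner f' g - cinner f g' = \<Gamma>\<^sub>1 f * cnj (\<Gamma>\<^sub>0 g) - \<Gamma>\<^sub>0 f * cnj (\<Gamma>\<^sub>1 g)"
  using bt assms unfolding boundary_triplet_def by fast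

lemma boundary_triplet_surj:
  obtains g g' where "(g, g') \<in> adjoint_op A" "\<Gamma>\<^sub>0 g = a" "\<Gamma>\<^sub>1 g = b"
proof -
  have "(a, b) \<in> (\<lambda>u. (\<Gamma>\<^sub>0 u, \<Gamma>\<^sub>1 u)) ` Domain (adjoint_op A)"
    using bt unfolding boundary_triplet_def by auto
  then show ?thesis
    using that by auto
qed

lemma boundary_triplet_scale:
  assumes "(f, f') \<in> adjoint_op A"
  shows "\<Gamma>\<^sub>0 (scaleC c f) = c * \<Gamma>\<^sub>0 f" "\<Gamma>\<^sub>1 (scaleC c f) = c * \<Gamma>\<^sub>1 f"
  using bt DomainI[OF assms] unfolding boundary_triplet_def by simp_all

lemma boundary_triplet_add:
  assumes "(f, f') \<in> adjoint_op A" "(g, g') \<in> adjoint_op A"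
  shows "\<Gamma>\<^sub>0 (f + g) = \<Gamma>\<^sub>0 f + \<Gamma>\<^sub>0 g" "\<Gamma>\<^sub>1 (f + g) = \<Gamma>\<^sub>1 f + \<Gamma>\<^sub>1 g"
  using bt DomainI[OF assms(1)] DomainI[OF assms(2)] unfolding boundary_triplet_def by simp_all

lemma boundary_triplet_diff:
  assumes "(f, f') \<in> adjoint_op A" "(g, g') \<in> adjoint_op A"
  shows "\<Gamma>\<^sub>0 (f - g) = \<Gamma>\<^sub>0 f - \<Gamma>\<^sub>0 g" "\<Gamma>\<^sub>1 (f - g) = \<Gamma>\<^sub>1 f - \<Gamma>\<^sub>1 g"
  using boundary_triplet_add[OF assms(1) adjoint_op_scaleC[OF assms(2), of "-1"]]
    boundary_triplet_scale[OF assms(2), of "-1"]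
  by (simp_all add: minus_l2_def uminus_l2_def)

text \<open>As self-adjoint extensions of \<open>A\<close> contain \<open>A\<^sup>*\<^sup>*\<close>, functions with vanishing boundary values
  belong to all of them.\<close>

lemma boundary_values_zero_imp_biadjoint:
  assumes "(f, f') \<in> adjoint_op A" "\<Gamma>\<^sub>0 f = 0" "\<Gamma>\<^sub>1 f = 0"
  shows "(f, f') \<in> adjoint_op (adjoint_op A)"
  unfolding adjoint_op_iff[of f]
proof (intro allI impI)
  fix g g'
  assume "(g, g') \<in> adjoint_op A"
  from boundary_triplet_green[OF this assms(1)] assms show "cinner g' f = cinner g f'"
    by simp
qed

lemma boundary_values_zero_on_operator:
  assumes "(f, f') \<in> A"
  shows "\<Gamma>\<^sub>0 f = 0" "\<Gamma>\<^sub>1 f = 0"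
proof -
  have f: "(f, f') \<in> adjoint_op A"
    using assms symmetric by blast
  have "\<Gamma>\<^sub>1 f * cnj a - \<Gamma>\<^sub>0 f * cnj b = 0" for a b
  proof -
    obtain g g' where g: "(g, g') \<in> adjoint_op A" "\<Gamma>\<^sub>0 g = a" "\<Gamma>\<^sub>1 g = b"
      using boundary_triplet_surj .
    show ?thesis
      using boundary_triplet_green[OF f g(1)] adjoint_op_eqD[OF g(1) assms] g by simp
  qed
  from this[of 0 1] this[of 1 0] show "\<Gamma>\<^sub>0 f = 0" "\<Gamma>\<^sub>1 f = 0"
    by simp_all
qed

lemma single_valued_adjoint: "single_valued (adjoint_op A)"
proof (rule single_valuedI)
  fix u v w
  assume "(u, v) \<in> adjoint_op A" "(u, w) \<in> adjoint_op A"
  from adjoint_op_diff[OF this] have "cinner f (v - w) = 0" if "f \<in> Domain A" for f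
    using that by (auto simp: adjoint_op_iff)
  moreover have "closed {f. cinner f (v - w) = 0}"
    by (intro closed_Collect_eq continuous_intros
        bounded_linear.continuous_on[OF bounded_bilinear.bounded_linear_left[OF bounded_bilinear_cinner]])
  ultimately have "closure (Domain A) \<subseteq> {f. cinner f (v - w) = 0}"
    by (intro closure_minimal) auto
  then have "cinner (v - w) (v - w) = 0"
    using dense by auto
  then show "v = w"
    by (simp add: cinner_self)
qed

text \<open>Green's identity shows that the restriction is symmetric. Conversely, an element \<open>g\<close> of the
  domain of its adjoint is paired with some \<open>f\<close> such that \<open>\<Gamma>\<^sub>0 f = 0\<close> and \<open>\<Gamma>\<^sub>1 f = 1\<close>, and what
  remains of the identity is \<open>\<Gamma>\<^sub>0 g = 0\<close>.\<close>

lemma self_adjoint_boundary_kernel: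
  "self_adjoint_op {(f, f') \<in> adjoint_op A. \<Gamma>\<^sub>0 f = 0}" (is "self_adjoint_op ?B")
proof -
  have AB: "A \<subseteq> ?B"
    using symmetric boundary_values_zero_on_operator by auto
  have "linear_op ?B"
    unfolding linear_op_def
  proof (intro conjI allI impI)
    show "single_valued ?B"
      by (rule single_valued_subset[OF _ single_valued_adjoint]) auto
    show "(0, 0) \<in> ?B"
      using boundary_triplet_scale(1)[OF adjoint_op_0, of 0] adjoint_op_0[of A]
        scaleR_eq_scaleC[of 0 "0::l2"] by simp
  qed (auto simp: boundary_triplet_add boundary_triplet_scale intro: adjoint_op_add adjoint_op_scaleC)
  moreover have "closure (Domain ?B) = UNIV"
    using closure_mono[OF Domain_mono[OF AB]] dense by auto
  moreover have "adjoint_op ?B = ?B"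
  proof (rule antisym)
    show "?B \<subseteq> adjoint_op ?B"
    proof (rule subrelI)
      fix g g'
      assume g: "(g, g') \<in> ?B"
      show "(g, g') \<in> adjoint_op ?B"
        unfolding adjoint_op_iff[of g g']
      proof (intro allI impI)
        fix f f'
        assume "(f, f') \<in> ?B"
        with g show "cinner f' g = cinner f g'"
          using boundary_triplet_green[of f f' g g'] by simp
      qed
    qed
    show "adjoint_op ?B \<subseteq> ?B"
    proof (rule subrelI)
      fix g g'
      assume g: "(g, g') \<in> adjoint_op ?B"
      then have gA: "(g, g') \<in> adjoint_op A"
        using adjoint_op_antimono[OF AB] by blast
      obtain f f' where f: "(f, f') \<in> adjoint_op A" "\<Gamma>\<^sub>0 f = 0" "\<Gamma>\<^sub>1 f = 1"
        using boundary_triplet_surj .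
      have "cinner f' g = cinner f g'"
        using f by (intro adjoint_op_eqD[OF g]) simp
      with boundary_triplet_green[OF f(1) gA] f gA show "(g, g') \<in> ?B"
        by simp
    qed
  qed
  ultimately show ?thesis
    by (simp add: self_adjoint_op_def)
qed

end

section \<open>Absolutely continuous functions\<close>

text \<open>Absolute continuity for families of intervals over an arbitrary finite index set, so that it
  applies directly to tagged divisions.\<close>

lemma absolutely_continuous_finite_family:
  assumes "absolutely_continuous_on_interval a b F" "0 < \<epsilon>"
  obtains \<delta> where "0 < \<delta>" "\<forall>I s t. finite I \<longrightarrow> (\<forall>i\<in>I. a \<le> s i \<and> s i \<le> t i \<and> t i \<le> b) \<longrightarrow>
      (\<forall>i\<in>I. \<forall>j\<in>I. i \<noteq> j \<longrightarrow> {s i<..<t i} \<inter> {s j<..<t j} = {}) \<longrightarrow>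
      (\<Sum>i\<in>I. t i - s i) < \<delta> \<longrightarrow> (\<Sum>i\<in>I. norm (F (t i) - F (s i))) < \<epsilon>"
proof -
  obtain \<delta> where "0 < \<delta>" and \<delta>: "\<forall>(n::nat) s t. (\<forall>i<n. a \<le> s i \<and> s i \<le> t i \<and> t i \<le> b) \<longrightarrow>
      (\<forall>i<n. \<forall>j<n. i \<noteq> j \<longrightarrow> {s i<..<t i} \<inter> {s j<..<t j} = {}) \<longrightarrow>
      (\<Sum>i<n. t i - s i) < \<delta> \<longrightarrow> (\<Sum>i<n. norm (F (t i) - F (s i))) < \<epsilon>"
    using assms(1)[unfolded absolutely_continuous_on_interval_def, rule_format, OF assms(2)] by (elim exE conjE)
  show thesis
  proof (rule that[OF \<open>0 < \<delta>\<close>], intro allI impI)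
    fix I :: "'a set" and s t :: "'a \<Rightarrow> real"
    assume I: "finite I" "\<forall>i\<in>I. a \<le> s i \<and> s i \<le> t i \<and> t i \<le> b"
      "\<forall>i\<in>I. \<forall>j\<in>I. i \<noteq> j \<longrightarrow> {s i<..<t i} \<inter> {s j<..<t j} = {}"
      "(\<Sum>i\<in>I. t i - s i) < \<delta>"
    obtain h where h: "bij_betw h {..<card I} I"
      using ex_bij_betw_nat_finite[OF I(1)] by (auto simp: atLeast0LessThan)
    have hI: "h i \<in> I" if "i < card I" for i
      using h that by (auto simp: bij_betw_def)
    have inj: "h i \<noteq> h j" if "i < card I" "j < card I" "i \<noteq> j" for i j
      using h that by (auto simp: bij_betw_def inj_on_def)
    have "(\<Sum>i<card I. norm (F (t (h i)) - F (s (h i)))) < \<epsilon>"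
    proof (rule \<delta>[rule_format])
      show "(\<Sum>i<card I. t (h i) - s (h i)) < \<delta>"
        using I(4) sum.reindex_bij_betw[OF h, of "\<lambda>i. t i - s i"] by simp
    qed (use I(2,3) hI inj in auto)
    then show "(\<Sum>i\<in>I. norm (F (t i) - F (s i))) < \<epsilon>"
      using sum.reindex_bij_betw[OF h, of "\<lambda>i. norm (F (t i) - F (s i))"] by simp
  qed
qed

lemma tagged_division_interval:
  fixes p :: "(real \<times> real set) set"
  assumes "p tagged_partial_division_of {a..b}" "(x, K) \<in> p"
  shows "K = {Inf K..Sup K}" "a \<le> Inf K" "Inf K \<le> x" "x \<le> Sup K" "Sup K \<le> b"
    "interior K = {Inf K<..<Sup K}" "measure lborel K = Sup K - Inf K"
proof -
  obtain u v where K: "K = cbox u v"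
    using tagged_partial_division_ofD(4)[OF assms] by blast
  have x: "x \<in> K" "K \<subseteq> {a..b}"
    using tagged_partial_division_ofD(2,3)[OF assms] by blast+
  then have "u \<le> v"
    by (auto simp: K)
  then have [simp]: "Inf K = u" "Sup K = v"
    by (auto simp: K)
  show "K = {Inf K..Sup K}" "a \<le> Inf K" "Inf K \<le> x" "x \<le> Sup K" "Sup K \<le> b"
    "interior K = {Inf K<..<Sup K}" "measure lborel K = Sup K - Inf K"
    using x \<open>u \<le> v\<close> unfolding \<open>Inf K = u\<close> \<open>Sup K = v\<close> by (auto simp: K)
qed

lemma sum_content_tagged_le:
  fixes p :: "(real \<times> real set) set"
  assumes p: "p tagged_partial_division_of {a..b}" and U: "U \<in> lmeasurable"
    and sub: "\<And>x K. (x, K) \<in> p \<Longrightarrow> K \<subseteq> U"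
  shows "(\<Sum>(x, K)\<in>p. measure lborel K) \<le> measure lebesgue U"
proof -
  have "finite p"
    using p by (simp add: tagged_partial_division_of_def)
  have "(\<Sum>(x, K)\<in>p. measure lborel K) = (\<Sum>i\<in>p. measure lebesgue (interior (snd i)))"
  proof (rule sum.cong, safe)
    fix x K
    assume "(x, K) \<in> p"
    note * = tagged_division_interval[OF p this]
    show "measure lborel K = measure lebesgue (interior (snd (x, K)))"
      using *(3,4) unfolding snd_conv *(6,7) by simp
  qed
  also have "\<dots> = measure lebesgue (\<Union>i\<in>p. interior (snd i))"
  proof (rule measure_finite_Union[symmetric])
    show "disjoint_family_on (\<lambda>i. interior (snd i)) p"
      unfolding disjoint_family_on_def
      using tagged_partial_division_ofD(5)[OF p] by (metis prod.collapse)
    show "(\<lambda>i. interior (snd i)) ` p \<subseteq> sets lebesgue"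
      by auto
    show "emeasure lebesgue (interior (snd i)) \<noteq> \<infinity>" if "i \<in> p" for i
      using tagged_division_interval(3,4,6)[OF p, of "fst i" "snd i"] that by simp
  qed fact
  also have "\<dots> \<le> measure lebesgue U"
    using sub interior_subset by (intro measure_mono_fmeasurable U) (fastforce intro: borel_open)+
  finally show ?thesis .
qed

text \<open>A Riemann sum is compared with the telescoping sum of the increments of \<open>F\<close>. At tags outside
  the exceptional null set the two are close by differentiability; the intervals with tags in the
  null set can be forced into an open set of small measure, where absolute continuity bounds the
  increments.\<close>

theorem absolutely_continuous_FTC:
  assumes "a \<le> b" and ac: "absolutely_continuous_on_interval a b F" and N: "negligible N"
    and deriv: "\<And>x. x \<in> {a..b} - N \<Longrightarrow> (F has_vector_derivative f x) (at x within {a..b})"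
  shows "(f has_integral (F b - F a)) {a..b}"
proof -
  define f0 where "f0 x = (if x \<in> N then 0 else f x)" for x
  have "(f0 has_integral (F b - F a)) {a..b}"
    unfolding has_integral_real
  proof (intro allI impI)
    fix e :: real
    assume "0 < e"
    define \<epsilon> where "\<epsilon> = e / (2 * (b - a + 1))"
    have "0 < \<epsilon>"
      using \<open>0 < e\<close> \<open>a \<le> b\<close> by (simp add: \<epsilon>_def)
    obtain \<delta> where "0 < \<delta>" and \<delta>: "\<forall>(I :: (real \<times> real set) set) s t. finite I \<longrightarrow> (\<forall>i\<in>I. a \<le> s i \<and> s i \<le> t i \<and> t i \<le> b) \<longrightarrow>
      (\<forall>i\<in>I. \<forall>j\<in>I. i \<noteq> j \<longrightarrow> {s i<..<t i} \<inter> {s j<..<t j} = {}) \<longrightarrow>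
      (\<Sum>i\<in>I. t i - s i) < \<delta> \<longrightarrow> (\<Sum>i\<in>I. norm (F (t i) - F (s i))) < e / 2"
      using absolutely_continuous_finite_family[OF ac half_gt_zero[OF \<open>0 < e\<close>], where 'a = "real \<times> real set"] .
    obtain U where U: "open U" "N \<subseteq> U" "U \<in> lmeasurable" "measure lebesgue U < \<delta>"
    proof -
      obtain T where T: "open T" "N \<subseteq> T" "T - N \<in> lmeasurable" "emeasure lebesgue (T - N) < ennreal \<delta>"
        using sets_lebesgue_outer_open[OF negligible_imp_sets[OF N] \<open>0 < \<delta>\<close>] .
      have T_eq: "T = (T - N) \<union> N"
        using T(2) by auto
      have Tm: "T \<in> lmeasurable"
        by (subst T_eq, rule fmeasurable.Un[OF T(3) negligible_imp_measurable[OF N]])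
      have "emeasure lebesgue (T - N) = measure lebesgue (T - N)"
        using T(3) by (rule emeasure_eq_measure2)
      then have "measure lebesgue (T - N) < \<delta>"
        using T(4) \<open>0 < \<delta>\<close> by (simp add: ennreal_less_iff)
      moreover have "measure lebesgue T = measure lebesgue (T - N)"
        by (rule measure_negligible_symdiff[OF T(3)])
          (rule negligible_subset[OF N], auto)
      ultimately show thesis
        using that T Tm by simp
    qed
    have "\<exists>d>0. \<forall>y\<in>{a..b}. \<bar>y - x\<bar> < d \<longrightarrow> norm (F y - F x - (y - x) *\<^sub>R f x) \<le> \<epsilon> * \<bar>y - x\<bar>"
      if "x \<in> {a..b} - N" for x
      using deriv[OF that] \<open>0 < \<epsilon>\<close> unfolding has_vector_derivative_def has_derivative_within_alt by simp
    then obtain d where d_pos: "\<And>x. x \<in> {a..b} - N \<Longrightarrow> 0 < d x"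
      and d: "\<And>x y. x \<in> {a..b} - N \<Longrightarrow> y \<in> {a..b} \<Longrightarrow> \<bar>y - x\<bar> < d x \<Longrightarrow>
        norm (F y - F x - (y - x) *\<^sub>R f x) \<le> \<epsilon> * \<bar>y - x\<bar>"
      by metis
    define \<gamma> where "\<gamma> x = (if x \<in> N then U else if x \<in> {a..b} then ball x (d x) else UNIV)" for x
    have g: "gauge \<gamma>"
      unfolding gauge_def \<gamma>_def using U d_pos by auto
    have bd: "norm ((\<Sum>(x, K)\<in>p. measure lborel K *\<^sub>R f0 x) - (F b - F a)) < e"
      if p: "p tagged_division_of {a..b}" and fine: "\<gamma> fine p" for p
    proof -
      have pp: "p tagged_partial_division_of {a..b}"
        using p by (simp add: tagged_division_of_def)
      then have "finite p"
        by (simp add: tagged_partial_division_of_def)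
      note int = tagged_division_interval[OF pp]
      have fineD: "K \<subseteq> \<gamma> x" if "(x, K) \<in> p" for x K
        using fine that unfolding fine_def by blast
      let ?D = "\<lambda>(x, K). measure lborel K *\<^sub>R f0 x - (F (Sup K) - F (Inf K))"
      define p1 where "p1 = {(x, K) \<in> p. x \<in> N}"
      define p2 where "p2 = {(x, K) \<in> p. x \<notin> N}"
      have "(\<Sum>(x, K)\<in>p. measure lborel K *\<^sub>R f0 x) - (F b - F a) = (\<Sum>i\<in>p. ?D i)"
        unfolding additive_tagged_division_1[OF \<open>a \<le> b\<close> p, of F, symmetric]
        by (simp add: case_prod_beta sum_subtractf)
      also have "\<dots> = (\<Sum>i\<in>p1. ?D i) + (\<Sum>i\<in>p2. ?D i)"
      proof -
        have "sum ?D (p1 \<union> p2) = sum ?D p1 + sum ?D p2"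
          using \<open>finite p\<close> by (intro sum.union_disjoint) (auto simp: p1_def p2_def intro: rev_finite_subset)
        moreover have "p1 \<union> p2 = p"
          by (auto simp: p1_def p2_def)
        ultimately show ?thesis
          by simp
      qed
      also have "norm \<dots> \<le> (\<Sum>i\<in>p1. norm (?D i)) + (\<Sum>i\<in>p2. norm (?D i))"
        by (intro norm_triangle_mono norm_sum)
      also have "(\<Sum>i\<in>p1. norm (?D i)) < e / 2"
      proof -
        have p1: "p1 tagged_partial_division_of {a..b}"
          by (rule tagged_partial_division_subset[OF pp]) (auto simp: p1_def)
        have "(\<Sum>i\<in>p1. norm (F (Sup (snd i)) - F (Inf (snd i)))) < e / 2"
        proof (rule \<delta>[rule_format])
          show "finite p1"
            using p1 by (simp add: tagged_partial_division_of_def)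
          show "a \<le> Inf (snd i) \<and> Inf (snd i) \<le> Sup (snd i) \<and> Sup (snd i) \<le> b" if "i \<in> p1" for i
            using that tagged_division_interval(2-5)[OF p1, of "fst i" "snd i"] by auto
          show "{Inf (snd i)<..<Sup (snd i)} \<inter> {Inf (snd j)<..<Sup (snd j)} = {}"
            if "i \<in> p1" "j \<in> p1" "i \<noteq> j" for i j
          proof -
            have "interior (snd i) \<inter> interior (snd j) = {}"
              using tagged_partial_division_ofD(5)[OF p1] that by (metis prod.collapse)
            then show ?thesis
              using tagged_division_interval(6)[OF p1, of "fst i" "snd i"]
                tagged_division_interval(6)[OF p1, of "fst j" "snd j"] that by simp
          qed
          have "(\<Sum>i\<in>p1. Sup (snd i) - Inf (snd i)) = (\<Sum>(x, K)\<in>p1. measure lborel K)"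
            using tagged_division_interval(7)[OF p1] by (intro sum.cong) auto
          also have "\<dots> \<le> measure lebesgue U"
          proof (rule sum_content_tagged_le[OF p1 U(3)])
            show "K \<subseteq> U" if "(x, K) \<in> p1" for x K
              using that fineD[of x K] by (simp add: p1_def \<gamma>_def)
          qed
          finally show "(\<Sum>i\<in>p1. Sup (snd i) - Inf (snd i)) < \<delta>"
            using U(4) by simp
        qed
        moreover have "norm (?D i) = norm (F (Sup (snd i)) - F (Inf (snd i)))" if "i \<in> p1" for i
          using that by (auto simp: p1_def f0_def norm_minus_commute)
        ultimately show ?thesis
          by simp
      qed
      also have "(\<Sum>i\<in>p2. norm (?D i)) \<le> (\<Sum>(x, K)\<in>p2. \<epsilon> * measure lborel K)"
      proof (rule sum_mono, safe)
        fix x K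
        assume "(x, K) \<in> p2"
        then have xK: "(x, K) \<in> p" "x \<notin> N"
          by (auto simp: p2_def)
        note i = int[OF xK(1)]
        have x: "x \<in> {a..b} - N"
          using i(2-5) xK by auto
        have "K \<subseteq> ball x (d x)"
          using fineD[OF xK(1)] xK(2) x by (simp add: \<gamma>_def)
        moreover have "Inf K \<in> K" "Sup K \<in> K"
          using i(1,3,4) by (metis atLeastAtMost_iff order_refl order_trans)+
        ultimately have near: "\<bar>Inf K - x\<bar> < d x" "\<bar>Sup K - x\<bar> < d x"
          by (auto simp: dist_real_def subset_iff)
        have ends: "Inf K \<in> {a..b}" "Sup K \<in> {a..b}"
          using i(2-5) by auto
        have "norm (F (Sup K) - F x - (Sup K - x) *\<^sub>R f x) \<le> \<epsilon> * \<bar>Sup K - x\<bar>"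
          "norm (F (Inf K) - F x - (Inf K - x) *\<^sub>R f x) \<le> \<epsilon> * \<bar>Inf K - x\<bar>"
          by (rule d[OF x ends(2) near(2)], rule d[OF x ends(1) near(1)])
        then have "norm ((F (Inf K) - F x - (Inf K - x) *\<^sub>R f x) - (F (Sup K) - F x - (Sup K - x) *\<^sub>R f x))
            \<le> \<epsilon> * \<bar>Inf K - x\<bar> + \<epsilon> * \<bar>Sup K - x\<bar>"
          by (intro norm_triangle_le_diff) simp
        also have "\<dots> = \<epsilon> * measure lborel K"
          using i(3,4) unfolding i(7) by (simp add: algebra_simps)
        also have "(F (Inf K) - F x - (Inf K - x) *\<^sub>R f x) - (F (Sup K) - F x - (Sup K - x) *\<^sub>R f x)
            = measure lborel K *\<^sub>R f0 x - (F (Sup K) - F (Inf K))"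
          using xK(2) unfolding i(7) by (simp add: f0_def algebra_simps)
        finally show "norm (measure lborel K *\<^sub>R f0 x - (F (Sup K) - F (Inf K))) \<le> \<epsilon> * measure lborel K" .
      qed
      also have "\<dots> = \<epsilon> * (\<Sum>(x, K)\<in>p2. measure lborel K)"
        by (simp add: sum_distrib_left case_prod_beta)
      also have "\<dots> \<le> \<epsilon> * (b - a)"
      proof (rule mult_left_mono)
        have "(\<Sum>(x, K)\<in>p2. measure lborel K) \<le> measure lebesgue {a..b}"
          using pp by (intro sum_content_tagged_le[OF tagged_partial_division_subset[OF pp]])
            (auto simp: p2_def tagged_partial_division_of_def)
        then show "(\<Sum>(x, K)\<in>p2. measure lborel K) \<le> b - a"
          using \<open>a \<le> b\<close> by simp
      qed (use \<open>0 < \<epsilon>\<close> in simp)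
      also have "\<dots> \<le> e / 2"
        using \<open>0 < e\<close> \<open>a \<le> b\<close> by (simp add: \<epsilon>_def field_simps)
      finally show ?thesis
        by simp
    qed
    show "\<exists>\<gamma>. gauge \<gamma> \<and> (\<forall>p. p tagged_division_of {a..b} \<and> \<gamma> fine p \<longrightarrow>
        norm ((\<Sum>(x, K)\<in>p. measure lborel K *\<^sub>R f0 x) - (F b - F a)) < e)"
      by (intro exI[of _ \<gamma>] conjI allI impI g) (elim conjE, rule bd)
  qed
  then show ?thesis
    by (rule has_integral_spike[OF N, rotated]) (simp add: f0_def)
qed

lemma absolutely_continuous_imp_continuous_on:
  assumes "absolutely_continuous_on_interval a b F"
  shows "continuous_on {a..b} F"
proof (rule continuous_onI)
  fix x e :: real
  assume x: "x \<in> {a..b}" and "0 < e"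
  obtain \<delta> where "0 < \<delta>" and \<delta>: "\<forall>I s t. finite I \<longrightarrow> (\<forall>i\<in>I. a \<le> s i \<and> s i \<le> t i \<and> t i \<le> b) \<longrightarrow>
      (\<forall>i\<in>I. \<forall>j\<in>I. i \<noteq> j \<longrightarrow> {s i<..<t i} \<inter> {s j<..<t j} = {}) \<longrightarrow>
      (\<Sum>i\<in>I. t i - s i) < \<delta> \<longrightarrow> (\<Sum>i\<in>(I :: unit set). norm (F (t i) - F (s i))) < e"
    using absolutely_continuous_finite_family[OF assms \<open>0 < e\<close>, where 'a = unit] .
  show "\<exists>d>0. \<forall>x'\<in>{a..b}. dist x' x < d \<longrightarrow> dist (F x') (F x) \<le> e"
  proof (intro exI[of _ \<delta>] conjI ballI impI \<open>0 < \<delta>\<close>)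
    fix y
    assume y: "y \<in> {a..b}" "dist y x < \<delta>"
    have "norm (F (max x y) - F (min x y)) < e"
      using \<delta>[rule_format, of "{()}" "\<lambda>_. min x y" "\<lambda>_. max x y"] x y
      by (auto simp: dist_real_def min_def max_def split: if_splits)
    then show "dist (F y) (F x) \<le> e"
      by (auto simp: dist_norm norm_minus_commute min_def max_def split: if_splits)
  qed
qed

lemma absolutely_continuous_add:
  assumes F: "absolutely_continuous_on_interval a b F" and G: "absolutely_continuous_on_interval a b G"
  shows "absolutely_continuous_on_interval a b (\<lambda>x. F x + G x)"
  unfolding absolutely_continuous_on_interval_def
proof (intro allI impI)
  fix e :: real
  assume "0 < e"
  then have e2: "0 < e / 2"
    by simp
  obtain d1 where d1: "0 < d1" "\<forall>(n::nat) s t. (\<forall>i<n. a \<le> s i \<and> s i \<le> t i \<and> t i \<le> b) \<longrightarrow>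
      (\<forall>i<n. \<forall>j<n. i \<noteq> j \<longrightarrow> {s i<..<t i} \<inter> {s j<..<t j} = {}) \<longrightarrow>
      (\<Sum>i<n. t i - s i) < d1 \<longrightarrow> (\<Sum>i<n. norm (F (t i) - F (s i))) < e / 2"
    using F[unfolded absolutely_continuous_on_interval_def, rule_format, OF e2] by (elim exE conjE)
  obtain d2 where d2: "0 < d2" "\<forall>(n::nat) s t. (\<forall>i<n. a \<le> s i \<and> s i \<le> t i \<and> t i \<le> b) \<longrightarrow>
      (\<forall>i<n. \<forall>j<n. i \<noteq> j \<longrightarrow> {s i<..<t i} \<inter> {s j<..<t j} = {}) \<longrightarrow>
      (\<Sum>i<n. t i - s i) < d2 \<longrightarrow> (\<Sum>i<n. norm (G (t i) - G (s i))) < e / 2"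
    using G[unfolded absolutely_continuous_on_interval_def, rule_format, OF e2] by (elim exE conjE)
  show "\<exists>\<delta>>0. \<forall>(n::nat) s t. (\<forall>i<n. a \<le> s i \<and> s i \<le> t i \<and> t i \<le> b) \<longrightarrow>
      (\<forall>i<n. \<forall>j<n. i \<noteq> j \<longrightarrow> {s i<..<t i} \<inter> {s j<..<t j} = {}) \<longrightarrow>
      (\<Sum>i<n. t i - s i) < \<delta> \<longrightarrow> (\<Sum>i<n. norm (F (t i) + G (t i) - (F (s i) + G (s i)))) < e"
  proof (intro exI[of _ "min d1 d2"] conjI allI impI)
    fix n :: nat and s t
    assume *: "\<forall>i<n. a \<le> s i \<and> s i \<le> t i \<and> t i \<le> b"
      "\<forall>i<n. \<forall>j<n. i \<noteq> j \<longrightarrow> {s i<..<t i} \<inter> {s j<..<t j} = {}" "(\<Sum>i<n. t i - s i) < min d1 d2"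
    have "(\<Sum>i<n. norm (F (t i) + G (t i) - (F (s i) + G (s i))))
        \<le> (\<Sum>i<n. norm (F (t i) - F (s i)) + norm (G (t i) - G (s i)))"
      by (intro sum_mono) (metis add_diff_add norm_triangle_ineq)
    also have "\<dots> < e / 2 + e / 2"
      using d1(2)[rule_format, of n s t] d2(2)[rule_format, of n s t] * unfolding sum.distrib
      by (intro add_strict_mono) auto
    finally show "(\<Sum>i<n. norm (F (t i) + G (t i) - (F (s i) + G (s i)))) < e"
      by simp
  qed (use d1 d2 in simp)
qed

lemma absolutely_continuous_mult:
  assumes F: "absolutely_continuous_on_interval a b F" and G: "absolutely_continuous_on_interval a b G"
  shows "absolutely_continuous_on_interval a b (\<lambda>x. F x * G x)"
  unfolding absolutely_continuous_on_interval_def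
proof (intro allI impI)
  fix e :: real
  assume "0 < e"
  have "bounded (F ` {a..b})" "bounded (G ` {a..b})"
    using absolutely_continuous_imp_continuous_on F G
    by (auto intro!: compact_imp_bounded compact_continuous_image)
  then obtain M where M: "0 < M" "\<And>x. x \<in> {a..b} \<Longrightarrow> norm (F x) \<le> M" "\<And>x. x \<in> {a..b} \<Longrightarrow> norm (G x) \<le> M"
  proof -
    obtain M1 M2 where M12: "\<forall>x\<in>{a..b}. norm (F x) \<le> M1" "\<forall>x\<in>{a..b}. norm (G x) \<le> M2"
      using \<open>bounded (F ` {a..b})\<close> \<open>bounded (G ` {a..b})\<close> by (auto simp: bounded_iff)
    show thesis
      by (rule that[of "max 1 (max M1 M2)"]) (use M12 in \<open>auto simp: le_max_iff_disj\<close>)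
  qed
  have e2: "0 < e / (2 * M)"
    using \<open>0 < e\<close> M(1) by simp
  obtain d1 where d1: "0 < d1" "\<forall>(n::nat) s t. (\<forall>i<n. a \<le> s i \<and> s i \<le> t i \<and> t i \<le> b) \<longrightarrow>
      (\<forall>i<n. \<forall>j<n. i \<noteq> j \<longrightarrow> {s i<..<t i} \<inter> {s j<..<t j} = {}) \<longrightarrow>
      (\<Sum>i<n. t i - s i) < d1 \<longrightarrow> (\<Sum>i<n. norm (F (t i) - F (s i))) < e / (2 * M)"
    using F[unfolded absolutely_continuous_on_interval_def, rule_format, OF e2] by (elim exE conjE)
  obtain d2 where d2: "0 < d2" "\<forall>(n::nat) s t. (\<forall>i<n. a \<le> s i \<and> s i \<le> t i \<and> t i \<le> b) \<longrightarrow>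
      (\<forall>i<n. \<forall>j<n. i \<noteq> j \<longrightarrow> {s i<..<t i} \<inter> {s j<..<t j} = {}) \<longrightarrow>
      (\<Sum>i<n. t i - s i) < d2 \<longrightarrow> (\<Sum>i<n. norm (G (t i) - G (s i))) < e / (2 * M)"
    using G[unfolded absolutely_continuous_on_interval_def, rule_format, OF e2] by (elim exE conjE)
  show "\<exists>\<delta>>0. \<forall>(n::nat) s t. (\<forall>i<n. a \<le> s i \<and> s i \<le> t i \<and> t i \<le> b) \<longrightarrow>
      (\<forall>i<n. \<forall>j<n. i \<noteq> j \<longrightarrow> {s i<..<t i} \<inter> {s j<..<t j} = {}) \<longrightarrow>
      (\<Sum>i<n. t i - s i) < \<delta> \<longrightarrow> (\<Sum>i<n. norm (F (t i) * G (t i) - F (s i) * G (s i))) < e"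
  proof (intro exI[of _ "min d1 d2"] conjI allI impI)
    fix n :: nat and s t
    assume *: "\<forall>i<n. a \<le> s i \<and> s i \<le> t i \<and> t i \<le> b"
      "\<forall>i<n. \<forall>j<n. i \<noteq> j \<longrightarrow> {s i<..<t i} \<inter> {s j<..<t j} = {}" "(\<Sum>i<n. t i - s i) < min d1 d2"
    have "(\<Sum>i<n. norm (F (t i) * G (t i) - F (s i) * G (s i)))
        \<le> (\<Sum>i<n. norm (F (t i) - F (s i)) * M + M * norm (G (t i) - G (s i)))"
    proof (rule sum_mono)
      fix i
      assume "i \<in> {..<n}"
      then have st: "s i \<in> {a..b}" "t i \<in> {a..b}"
        using *(1) by force+
      have "F (t i) * G (t i) - F (s i) * G (s i)
          = (F (t i) - F (s i)) * G (t i) + F (s i) * (G (t i) - G (s i))"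
        by (simp add: algebra_simps)
      also have "norm \<dots> \<le> norm (F (t i) - F (s i)) * norm (G (t i)) + norm (F (s i)) * norm (G (t i) - G (s i))"
        by (metis norm_mult norm_triangle_ineq)
      also have "\<dots> \<le> norm (F (t i) - F (s i)) * M + M * norm (G (t i) - G (s i))"
        using M st by (intro add_mono mult_left_mono mult_right_mono) auto
      finally show "norm (F (t i) * G (t i) - F (s i) * G (s i))
          \<le> norm (F (t i) - F (s i)) * M + M * norm (G (t i) - G (s i))" .
    qed
    also have "\<dots> = (\<Sum>i<n. norm (F (t i) - F (s i))) * M + M * (\<Sum>i<n. norm (G (t i) - G (s i)))"
      by (simp add: sum.distrib sum_distrib_left sum_distrib_right)
    also have "\<dots> < (e / (2 * M)) * M + M * (e / (2 * M))"
      using d1(2)[rule_format, of n s t] d2(2)[rule_format, of n s t] * M(1)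
      by (intro add_strict_mono mult_strict_left_mono mult_strict_right_mono) auto
    also have "\<dots> = e"
      using M(1) by simp
    finally show "(\<Sum>i<n. norm (F (t i) * G (t i) - F (s i) * G (s i))) < e" .
  qed (use d1 d2 in simp)
qed

lemma sum_integral_disjoint_le:
  fixes h :: "real \<Rightarrow> real"
  assumes h: "h integrable_on {a..b}" "\<And>x. x \<in> {a..b} \<Longrightarrow> 0 \<le> h x" and "finite I"
    and I: "\<And>i. i \<in> I \<Longrightarrow> a \<le> s i \<and> s i \<le> t i \<and> t i \<le> b"
    and disj: "\<And>i j. i \<in> I \<Longrightarrow> j \<in> I \<Longrightarrow> i \<noteq> j \<Longrightarrow> {s i<..<t i} \<inter> {s j<..<t j} = {}"
  shows "(\<Sum>i\<in>I. integral {s i..t i} h) \<le> integral {a..b} h"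
proof (rule has_integral_le)
  show "((\<lambda>x. \<Sum>i\<in>I. if x \<in> {s i<..<t i} then h x else 0) has_integral (\<Sum>i\<in>I. integral {s i..t i} h)) {a..b}"
  proof (rule has_integral_sum[OF \<open>finite I\<close>])
    fix i
    assume i: "i \<in> I"
    have "h integrable_on {s i..t i}"
      using I[OF i] by (intro integrable_subinterval_real[OF h(1)]) auto
    then have "(h has_integral integral {s i..t i} h) {s i<..<t i}"
      by (simp add: has_integral_Icc_iff_Ioo[symmetric] integrable_integral)
    then show "((\<lambda>x. if x \<in> {s i<..<t i} then h x else 0) has_integral integral {s i..t i} h) {a..b}"
      using I[OF i] by (subst has_integral_restrict) auto
  qed
  show "(h has_integral integral {a..b} h) {a..b}"
    using h(1) by (rule integrable_integral)
  show "(\<Sum>i\<in>I. if x \<in> {s i<..<t i} then h x else 0) \<le> h x" if x: "x \<in> {a..b}" for x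
  proof (cases "\<exists>i\<in>I. x \<in> {s i<..<t i}")
    case True
    then obtain i where i: "i \<in> I" "x \<in> {s i<..<t i}"
      by blast
    have "(\<Sum>j\<in>I. if x \<in> {s j<..<t j} then h x else 0) = (\<Sum>j\<in>I. if j = i then h x else 0)"
    proof (intro sum.cong refl)
      fix j
      assume "j \<in> I"
      then show "(if x \<in> {s j<..<t j} then h x else 0) = (if j = i then h x else 0)"
        using disj[of j i] i by (cases "j = i") auto
    qed
    then show ?thesis
      using \<open>finite I\<close> i by simp
  next
    case False
    then have "(\<Sum>j\<in>I. if x \<in> {s j<..<t j} then h x else 0) = 0"
      by (intro sum.neutral) auto
    then show ?thesis
      using h(2)[OF x] by simp
  qed
qed

text \<open>Square integrability of the derivative gives an explicit modulus: by
  \<open>2 \<bar>f\<bar> \<le> c \<bar>f\<bar>\<^sup>2 + 1 / c\<close> the increments over intervals of total length \<open>d\<close> sum up to at most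
  \<open>(c \<parallel>f\<parallel>\<^sup>2 + d / c) / 2\<close>.\<close>

lemma locally_absolutely_continuousI_integral:
  fixes f :: "real \<Rightarrow> complex"
  assumes F: "\<And>s t. 0 < s \<Longrightarrow> s \<le> t \<Longrightarrow> (f has_integral F t - F s) {s..t}"
    and sq: "\<And>s t. 0 < s \<Longrightarrow> s \<le> t \<Longrightarrow> (\<lambda>x. (norm (f x))\<^sup>2) integrable_on {s..t}"
  shows "locally_absolutely_continuous F"
  unfolding locally_absolutely_continuous_def absolutely_continuous_on_interval_def
proof (intro allI impI)
  fix a b e :: real
  assume ab: "0 < a" "a \<le> b" and "0 < e"
  let ?h = "\<lambda>x. (norm (f x))\<^sup>2"
  define H where "H = integral {a..b} ?h"
  have "0 \<le> H"
    unfolding H_def by (intro integral_nonneg sq ab) simp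
  define c where "c = e / (H + 1)"
  have "0 < c"
    using \<open>0 < e\<close> \<open>0 \<le> H\<close> by (simp add: c_def)
  show "\<exists>\<delta>>0. \<forall>(n::nat) s t. (\<forall>i<n. a \<le> s i \<and> s i \<le> t i \<and> t i \<le> b) \<longrightarrow>
      (\<forall>i<n. \<forall>j<n. i \<noteq> j \<longrightarrow> {s i<..<t i} \<inter> {s j<..<t j} = {}) \<longrightarrow>
      (\<Sum>i<n. t i - s i) < \<delta> \<longrightarrow> (\<Sum>i<n. norm (F (t i) - F (s i))) < e"
  proof (intro exI[of _ "e * c"] conjI allI impI)
    fix n :: nat and s t
    assume I: "\<forall>i<n. a \<le> s i \<and> s i \<le> t i \<and> t i \<le> b"
      and disj: "\<forall>i<n. \<forall>j<n. i \<noteq> j \<longrightarrow> {s i<..<t i} \<inter> {s j<..<t j} = {}"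
      and len: "(\<Sum>i<n. t i - s i) < e * c"
    have "norm (F (t i) - F (s i)) \<le> (c / 2) * integral {s i..t i} ?h + (t i - s i) / (2 * c)"
      if "i \<in> {..<n}" for i
    proof -
      have st: "0 < s i" "s i \<le> t i"
        using I ab that by force+
      have "F (t i) - F (s i) = integral {s i..t i} f"
        using F[OF st] by (simp add: integral_unique)
      also have "norm \<dots> \<le> integral {s i..t i} (\<lambda>x. (c / 2) * ?h x + 1 / (2 * c))"
      proof (rule integral_norm_bound_integral)
        show "f integrable_on {s i..t i}"
          using F[OF st] by blast
        show "(\<lambda>x. (c / 2) * ?h x + 1 / (2 * c)) integrable_on {s i..t i}"
          by (intro integrable_add integrable_on_mult_right sq st integrable_const_ivl)
        show "norm (f x) \<le> (c / 2) * ?h x + 1 / (2 * c)" for x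
        proof -
          have "0 \<le> (c * norm (f x) - 1)\<^sup>2 / (2 * c)"
            using \<open>0 < c\<close> by simp
          also have "\<dots> = (c / 2) * ?h x + 1 / (2 * c) - norm (f x)"
            using \<open>0 < c\<close> by (simp add: field_simps power2_eq_square)
          finally show ?thesis by simp
        qed
      qed
      also have "\<dots> = (c / 2) * integral {s i..t i} ?h + (t i - s i) / (2 * c)"
        using st by (subst integral_add) (auto intro!: integrable_on_mult_right sq simp: integral_mult_right)
      finally show ?thesis .
    qed
    then have "(\<Sum>i<n. norm (F (t i) - F (s i)))
        \<le> (\<Sum>i<n. (c / 2) * integral {s i..t i} ?h + (t i - s i) / (2 * c))"
      by (rule sum_mono)
    also have "\<dots> = (c / 2) * (\<Sum>i<n. integral {s i..t i} ?h) + (\<Sum>i<n. t i - s i) / (2 * c)"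
      by (simp add: sum.distrib sum_distrib_left sum_divide_distrib)
    also have "\<dots> < (c / 2) * (H + 1) + (e * c) / (2 * c)"
    proof (rule add_strict_mono)
      have "(\<Sum>i<n. integral {s i..t i} ?h) \<le> H"
        unfolding H_def using I disj ab by (intro sum_integral_disjoint_le sq) auto
      then show "(c / 2) * (\<Sum>i<n. integral {s i..t i} ?h) < (c / 2) * (H + 1)"
        using \<open>0 < c\<close> by (intro mult_strict_left_mono) auto
      show "(\<Sum>i<n. t i - s i) / (2 * c) < (e * c) / (2 * c)"
        using \<open>0 < c\<close> len by (intro divide_strict_right_mono) auto
    qed
    also have "\<dots> = e"
    proof -
      have "c * (H + 1) = e"
        using \<open>0 \<le> H\<close> by (simp add: c_def)
      then show ?thesis
        using \<open>0 < c\<close> by simp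
    qed
    finally show "(\<Sum>i<n. norm (F (t i) - F (s i))) < e" .
  qed (use \<open>0 < e\<close> \<open>0 < c\<close> in simp)
qed

lemma locally_absolutely_continuous_C1:
  assumes "\<And>x. 0 < x \<Longrightarrow> (F has_vector_derivative f x) (at x)" "continuous_on {0<..} f"
  shows "locally_absolutely_continuous F"
proof (rule locally_absolutely_continuousI_integral)
  fix s t :: real
  assume st: "0 < s" "s \<le> t"
  show "(f has_integral F t - F s) {s..t}"
    using st assms(1) by (intro fundamental_theorem_of_calculus) (auto intro: has_vector_derivative_at_within)
  have "continuous_on {s..t} f"
    using st by (intro continuous_on_subset[OF assms(2)]) auto
  then show "(\<lambda>x. (norm (f x))\<^sup>2) integrable_on {s..t}"
    by (intro integrable_continuous_real continuous_intros)
qed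

lemma locally_absolutely_continuous_add:
  "locally_absolutely_continuous F \<Longrightarrow> locally_absolutely_continuous G \<Longrightarrow>
    locally_absolutely_continuous (\<lambda>x. F x + G x)"
  unfolding locally_absolutely_continuous_def by (blast intro: absolutely_continuous_add)

lemma locally_absolutely_continuous_mult:
  "locally_absolutely_continuous F \<Longrightarrow> locally_absolutely_continuous G \<Longrightarrow>
    locally_absolutely_continuous (\<lambda>x. F x * G x)"
  unfolding locally_absolutely_continuous_def by (blast intro: absolutely_continuous_mult)

lemma locally_absolutely_continuous_const: "locally_absolutely_continuous (\<lambda>x. c)"
  unfolding locally_absolutely_continuous_def absolutely_continuous_on_interval_def
  by (auto intro!: exI[of _ 1])

lemma locally_absolutely_continuous_diff:
  assumes "locally_absolutely_continuous F" "locally_absolutely_continuous G"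
  shows "locally_absolutely_continuous (\<lambda>x. F x - G x)"
  using locally_absolutely_continuous_add[OF assms(1)
      locally_absolutely_continuous_mult[OF locally_absolutely_continuous_const[of "-1"] assms(2)]]
  by simp

lemma locally_absolutely_continuous_cnj:
  assumes "locally_absolutely_continuous F"
  shows "locally_absolutely_continuous (\<lambda>x. cnj (F x))"
  using assms unfolding locally_absolutely_continuous_def absolutely_continuous_on_interval_def
    complex_cnj_diff[symmetric] complex_mod_cnj .

lemma locally_absolutely_continuous_FTC:
  assumes F: "locally_absolutely_continuous F" and ab: "0 < a" "a \<le> b"
    and deriv: "AE x in half_line. (F has_vector_derivative f x) (at x)"
  shows "(f has_integral (F b - F a)) {a..b}"
proof -
  obtain N where N: "negligible N" "\<And>x. 0 < x \<Longrightarrow> x \<notin> N \<Longrightarrow> (F has_vector_derivative f x) (at x)"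
  proof -
    have "AE x in lebesgue. x \<in> {0<..} \<longrightarrow> (F has_vector_derivative f x) (at x)"
      using deriv by (subst (asm) AE_restrict_space_iff) auto
    then have "negligible {x. \<not> (x \<in> {0<..} \<longrightarrow> (F has_vector_derivative f x) (at x))}"
      unfolding eventually_ae_filter_negligible by (auto intro: negligible_subset)
    then show thesis
      by (rule that) auto
  qed
  show ?thesis
  proof (rule absolutely_continuous_FTC[OF ab(2) _ N(1)])
    show "absolutely_continuous_on_interval a b F"
      using F ab by (auto simp: locally_absolutely_continuous_def)
    show "(F has_vector_derivative f x) (at x within {a..b})" if "x \<in> {a..b} - N" for x
      using N(2)[of x] that ab by (auto intro: has_vector_derivative_at_within)
  qed
qed

text \<open>If the difference quotients of the indefinite integral at the points of a set stay away from
  \<open>f\<close>, the corresponding intervals form a Vitali cover of the set. Henstock's lemma bounds the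
  total length of every finite disjoint family of such intervals.\<close>

theorem integral_has_vector_derivative_AE:
  fixes f :: "real \<Rightarrow> complex"
  assumes f: "f integrable_on {a..b}"
  shows "negligible {x \<in> {a<..<b}. \<not> ((\<lambda>u. integral {a..u} f) has_vector_derivative f x) (at x)}"
proof -
  define J where "J x y = {min x y..max x y}" for x y :: real
  define bad where "bad \<eta> = {x \<in> {a<..<b}. \<forall>d>0. \<exists>y\<in>{a..b}. y \<noteq> x \<and> \<bar>y - x\<bar> < d \<and>
      \<eta> * \<bar>y - x\<bar> < norm (\<bar>y - x\<bar> *\<^sub>R f x - integral (J x y) f)}" for \<eta> :: real
  have J_cball: "J x y = cball ((x + y) / 2) (\<bar>y - x\<bar> / 2)" for x y
    unfolding J_def cball_eq_atLeastAtMost by (auto simp: min_def max_def field_simps)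
  have "negligible (bad \<eta>)" if "0 < \<eta>" for \<eta>
    unfolding negligible_outer_le
  proof (intro allI impI)
    fix e :: real
    assume "0 < e"
    have "f integrable_on cbox a b" "0 < e * \<eta>"
      using f \<open>0 < e\<close> \<open>0 < \<eta>\<close> by auto
    then have "\<exists>\<gamma>. gauge \<gamma> \<and> (\<forall>p. p tagged_partial_division_of (cbox a b) \<and> \<gamma> fine p \<longrightarrow>
        (\<Sum>(x, k)\<in>p. norm (measure lborel k *\<^sub>R f x - integral k f)) < e * \<eta>)"
      by (rule Henstock_lemma) blast
    then obtain \<gamma> where "gauge \<gamma>"
      and \<gamma>: "\<forall>p. p tagged_partial_division_of (cbox a b) \<and> \<gamma> fine p \<longrightarrow>
        (\<Sum>(x, k)\<in>p. norm (measure lborel k *\<^sub>R f x - integral k f)) < e * \<eta>"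
      by (elim exE conjE)
    define K where "K = {(x, y). a < x \<and> x < b \<and> a \<le> y \<and> y \<le> b \<and> y \<noteq> x \<and> J x y \<subseteq> \<gamma> x \<and>
        \<eta> * \<bar>y - x\<bar> < norm (\<bar>y - x\<bar> *\<^sub>R f x - integral (J x y) f)}"
    let ?c = "\<lambda>(x, y). (x + y) / 2" and ?r = "\<lambda>(x, y). \<bar>y - x\<bar> / 2"
    have vitali: "\<exists>i. i \<in> K \<and> x \<in> cball (?c i) (?r i) \<and> ?r i < d" if x: "x \<in> bad \<eta>" and "0 < d" for x d :: real
    proof -
      obtain \<rho> where "0 < \<rho>" "ball x \<rho> \<subseteq> \<gamma> x"
        using \<open>gauge \<gamma>\<close> unfolding gauge_def by (metis open_contains_ball)
      moreover have "\<forall>d>0. \<exists>y\<in>{a..b}. y \<noteq> x \<and> \<bar>y - x\<bar> < d \<and>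
          \<eta> * \<bar>y - x\<bar> < norm (\<bar>y - x\<bar> *\<^sub>R f x - integral (J x y) f)"
        using x by (simp add: bad_def)
      ultimately obtain y where y: "y \<in> {a..b}" "y \<noteq> x" "\<bar>y - x\<bar> < min d \<rho>"
          "\<eta> * \<bar>y - x\<bar> < norm (\<bar>y - x\<bar> *\<^sub>R f x - integral (J x y) f)"
        using \<open>0 < d\<close> by (meson min_less_iff_conj)
      have "J x y \<subseteq> ball x \<rho>"
        using y(3) by (auto simp: J_def dist_real_def)
      then have "(x, y) \<in> K"
        using x y \<open>ball x \<rho> \<subseteq> \<gamma> x\<close> by (auto simp: K_def bad_def)
      moreover have "x \<in> cball (?c (x, y)) (?r (x, y))"
        unfolding prod.case J_cball[symmetric] by (simp add: J_def)
      moreover have "?r (x, y) < d"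
        using y by auto
      ultimately show ?thesis
        by blast
    qed
    have "0 < ?r i" if "i \<in> K" for i
      using that by (auto simp: K_def)
    then obtain C where C: "countable C" "C \<subseteq> K"
        "pairwise (\<lambda>i j. disjnt (cball (?c i) (?r i)) (cball (?c j) (?r j))) C"
        "negligible (bad \<eta> - (\<Union>i\<in>C. cball (?c i) (?r i)))"
      using Vitali_covering_theorem_cballs[of K ?r "bad \<eta>" ?c] vitali by blast
    let ?J = "\<lambda>i. J (fst i) (snd i)"
    have cb: "cball (?c i) (?r i) = ?J i" for i
      by (simp add: J_cball case_prod_beta)
    have disj: "?J i \<inter> ?J j = {}" if "i \<in> C" "j \<in> C" "i \<noteq> j" for i j
      using C(3) that unfolding pairwise_def cb disjnt_def by blast
    have finite_bound: "measure lebesgue (\<Union>i\<in>D. ?J i) \<le> e" if D: "D \<subseteq> C" "finite D" for D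
    proof -
      define p where "p = (\<lambda>i. (fst i, ?J i)) ` D"
      have inj: "inj_on (\<lambda>i. (fst i, ?J i)) D"
      proof (rule inj_onI)
        fix i j
        assume ij: "i \<in> D" "j \<in> D" "(fst i, ?J i) = (fst j, ?J j)"
        have "fst i \<in> ?J i \<inter> ?J j"
          using ij(3) by (auto simp: J_def)
        with ij(1,2) disj[of i j] D show "i = j"
          by blast
      qed
      have DK: "i \<in> K" if "i \<in> D" for i
        using D C that by auto
      have "p tagged_partial_division_of (cbox a b)"
        unfolding tagged_partial_division_of_def
      proof (intro conjI allI impI)
        show "finite p"
          using D by (simp add: p_def)
        fix x k
        assume "(x, k) \<in> p"
        then obtain i where i: "i \<in> D" "x = fst i" "k = ?J i"
          by (auto simp: p_def)
        show "x \<in> k" "\<exists>u v. k = cbox u v"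
          by (auto simp: i J_def)
        show "k \<subseteq> cbox a b"
          using DK[OF i(1)] unfolding K_def i(3) J_def by (cases i) auto
      next
        fix x k y l
        assume xy: "(x, k) \<in> p \<and> (y, l) \<in> p \<and> (x, k) \<noteq> (y, l)"
        then obtain i j where i: "i \<in> D" "(x, k) = (fst i, ?J i)" and j: "j \<in> D" "(y, l) = (fst j, ?J j)"
          by (auto simp: p_def)
        then have "i \<noteq> j"
          using xy by auto
        then have "k \<inter> l = {}"
          using disj[of i j] i j D by auto
        then show "interior k \<inter> interior l = {}"
          using interior_subset by blast
      qed
      moreover have "\<gamma> fine p"
        using DK by (force simp: fine_def p_def K_def)
      ultimately have "(\<Sum>(x, k)\<in>p. norm (measure lborel k *\<^sub>R f x - integral k f)) < e * \<eta>"
        using \<gamma> by simp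
      then have "(\<Sum>i\<in>D. norm (measure lborel (?J i) *\<^sub>R f (fst i) - integral (?J i) f)) < e * \<eta>"
        unfolding p_def by (subst (asm) sum.reindex[OF inj]) (simp add: o_def)
      moreover have len: "measure lborel (?J i) = \<bar>snd i - fst i\<bar>" for i
        by (auto simp: J_def min_def max_def)
      moreover have "(\<Sum>i\<in>D. \<eta> * \<bar>snd i - fst i\<bar>)
          \<le> (\<Sum>i\<in>D. norm (\<bar>snd i - fst i\<bar> *\<^sub>R f (fst i) - integral (?J i) f))"
        using DK by (intro sum_mono) (force simp: K_def intro: less_imp_le)
      ultimately have "\<eta> * (\<Sum>i\<in>D. \<bar>snd i - fst i\<bar>) < \<eta> * e"
        by (simp add: sum_distrib_left mult.commute)
      then have "(\<Sum>i\<in>D. \<bar>snd i - fst i\<bar>) \<le> e"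
        using \<open>0 < \<eta>\<close> by simp
      moreover have "measure lebesgue (\<Union>i\<in>D. ?J i) \<le> (\<Sum>i\<in>D. measure lebesgue (?J i))"
        using D by (intro measure_UNION_le) (auto simp: J_def)
      moreover have "measure lebesgue (?J i) = \<bar>snd i - fst i\<bar>" for i
        by (auto simp: J_def min_def max_def)
      ultimately show ?thesis
        by simp
    qed
    let ?T = "(\<Union>i\<in>C. ?J i)"
    have Jm: "?J i \<in> lmeasurable" for i
      by (simp add: J_def)
    have T: "?T \<in> lmeasurable" "measure lebesgue ?T \<le> e"
      using fmeasurable_UN_bound[OF C(1) Jm finite_bound] measure_UN_bound[OF C(1) Jm finite_bound] by auto
    have N: "negligible (bad \<eta> - ?T)"
      using C(4) by (simp add: cb)
    show "\<exists>T. bad \<eta> \<subseteq> T \<and> T \<in> lmeasurable \<and> measure lebesgue T \<le> e"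
    proof (intro exI[of _ "?T \<union> (bad \<eta> - ?T)"] conjI)
      show "?T \<union> (bad \<eta> - ?T) \<in> lmeasurable"
        by (intro fmeasurable.Un T negligible_imp_measurable N)
      have "measure lebesgue (?T \<union> (bad \<eta> - ?T)) = measure lebesgue ?T"
        by (rule measure_negligible_symdiff[OF T(1)]) (rule negligible_subset[OF N], auto)
      then show "measure lebesgue (?T \<union> (bad \<eta> - ?T)) \<le> e"
        using T(2) by simp
    qed auto
  qed
  then have "negligible (\<Union>n. bad (inverse (real (Suc n))))"
    by (intro negligible_countable_Union) auto
  then show ?thesis
  proof (rule negligible_subset, intro subsetI)
    fix x
    assume x: "x \<in> {x \<in> {a<..<b}. \<not> ((\<lambda>u. integral {a..u} f) has_vector_derivative f x) (at x)}"
    show "x \<in> (\<Union>n. bad (inverse (real (Suc n))))"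
    proof (rule ccontr)
      assume not_bad: "x \<notin> (\<Union>n. bad (inverse (real (Suc n))))"
      have ab: "a < x" "x < b"
        using x by auto
      have "((\<lambda>u. integral {a..u} f) has_vector_derivative f x) (at x)"
        unfolding has_vector_derivative_def has_derivative_at_alt
      proof (intro conjI allI impI)
        show "bounded_linear (\<lambda>h. h *\<^sub>R f x)"
          by (rule bounded_linear_scaleR_left)
        fix e :: real
        assume "0 < e"
        then obtain n where n: "inverse (real (Suc n)) < e"
          using reals_Archimedean by blast
        have "x \<notin> bad (inverse (real (Suc n)))"
          using not_bad by blast
        then obtain d where "0 < d" and nd: "\<not> (\<exists>y\<in>{a..b}. y \<noteq> x \<and> \<bar>y - x\<bar> < d \<and>
            inverse (real (Suc n)) * \<bar>y - x\<bar> < norm (\<bar>y - x\<bar> *\<^sub>R f x - integral (J x y) f))"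
          using ab unfolding bad_def by auto
        have d: "norm (\<bar>y - x\<bar> *\<^sub>R f x - integral (J x y) f) \<le> inverse (real (Suc n)) * \<bar>y - x\<bar>"
          if "y \<in> {a..b}" "y \<noteq> x" "\<bar>y - x\<bar> < d" for y
          using nd that by (meson not_less)
        show "\<exists>d>0. \<forall>y. norm (y - x) < d \<longrightarrow>
            norm (integral {a..y} f - integral {a..x} f - (y - x) *\<^sub>R f x) \<le> e * norm (y - x)"
        proof (intro exI[of _ "min d (min (x - a) (b - x))"] conjI allI impI)
          fix y
          assume y: "norm (y - x) < min d (min (x - a) (b - x))"
          have yab: "y \<in> {a..b}"
            using y by auto
          show "norm (integral {a..y} f - integral {a..x} f - (y - x) *\<^sub>R f x) \<le> e * norm (y - x)"
          proof (cases "y = x")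
            case False
            have "norm (integral {a..y} f - integral {a..x} f - (y - x) *\<^sub>R f x)
                = norm (\<bar>y - x\<bar> *\<^sub>R f x - integral (J x y) f)"
            proof (cases "x \<le> y")
              case True
              have "integral {a..x} f + integral {x..y} f = integral {a..y} f"
                using True ab yab by (intro Henstock_Kurzweil_Integration.integral_combine integrable_subinterval_real[OF f]) auto
              then have "integral {a..y} f - integral {a..x} f = integral {x..y} f"
                by (simp add: algebra_simps)
              then show ?thesis
                using True by (simp add: J_def norm_minus_commute)
            next
              case False
              have "integral {a..y} f + integral {y..x} f = integral {a..x} f"
                using False ab yab by (intro Henstock_Kurzweil_Integration.integral_combine integrable_subinterval_real[OF f]) auto
              then have "integral {a..y} f - integral {a..x} f - (y - x) *\<^sub>R f x
                  = (x - y) *\<^sub>R f x - integral {y..x} f"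
                by (simp add: algebra_simps)
              then show ?thesis
                using False by (simp add: J_def)
            qed
            also have "\<dots> \<le> inverse (real (Suc n)) * \<bar>y - x\<bar>"
              using y by (intro d yab False) auto
            also have "\<dots> \<le> e * norm (y - x)"
              using n \<open>0 < e\<close> by (intro mult_mono) auto
            finally show ?thesis .
          qed simp
        qed (use ab \<open>0 < d\<close> in auto)
      qed
      then show False
        using x by simp
    qed
  qed
qed

section \<open>Integrals over the half-line\<close>

lemma half_line_absolutely_integrable:
  fixes h :: "real \<Rightarrow> 'a :: euclidean_space"
  shows "integrable half_line h \<longleftrightarrow> h absolutely_integrable_on {0<..}"
  unfolding set_integrable_def by (subst integrable_restrict_space) simp_all

lemma half_line_integral_eq:
  fixes h :: "real \<Rightarrow> 'a :: euclidean_space"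
  assumes "integrable half_line h"
  shows "integral\<^sup>L half_line h = integral {0<..} h"
  by (rule lebesgue_integral_eq_integral[OF assms]) simp

lemma half_line_integrable_on:
  fixes h :: "real \<Rightarrow> 'a :: euclidean_space"
  assumes "integrable half_line h" "0 \<le> a"
  shows "h integrable_on {a..b}"
proof -
  have "h absolutely_integrable_on {0<..}"
    using assms by (simp add: half_line_absolutely_integrable)
  then have "h absolutely_integrable_on {a<..<b}"
    by (rule set_integrable_subset) (use assms in auto)
  then show ?thesis
    using set_lebesgue_integral_eq_integral(1) integrable_on_open_interval_real by blast
qed

lemma half_line_integral_le:
  fixes h :: "real \<Rightarrow> real"
  assumes "integrable half_line h" "0 \<le> a" "\<And>x. 0 < x \<Longrightarrow> 0 \<le> h x"
  shows "integral {a..b} h \<le> integral\<^sup>L half_line h"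
proof -
  have "integral {a..b} h = integral {a<..<b} h"
    by (rule integral_open_interval_real)
  also have "\<dots> \<le> integral {0<..} h"
  proof (rule integral_subset_le)
    show "h integrable_on {a<..<b}"
      using half_line_integrable_on[OF assms(1,2)] integrable_on_open_interval_real by blast
    show "h integrable_on {0<..}"
      by (rule integrable_on_lebesgue_on[OF assms(1)]) simp
  qed (use assms in auto)
  finally show ?thesis
    using half_line_integral_eq[OF assms(1)] by simp
qed

lemma half_line_integral_limit:
  fixes h :: "real \<Rightarrow> 'a :: euclidean_space"
  assumes h: "integrable half_line h" and a: "\<And>n. 0 < a n" "a \<longlonglongrightarrow> 0"
    and b: "filterlim b at_top sequentially"
  shows "(\<lambda>n. integral {a n..b n} h) \<longlonglongrightarrow> integral\<^sup>L half_line h"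
proof -
  have "(\<lambda>n. integral\<^sup>L half_line (\<lambda>x. indicator {a n..b n} x *\<^sub>R h x)) \<longlonglongrightarrow> integral\<^sup>L half_line h"
  proof (rule integral_dominated_convergence[where w = "\<lambda>x. norm (h x)"])
    show "AE x in half_line. (\<lambda>n. indicator {a n..b n} x *\<^sub>R h x) \<longlonglongrightarrow> h x"
    proof (rule AE_I2)
      fix x
      assume "x \<in> space half_line"
      then have "0 < x"
        by simp
      have "\<forall>\<^sub>F n in sequentially. a n < x"
        using order_tendstoD(2)[OF a(2) \<open>0 < x\<close>] .
      moreover have "\<forall>\<^sub>F n in sequentially. x \<le> b n"
        using b by (auto simp: filterlim_at_top)
      ultimately have "\<forall>\<^sub>F n in sequentially. indicator {a n..b n} x *\<^sub>R h x = h x"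
        by eventually_elim auto
      then show "(\<lambda>n. indicator {a n..b n} x *\<^sub>R h x) \<longlonglongrightarrow> h x"
        by (rule tendsto_eventually)
    qed
    show "AE x in half_line. norm (indicator {a n..b n} x *\<^sub>R h x) \<le> norm (h x)" for n
      by (auto simp: indicator_def)
    show "(\<lambda>x. indicator {a n..b n} x *\<^sub>R h x) \<in> borel_measurable half_line" for n
      by (rule borel_measurable_scaleR[OF measurable_restrict_space1[OF borel_measurable_indicator]
            borel_measurable_integrable[OF h]]) simp
  qed (use h in auto)
  moreover have "integral\<^sup>L half_line (\<lambda>x. indicator {a n..b n} x *\<^sub>R h x) = integral {a n..b n} h" for n
  proof -
    have "h absolutely_integrable_on {0<..}"
      using h by (simp add: half_line_absolutely_integrable)
    then have ab: "h absolutely_integrable_on {a n..b n}"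
      by (rule set_integrable_subset) (use a(1)[of n] in auto)
    have "integral\<^sup>L half_line (\<lambda>x. indicator {a n..b n} x *\<^sub>R h x)
        = integral\<^sup>L lebesgue (\<lambda>x. indicator {0<..} x *\<^sub>R indicator {a n..b n} x *\<^sub>R h x)"
      by (rule integral_restrict_space) simp
    also have "\<dots> = integral\<^sup>L lebesgue (\<lambda>x. indicator {a n..b n} x *\<^sub>R h x)"
      using a(1)[of n] by (intro Bochner_Integration.integral_cong) (auto simp: indicator_def)
    also have "\<dots> = integral {a n..b n} h"
      using set_lebesgue_integral_eq_integral(2)[OF ab] by (simp add: set_lebesgue_integral_def)
    finally show ?thesis .
  qed
  ultimately show ?thesis
    by simp
qed

lemma square_integrable_integrable: "square_integrable f \<Longrightarrow> integrable half_line (\<lambda>x. (norm (f x))\<^sup>2)"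
  by (simp add: square_integrable_def)

lemma square_integrable_cong_AE:
  assumes "square_integrable f" "g \<in> borel_measurable half_line" "AE x in half_line. f x = g x"
  shows "square_integrable g"
  unfolding square_integrable_def
proof
  show "integrable half_line (\<lambda>x. (norm (g x))\<^sup>2)"
    using assms by (subst integrable_cong_AE[of _ _ "\<lambda>x. (norm (f x))\<^sup>2"]) (auto simp: square_integrable_def)
qed fact

lemma continuous_on_measurable_half_line:
  fixes f :: "real \<Rightarrow> complex"
  assumes "continuous_on {0<..} f"
  shows "f \<in> borel_measurable half_line"
  by (rule continuous_imp_measurable_on_sets_lebesgue[OF assms]) simp

section \<open>The Bessel differential expression\<close>

text \<open>The local part of the definition of the maximal domain, without square integrability, so
  that it also covers the solutions \<open>x powr (1/2 \<plusminus> \<nu>)\<close>; \<open>f1\<close> and \<open>f2\<close> are the derivatives of \<open>f\<close>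
  and \<open>g = \<tau>\<^sub>\<nu> f\<close>.\<close>

definition bessel_ode :: "real \<Rightarrow> (real \<Rightarrow> complex) \<Rightarrow> (real \<Rightarrow> complex) \<Rightarrow> (real \<Rightarrow> complex) \<Rightarrow>
    (real \<Rightarrow> complex) \<Rightarrow> bool"
  where "bessel_ode \<nu> f f1 f2 g \<longleftrightarrow>
    (\<forall>x>0. (f has_vector_derivative f1 x) (at x)) \<and> locally_absolutely_continuous f1 \<and>
    (AE x in half_line. (f1 has_vector_derivative f2 x) (at x)) \<and>
    (\<forall>x>0. g x = - f2 x + of_real ((\<nu>\<^sup>2 - 1/4) / x\<^sup>2) * f x)"

lemma locally_absolutely_continuous_imp_continuous_on:
  assumes "locally_absolutely_continuous f"
  shows "continuous_on {0<..} f"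
proof -
  have "isCont f x" if "0 < x" for x
  proof -
    have "continuous_on {x/2..2*x} f"
      using assms that unfolding locally_absolutely_continuous_def
      by (intro absolutely_continuous_imp_continuous_on) simp
    then show ?thesis
      by (rule continuous_on_interior) (use that in auto)
  qed
  then show ?thesis
    by (intro continuous_at_imp_continuous_on) auto
qed

lemma bessel_odeD:
  assumes "bessel_ode \<nu> f f1 f2 g"
  shows "\<And>x. 0 < x \<Longrightarrow> (f has_vector_derivative f1 x) (at x)"
    "locally_absolutely_continuous f1" "continuous_on {0<..} f1"
    "locally_absolutely_continuous f" "continuous_on {0<..} f"
    "AE x in half_line. (f1 has_vector_derivative f2 x) (at x)"
    "\<And>x. 0 < x \<Longrightarrow> g x = - f2 x + of_real ((\<nu>\<^sup>2 - 1/4) / x\<^sup>2) * f x"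
proof -
  show 1: "\<And>x. 0 < x \<Longrightarrow> (f has_vector_derivative f1 x) (at x)"
    and 2: "locally_absolutely_continuous f1"
    and "AE x in half_line. (f1 has_vector_derivative f2 x) (at x)"
    and "\<And>x. 0 < x \<Longrightarrow> g x = - f2 x + of_real ((\<nu>\<^sup>2 - 1/4) / x\<^sup>2) * f x"
    using assms by (auto simp: bessel_ode_def)
  show 3: "continuous_on {0<..} f1"
    by (rule locally_absolutely_continuous_imp_continuous_on[OF 2])
  show 4: "locally_absolutely_continuous f"
    by (rule locally_absolutely_continuous_C1[OF 1 3])
  show "continuous_on {0<..} f"
    by (rule locally_absolutely_continuous_imp_continuous_on[OF 4])
qed

lemma bessel_pair_iff:
  "bessel_pair \<nu> f g \<longleftrightarrow>
    square_integrable f \<and> square_integrable g \<and> (\<exists>f1 f2. bessel_ode \<nu> f f1 f2 g)"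
proof
  assume "bessel_pair \<nu> f g"
  then show "square_integrable f \<and> square_integrable g \<and> (\<exists>f1 f2. bessel_ode \<nu> f f1 f2 g)"
    unfolding bessel_pair_def bessel_ode_def by blast
next
  assume *: "square_integrable f \<and> square_integrable g \<and> (\<exists>f1 f2. bessel_ode \<nu> f f1 f2 g)"
  then obtain f1 f2 where ode: "bessel_ode \<nu> f f1 f2 g"
    by blast
  show "bessel_pair \<nu> f g"
    using * bessel_odeD(4)[OF ode] ode unfolding bessel_pair_def bessel_ode_def by blast
qed

lemma has_vector_derivative_cnj':
  "(f has_vector_derivative f') F \<Longrightarrow> ((\<lambda>x. cnj (f x)) has_vector_derivative cnj f') F"
  by (rule bounded_linear.has_vector_derivative[OF bounded_linear_cnj])

definition wronskian :: "(real \<Rightarrow> complex) \<Rightarrow> (real \<Rightarrow> complex) \<Rightarrow> (real \<Rightarrow> complex) \<Rightarrow>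
    (real \<Rightarrow> complex) \<Rightarrow> real \<Rightarrow> complex"
  where "wronskian f f1 g g1 x = f x * cnj (g1 x) - f1 x * cnj (g x)"

lemma wronskian_green:
  assumes f: "bessel_ode \<nu> f f1 f2 g" and h: "bessel_ode \<nu> h h1 h2 k" and ab: "0 < a" "a \<le> b"
  shows "((\<lambda>x. g x * cnj (h x) - f x * cnj (k x)) has_integral
    (wronskian f f1 h h1 b - wronskian f f1 h h1 a)) {a..b}"
proof (rule locally_absolutely_continuous_FTC[OF _ ab])
  note F = bessel_odeD[OF f] and H = bessel_odeD[OF h]
  show "locally_absolutely_continuous (wronskian f f1 h h1)"
    unfolding wronskian_def using F(2,4) H(2,4)
    by (intro locally_absolutely_continuous_diff locally_absolutely_continuous_mult
        locally_absolutely_continuous_cnj)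
  show "AE x in half_line.
      (wronskian f f1 h h1 has_vector_derivative g x * cnj (h x) - f x * cnj (k x)) (at x)"
    using F(6) H(6) AE_space
  proof eventually_elim
    case (elim x)
    then have x: "0 < x"
      by simp
    have "(wronskian f f1 h h1 has_vector_derivative (f x * cnj (h2 x) + f1 x * cnj (h1 x)
        - (f1 x * cnj (h1 x) + f2 x * cnj (h x)))) (at x)"
      unfolding wronskian_def[abs_def]
      by (intro has_vector_derivative_diff has_vector_derivative_mult has_vector_derivative_cnj'
          elim(1,2) F(1)[OF x] H(1)[OF x])
    also have "f x * cnj (h2 x) + f1 x * cnj (h1 x) - (f1 x * cnj (h1 x) + f2 x * cnj (h x))
        = g x * cnj (h x) - f x * cnj (k x)"
      by (simp add: F(7)[OF x] H(7)[OF x] algebra_simps)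
    finally show ?case .
  qed
qed

text \<open>The factorization \<open>\<tau>\<^sub>\<nu> = D\<^sup>* D\<close> with \<open>D f = f' - (m / x) f = x\<^sup>m (f / x\<^sup>m)'\<close>, valid if
  \<open>x\<^sup>m\<close> solves \<open>\<tau>\<^sub>\<nu> f = 0\<close>.\<close>

lemma bessel_energy_identity:
  assumes f: "bessel_ode \<nu> f f1 f2 g" and m: "m\<^sup>2 - m = \<nu>\<^sup>2 - 1/4" and ab: "0 < a" "a \<le> b"
  defines "V \<equiv> \<lambda>x. f1 x * cnj (f x) - of_real (m / x) * (f x * cnj (f x))"
  shows "((\<lambda>x. of_real ((norm (f1 x - of_real (m / x) * f x))\<^sup>2) - g x * cnj (f x)) has_integral (V b - V a)) {a..b}"
proof (rule locally_absolutely_continuous_FTC[OF _ ab])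
  note F = bessel_odeD[OF f]
  have inv: "((\<lambda>x. complex_of_real (m / x)) has_vector_derivative of_real (- m / x\<^sup>2)) (at x)" if "0 < x" for x
    using that by (intro has_vector_derivative_of_real)
      (auto intro!: derivative_eq_intros simp: has_real_derivative_iff_has_vector_derivative[symmetric] power2_eq_square)
  show "locally_absolutely_continuous V"
    unfolding V_def using F(2,4)
    by (intro locally_absolutely_continuous_diff locally_absolutely_continuous_mult
        locally_absolutely_continuous_cnj locally_absolutely_continuous_C1[OF inv])
      (auto intro!: continuous_intros)
  show "AE x in half_line. (V has_vector_derivative
      of_real ((norm (f1 x - of_real (m / x) * f x))\<^sup>2) - g x * cnj (f x)) (at x)"
    using F(6) AE_space
  proof eventually_elim
    case (elim x)
    then have x: "0 < x"
      by simp
    have "(V has_vector_derivative (f1 x * cnj (f1 x) + f2 x * cnj (f x)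
        - (of_real (m / x) * (f x * cnj (f1 x) + f1 x * cnj (f x)) + of_real (- m / x\<^sup>2) * (f x * cnj (f x))))) (at x)"
      unfolding V_def
      by (intro has_vector_derivative_diff has_vector_derivative_mult has_vector_derivative_cnj'
          elim(1) F(1)[OF x] inv[OF x])
    also have "f1 x * cnj (f1 x) + f2 x * cnj (f x)
        - (of_real (m / x) * (f x * cnj (f1 x) + f1 x * cnj (f x)) + of_real (- m / x\<^sup>2) * (f x * cnj (f x)))
      = of_real ((norm (f1 x - of_real (m / x) * f x))\<^sup>2) - g x * cnj (f x)"
    proof -
      have "complex_of_real ((\<nu>\<^sup>2 - 1/4) / x\<^sup>2) = of_real (m / x) * of_real (m / x) - of_real (m / x\<^sup>2)"
        unfolding m[symmetric] by (simp add: power2_eq_square diff_divide_distrib)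
      moreover have "A * cnj A + G * cnj Z - (r * (Z * cnj A + A * cnj Z) + - s * (Z * cnj Z))
          = (A - r * Z) * cnj (A - r * Z) - (- G + (r * r - s) * Z) * cnj Z"
        if "cnj r = r" for A G Z r s :: complex
        by (simp add: that algebra_simps)
      ultimately show ?thesis
        unfolding complex_norm_square F(7)[OF x] by (simp only: minus_divide_left[symmetric] of_real_minus complex_cnj_complex_of_real)
    qed
    finally show ?case .
  qed
qed

subsection \<open>Behaviour at infinity\<close>

lemma exists_small_value_of_bounded_integrals:
  fixes K :: "real \<Rightarrow> real"
  assumes K: "\<And>b. 1 \<le> b \<Longrightarrow> K integrable_on {1..b}" "\<And>x. 1 \<le> x \<Longrightarrow> 0 \<le> K x"
    and B: "\<And>b. 1 \<le> b \<Longrightarrow> integral {1..b} K \<le> B" and "0 < e" "1 \<le> R"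
  shows "\<exists>x\<ge>R. K x < e"
proof (rule ccontr)
  assume "\<not> (\<exists>x\<ge>R. K x < e)"
  then have ge: "e \<le> K x" if "R \<le> x" for x
    using that by force
  define b where "b = R + (\<bar>B\<bar> + 1) / e"
  have b: "R \<le> b"
    using \<open>0 < e\<close> by (simp add: b_def)
  have "\<bar>B\<bar> + 1 = integral {R..b} (\<lambda>x. e)"
    using b \<open>0 < e\<close> by (simp add: b_def)
  also have "\<dots> \<le> integral {R..b} K"
    using ge b \<open>1 \<le> R\<close> by (intro integral_le integrable_subinterval_real[OF K(1)[of b]]) auto
  also have "\<dots> \<le> integral {1..b} K"
    using b \<open>1 \<le> R\<close> K by (intro integral_subset_le integrable_subinterval_real[OF K(1)[of b]]) auto
  also have "\<dots> \<le> B"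
    using b \<open>1 \<le> R\<close> by (intro B) simp
  finally show False
    by simp
qed

text \<open>If the integral of \<open>\<bar>f'\<bar>\<^sup>2\<close> were infinite, then so would be the limit of \<open>Re (f' \<cdot> cnj f)\<close>,
  that is, half the derivative of \<open>\<bar>f\<bar>\<^sup>2\<close>, and \<open>f\<close> would not be square integrable.\<close>

lemma bessel_derivative_bounded_integrals:
  assumes ode: "bessel_ode \<nu> f f1 f2 g" and f: "square_integrable f" and g: "square_integrable g"
  shows "\<exists>B. \<forall>b\<ge>1. integral {1..b} (\<lambda>x. (norm (f1 x))\<^sup>2) \<le> B"
proof (rule ccontr)
  assume unbounded: "\<nexists>B. \<forall>b\<ge>1. integral {1..b} (\<lambda>x. (norm (f1 x))\<^sup>2) \<le> B"
  note F = bessel_odeD[OF ode]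
  define M where "M x = (\<bar>\<nu>\<^sup>2 - 1/4\<bar> + 1) * (norm (f x))\<^sup>2 + (norm (g x))\<^sup>2" for x
  define c where "c = integral\<^sup>L half_line M"
  have M: "integrable half_line M"
    unfolding M_def using f g by (intro Bochner_Integration.integrable_add integrable_mult_right square_integrable_integrable)
  have M0: "0 \<le> M x" for x
    by (simp add: M_def)
  define r where "r x = Re (f1 x * cnj (f x))" for x
  have f1sq: "(\<lambda>x. (norm (f1 x))\<^sup>2) integrable_on {1..b}" for b
    by (intro integrable_continuous_real continuous_intros continuous_on_subset[OF F(3)]) auto
  have r_ge: "r 1 + integral {1..b} (\<lambda>x. (norm (f1 x))\<^sup>2) - c \<le> r b" if "1 \<le> b" for b
  proof -
    have "((\<lambda>x. f1 x * cnj (f1 x) + f2 x * cnj (f x)) has_integral f1 b * cnj (f b) - f1 1 * cnj (f 1)) {1..b}"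
    proof (rule locally_absolutely_continuous_FTC[OF _ _ that])
      show "AE x in half_line. ((\<lambda>x. f1 x * cnj (f x)) has_vector_derivative
          f1 x * cnj (f1 x) + f2 x * cnj (f x)) (at x)"
        using F(6) AE_space
        by eventually_elim (auto intro!: has_vector_derivative_mult has_vector_derivative_cnj' F(1))
    qed (use F(2,4) in \<open>auto intro!: locally_absolutely_continuous_mult locally_absolutely_continuous_cnj\<close>)
    from has_integral_linear[OF this bounded_linear_Re]
    have Re_int: "((\<lambda>x. Re (f1 x * cnj (f1 x) + f2 x * cnj (f x))) has_integral r b - r 1) {1..b}"
      by (simp only: o_def r_def minus_complex.sel)
    have M_int: "((\<lambda>x. (norm (f1 x))\<^sup>2 - M x) has_integral
        integral {1..b} (\<lambda>x. (norm (f1 x))\<^sup>2) - integral {1..b} M) {1..b}"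
      by (intro has_integral_diff integrable_integral f1sq half_line_integrable_on[OF M]) simp
    have "integral {1..b} (\<lambda>x. (norm (f1 x))\<^sup>2) - integral {1..b} M \<le> r b - r 1"
    proof (rule has_integral_le[OF M_int Re_int])
      fix x
      assume "x \<in> {1..b}"
      then have x: "1 \<le> x"
        by simp
      have "norm (f2 x * cnj (f x)) \<le> M x"
      proof -
        have "v = q - u" if "u = - v + q" for u v q :: complex
          using that by simp
        from this[OF F(7)] have "f2 x = of_real ((\<nu>\<^sup>2 - 1/4) / x\<^sup>2) * f x - g x"
          using x by simp
        then have "f2 x * cnj (f x) = of_real ((\<nu>\<^sup>2 - 1/4) / x\<^sup>2) * (f x * cnj (f x)) - g x * cnj (f x)"
          by (simp only: left_diff_distrib mult.assoc)
        also have "norm \<dots> \<le> norm (of_real ((\<nu>\<^sup>2 - 1/4) / x\<^sup>2) * (f x * cnj (f x))) + norm (g x * cnj (f x))"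
          by (rule norm_triangle_ineq4)
        also have "norm (of_real ((\<nu>\<^sup>2 - 1/4) / x\<^sup>2) * (f x * cnj (f x))) = (\<bar>\<nu>\<^sup>2 - 1/4\<bar> / x\<^sup>2) * (norm (f x))\<^sup>2"
          unfolding norm_mult norm_of_real complex_mod_cnj by (simp add: power2_eq_square abs_mult)
        also have "\<dots> \<le> \<bar>\<nu>\<^sup>2 - 1/4\<bar> * (norm (f x))\<^sup>2"
          using x by (intro mult_right_mono) (auto simp: divide_le_eq mult_le_cancel_left1 one_le_power)
        also have "norm (g x * cnj (f x)) \<le> (norm (g x))\<^sup>2 + (norm (f x))\<^sup>2"
        proof -
          have "2 * norm (g x) * norm (f x) \<le> (norm (g x))\<^sup>2 + (norm (f x))\<^sup>2"
            by (rule sum_squares_bound)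
          moreover have "0 \<le> norm (g x) * norm (f x)"
            by simp
          ultimately have "norm (g x) * norm (f x) \<le> (norm (g x))\<^sup>2 + (norm (f x))\<^sup>2"
            by linarith
          then show ?thesis
            by (simp add: norm_mult)
        qed
        finally show ?thesis
          by (simp add: M_def algebra_simps)
      qed
      then have "- M x \<le> Re (f2 x * cnj (f x))"
        using abs_Re_le_cmod[of "f2 x * cnj (f x)"] by linarith
      moreover have "Re (f1 x * cnj (f1 x)) = (norm (f1 x))\<^sup>2"
        by (simp add: complex_norm_square[symmetric] del: of_real_power)
      ultimately show "(norm (f1 x))\<^sup>2 - M x \<le> Re (f1 x * cnj (f1 x) + f2 x * cnj (f x))"
        by simp
    qed
    moreover have "integral {1..b} M \<le> c"
      unfolding c_def using M0 by (intro half_line_integral_le[OF M]) auto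
    ultimately show ?thesis
      by simp
  qed
  obtain R where R: "1 \<le> R" "c + 1 - r 1 \<le> integral {1..R} (\<lambda>x. (norm (f1 x))\<^sup>2)"
    using unbounded by (meson le_cases)
  have r1: "1 \<le> r b" if "R \<le> b" for b
  proof -
    have "integral {1..R} (\<lambda>x. (norm (f1 x))\<^sup>2) \<le> integral {1..b} (\<lambda>x. (norm (f1 x))\<^sup>2)"
      using that by (intro integral_subset_le f1sq) auto
    then show ?thesis
      using r_ge[of b] R that by simp
  qed
  have sq_ge: "2 * (b - R) \<le> (norm (f b))\<^sup>2" if "R \<le> b" for b
  proof -
    have "((\<lambda>x. 2 * r x) has_integral (norm (f b))\<^sup>2 - (norm (f R))\<^sup>2) {R..b}"
    proof (rule fundamental_theorem_of_calculus[OF that])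
      fix x
      assume "x \<in> {R..b}"
      then have x: "0 < x"
        using R by simp
      have "((\<lambda>x. f x * cnj (f x)) has_vector_derivative f x * cnj (f1 x) + f1 x * cnj (f x)) (at x)"
        by (intro has_vector_derivative_mult has_vector_derivative_cnj' F(1) x)
      then have "((\<lambda>x. Re (f x * cnj (f x))) has_vector_derivative Re (f x * cnj (f1 x) + f1 x * cnj (f x))) (at x)"
        by (rule bounded_linear.has_vector_derivative[OF bounded_linear_Re])
      moreover have "Re (f x * cnj (f x)) = (norm (f x))\<^sup>2" for x
        by (simp add: complex_norm_square[symmetric] del: of_real_power)
      moreover have "Re (f x * cnj (f1 x) + f1 x * cnj (f x)) = 2 * r x"
        by (simp add: r_def)
      ultimately show "((\<lambda>x. (norm (f x))\<^sup>2) has_vector_derivative 2 * r x) (at x within {R..b})"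
        by (simp add: has_vector_derivative_at_within)
    qed
    moreover have "((\<lambda>x. 2) has_integral 2 * (b - R)) {R..b}"
      using has_integral_const_real[of "2::real" R b] that by (simp add: mult.commute)
    ultimately have "2 * (b - R) \<le> (norm (f b))\<^sup>2 - (norm (f R))\<^sup>2"
      using r1 by (elim has_integral_le[rotated 1]) auto
    then show ?thesis
      using zero_le_power2[of "norm (f R)"] by linarith
  qed
  have "\<exists>x\<ge>R+1. (norm (f x))\<^sup>2 < 1"
  proof (rule exists_small_value_of_bounded_integrals)
    show "(\<lambda>x. (norm (f x))\<^sup>2) integrable_on {1..b}" for b
      by (intro half_line_integrable_on square_integrable_integrable f) simp
    show "integral {1..b} (\<lambda>x. (norm (f x))\<^sup>2) \<le> integral\<^sup>L half_line (\<lambda>x. (norm (f x))\<^sup>2)" for b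
      by (intro half_line_integral_le square_integrable_integrable f) simp_all
  qed (use R in auto)
  then obtain x where "R + 1 \<le> x" "(norm (f x))\<^sup>2 < 1"
    by blast
  then show False
    using sq_ge[of x] by simp
qed

text \<open>One sequence serves two functions, because it is used for their bracket.\<close>

lemma bessel_vanishes_along_sequence:
  assumes ode: "bessel_ode \<nu> f f1 f2 g" and f: "square_integrable f" and g: "square_integrable g"
    and ode': "bessel_ode \<nu> h h1 h2 k" and h: "square_integrable h" and k: "square_integrable k"
  obtains b where "\<And>n. 1 \<le> b n" "filterlim b at_top sequentially"
    "(\<lambda>n. f (b n)) \<longlonglongrightarrow> 0" "(\<lambda>n. f1 (b n)) \<longlonglongrightarrow> 0" "(\<lambda>n. h (b n)) \<longlonglongrightarrow> 0" "(\<lambda>n. h1 (b n)) \<longlonglongrightarrow> 0"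
proof -
  define K where "K x = ((norm (f x))\<^sup>2 + (norm (f1 x))\<^sup>2) + ((norm (h x))\<^sup>2 + (norm (h1 x))\<^sup>2)" for x
  obtain B where B: "\<And>b. 1 \<le> b \<Longrightarrow> integral {1..b} (\<lambda>x. (norm (f1 x))\<^sup>2) \<le> B"
    using bessel_derivative_bounded_integrals[OF ode f g] by blast
  obtain B' where B': "\<And>b. 1 \<le> b \<Longrightarrow> integral {1..b} (\<lambda>x. (norm (h1 x))\<^sup>2) \<le> B'"
    using bessel_derivative_bounded_integrals[OF ode' h k] by blast
  have int: "(\<lambda>x. (norm (u x))\<^sup>2) integrable_on {1..b}" if "continuous_on {0<..} u" for u :: "real \<Rightarrow> complex" and b
    by (intro integrable_continuous_real continuous_intros continuous_on_subset[OF that]) auto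
  note int = int[OF bessel_odeD(5)[OF ode]] int[OF bessel_odeD(3)[OF ode]]
    int[OF bessel_odeD(5)[OF ode']] int[OF bessel_odeD(3)[OF ode']]
  let ?N = "\<lambda>f. integral\<^sup>L half_line (\<lambda>x. (norm (f x))\<^sup>2)"
  have "\<exists>x\<ge>1 + real n. K x < inverse (real (Suc n))" for n
  proof (rule exists_small_value_of_bounded_integrals)
    show "K integrable_on {1..b}" for b
      unfolding K_def by (intro integrable_add int)
    show "integral {1..b} K \<le> (?N f + B) + (?N h + B')" if "1 \<le> b" for b
    proof -
      have "integral {1..b} (\<lambda>x. (norm (u x))\<^sup>2) \<le> ?N u" if "square_integrable u" for u
        by (intro half_line_integral_le square_integrable_integrable that) simp_all
      from this[OF f] this[OF h] B[OF that] B'[OF that] show ?thesis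
        unfolding K_def by (simp add: integral_add integrable_add int)
    qed
  qed (auto simp: K_def)
  then obtain b where b: "\<And>n. 1 + real n \<le> b n" and Kb: "\<And>n. K (b n) < inverse (real (Suc n))"
    by metis
  have K0: "(\<lambda>n. K (b n)) \<longlonglongrightarrow> 0"
    by (rule tendsto_sandwich[OF _ _ tendsto_const LIMSEQ_inverse_real_of_nat])
      (use Kb in \<open>auto simp: K_def intro!: always_eventually less_imp_le\<close>)
  have lim0: "(\<lambda>n. u (b n)) \<longlonglongrightarrow> 0" if "\<And>x. (norm (u x))\<^sup>2 \<le> K x" for u :: "real \<Rightarrow> complex"
  proof -
    have "(\<lambda>n. (norm (u (b n)))\<^sup>2) \<longlonglongrightarrow> 0"
      by (rule tendsto_sandwich[OF _ _ tendsto_const K0]) (use that in auto)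
    then have "(\<lambda>n. sqrt ((norm (u (b n)))\<^sup>2)) \<longlonglongrightarrow> sqrt 0"
      by (rule tendsto_real_sqrt)
    then show ?thesis
      by (simp add: tendsto_norm_zero_iff)
  qed
  show thesis
  proof (rule that[of b])
    show "1 \<le> b n" for n
      using b[of n] by simp
    have "real n \<le> b n" for n
      using b[of n] by simp
    then show "filterlim b at_top sequentially"
      by (intro filterlim_at_top_mono[OF filterlim_real_sequentially] always_eventually) simp
  qed (auto intro!: lim0 simp: K_def)
qed

subsection \<open>Behaviour at the origin\<close>

text \<open>The bracket with a solution that is square integrable near the origin is an indefinite
  integral up to the origin.\<close>

lemma wronskian_tendsto_0:
  assumes ode: "bessel_ode \<nu> f f1 f2 g" and g: "square_integrable g"
    and p: "bessel_ode \<nu> p p1 p2 (\<lambda>_. 0)" and psq: "square_integrable (\<lambda>x. if x \<le> 1 then p x else 0)"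
    and x: "0 < x" "x \<le> 1"
  shows "(\<lambda>t. g t * cnj (p t)) integrable_on {0..x}"
    and "(wronskian f f1 p p1 \<longlongrightarrow> wronskian f f1 p p1 x - integral {0..x} (\<lambda>t. g t * cnj (p t))) (at_right 0)"
proof -
  let ?h = "\<lambda>t. g t * cnj (p t)"
  have "(\<lambda>t. g t * cnj (if t \<le> 1 then p t else 0)) integrable_on {0..x}"
    by (rule half_line_integrable_on[OF integrable_mult_cnj[OF g psq]]) simp
  then show int: "?h integrable_on {0..x}"
    by (rule integrable_eq) (use x in auto)
  have "continuous_on {0..x} (\<lambda>t. integral {t..x} ?h)"
    by (rule indefinite_integral_continuous_1'[OF int])
  then have "((\<lambda>t. integral {t..x} ?h) \<longlongrightarrow> integral {0..x} ?h) (at 0 within {0..x})"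
    using x by (auto simp: continuous_on_def)
  then have "((\<lambda>t. integral {t..x} ?h) \<longlongrightarrow> integral {0..x} ?h) (at_right 0)"
    using at_within_Icc_at_right[OF x(1)] by simp
  then have lim: "((\<lambda>t. wronskian f f1 p p1 x - integral {t..x} ?h) \<longlongrightarrow>
      wronskian f f1 p p1 x - integral {0..x} ?h) (at_right 0)"
    by (intro tendsto_intros)
  have "\<forall>\<^sub>F t in at_right 0. wronskian f f1 p p1 x - integral {t..x} ?h = wronskian f f1 p p1 t"
    unfolding eventually_at_right_field
  proof (intro exI[of _ x] conjI allI impI x(1))
    fix t
    assume "0 < t" "t < x"
    then have "(?h has_integral wronskian f f1 p p1 x - wronskian f f1 p p1 t) {t..x}"
      using wronskian_green[OF ode p, of t x] by simp
    then show "wronskian f f1 p p1 x - integral {t..x} ?h = wronskian f f1 p p1 t"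
      by (simp add: integral_unique)
  qed
  from Lim_transform_eventually[OF lim this]
  show "(wronskian f f1 p p1 \<longlongrightarrow> wronskian f f1 p p1 x - integral {0..x} ?h) (at_right 0)" .
qed

lemma bessel_odeI_real:
  fixes f f1 f2 g :: "real \<Rightarrow> real"
  assumes f: "\<And>x. 0 < x \<Longrightarrow> (f has_real_derivative f1 x) (at x)"
    and f1: "\<And>x. 0 < x \<Longrightarrow> (f1 has_real_derivative f2 x) (at x)"
    and f2: "continuous_on {0<..} f2"
    and g: "\<And>x. 0 < x \<Longrightarrow> g x = - f2 x + (\<nu>\<^sup>2 - 1/4) / x\<^sup>2 * f x"
  shows "bessel_ode \<nu> (\<lambda>x. of_real (f x)) (\<lambda>x. of_real (f1 x)) (\<lambda>x. of_real (f2 x)) (\<lambda>x. of_real (g x))"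
proof -
  have vd: "((\<lambda>x. complex_of_real (h x)) has_vector_derivative of_real h') (at x)"
    if "(h has_real_derivative h') (at x)" for h h' x
    using that by (intro has_vector_derivative_of_real) (simp add: has_real_derivative_iff_has_vector_derivative)
  have f1': "((\<lambda>x. complex_of_real (f1 x)) has_vector_derivative of_real (f2 x)) (at x)" if "0 < x" for x
    by (rule vd[OF f1[OF that]])
  show ?thesis
    unfolding bessel_ode_def
  proof (intro conjI allI impI)
    show "locally_absolutely_continuous (\<lambda>x. complex_of_real (f1 x))"
      by (rule locally_absolutely_continuous_C1[OF f1']) (use f2 in \<open>auto intro!: continuous_intros\<close>)
    show "AE x in half_line. ((\<lambda>x. complex_of_real (f1 x)) has_vector_derivative of_real (f2 x)) (at x)"
      by (rule AE_I2) (simp add: f1')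
    show "complex_of_real (g x) = - of_real (f2 x) + of_real ((\<nu>\<^sup>2 - 1/4) / x\<^sup>2) * of_real (f x)" if "0 < x" for x
      unfolding g[OF that] by (simp only: of_real_add of_real_minus of_real_mult)
  qed (rule vd[OF f])
qed

lemma integrable_on_powr_dominator:
  assumes "-1 < (\<alpha>::real)"
  shows "(\<lambda>x. if x \<le> 1 then x powr \<alpha> else x powr (-2)) integrable_on {0<..}"
proof -
  let ?w = "\<lambda>x. if x \<le> 1 then x powr \<alpha> else x powr (-2::real)"
  have "(\<lambda>x. x powr \<alpha>) integrable_on {0..1}"
    using has_integral_powr_from_0[OF assms, of 1] by auto
  then have 1: "?w integrable_on {0..1}"
    by (rule integrable_eq) auto
  have "(\<lambda>x. x powr (-2)) integrable_on {1::real..}"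
    using has_integral_powr_to_inf[of "-2" "1"] by auto
  then have 2: "?w integrable_on {1..}"
    by (rule integrable_eq) auto
  have "?w integrable_on ({0..1} \<union> {1..})"
    by (rule integrable_Un[OF _ 1 2]) (rule negligible_subset[of "{1}"], auto)
  then show ?thesis
    by (rule integrable_spike_set) (auto intro: negligible_subset[of "{0}"])
qed

text \<open>The exponent \<open>-2\<close> is just one that is integrable at infinity.\<close>

lemma square_integrable_by_powr:
  assumes "f \<in> borel_measurable half_line" "-1 < \<alpha>"
    and "\<And>x. 0 < x \<Longrightarrow> x \<le> 1 \<Longrightarrow> (norm (f x))\<^sup>2 \<le> C * x powr \<alpha>"
    and "\<And>x. 1 < x \<Longrightarrow> (norm (f x))\<^sup>2 \<le> C * x powr (-2)"
  shows "square_integrable f"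
proof -
  have "(\<lambda>x. (norm (f x))\<^sup>2) absolutely_integrable_on {0<..}"
  proof (rule measurable_bounded_by_integrable_imp_absolutely_integrable)
    show "(\<lambda>x. C * (if x \<le> 1 then x powr \<alpha> else x powr (-2))) integrable_on {0<..}"
      by (intro integrable_on_mult_right integrable_on_powr_dominator assms)
  qed (use assms in auto)
  then show ?thesis
    using assms(1) by (simp add: square_integrable_def half_line_absolutely_integrable)
qed

lemma bessel_ode_powr:
  assumes "m\<^sup>2 - m = \<nu>\<^sup>2 - 1/4"
  shows "bessel_ode \<nu> (\<lambda>x. of_real (x powr m)) (\<lambda>x. of_real (m * x powr (m - 1)))
    (\<lambda>x. of_real (m * ((m - 1) * x powr (m - 2)))) (\<lambda>_. 0)"
proof -
  have "bessel_ode \<nu> (\<lambda>x. of_real (x powr m)) (\<lambda>x. of_real (m * x powr (m - 1)))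
    (\<lambda>x. of_real (m * ((m - 1) * x powr (m - 2)))) (\<lambda>_. of_real 0)"
  proof (rule bessel_odeI_real)
    fix x :: real
    assume x: "0 < x"
    show "((\<lambda>x. x powr m) has_real_derivative m * x powr (m - 1)) (at x)"
      using x by (auto intro!: derivative_eq_intros)
    show "((\<lambda>x. m * x powr (m - 1)) has_real_derivative m * ((m - 1) * x powr (m - 2))) (at x)"
      using x by (auto intro!: derivative_eq_intros simp: algebra_simps)
    have "x powr (m - 2) = x powr m / x\<^sup>2"
      using x by (simp add: powr_diff)
    then show "0 = - (m * ((m - 1) * x powr (m - 2))) + (\<nu>\<^sup>2 - 1/4) / x\<^sup>2 * x powr m"
      unfolding assms[symmetric] by (simp add: power2_eq_square algebra_simps diff_divide_distrib)
  qed (auto intro!: continuous_intros)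
  then show ?thesis
    by simp
qed

lemma square_integrable_powr_near_0:
  assumes "-1/2 < m"
  shows "square_integrable (\<lambda>x. if x \<le> 1 then of_real (x powr m) else 0)"
proof (rule square_integrable_by_powr[where C = 1])
  have "(\<lambda>x. complex_of_real (x powr m)) \<in> borel_measurable half_line"
    by (intro continuous_on_measurable_half_line continuous_intros) auto
  then show "(\<lambda>x. if x \<le> 1 then complex_of_real (x powr m) else 0) \<in> borel_measurable half_line"
  proof (rule measurable_If)
    have "{0<..1::real} \<in> sets half_line"
      by (auto simp: sets_restrict_space_iff)
    also have "{0<..1::real} = {x \<in> space half_line. x \<le> 1}"
      by auto
    finally show "{x \<in> space half_line. x \<le> 1} \<in> sets half_line" .
  qed simp_all
  show "-1 < 2 * m"
    using assms by simp
  show "(norm (if x \<le> 1 then complex_of_real (x powr m) else 0))\<^sup>2 \<le> 1 * x powr (2 * m)"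
    if "0 < x" "x \<le> 1" for x
    using that by (simp add: power2_eq_square powr_add[symmetric])
qed auto

subsection \<open>The factorization up to the boundary\<close>

text \<open>If the bracket with \<open>p = x\<^sup>m\<close>, \<open>m = 1/2 + \<mu>\<close>, vanishes at the origin, it equals the integral
  of \<open>\<tau>\<^sub>\<nu> f \<cdot> p\<close> from the origin up to sign. The bound is that of Cauchy and Schwarz, obtained from
  \<open>2 \<bar>g p\<bar> \<le> \<kappa> \<bar>g\<bar>\<^sup>2 + p\<^sup>2 / \<kappa>\<close> with the weight \<open>\<kappa> = x\<^sup>1\<^sup>+\<^sup>\<mu>\<close>, which is of the size of the
  \<open>L\<^sup>2\<close> norm of \<open>p\<close> on \<open>(0, x)\<close>.\<close>

lemma wronskian_powr_bound:
  assumes ode: "bessel_ode \<nu> f f1 f2 g" and g: "square_integrable g"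
    and \<mu>: "-1 < \<mu>" "\<mu> < 1" "\<mu>\<^sup>2 = \<nu>\<^sup>2" and m: "m = 1/2 + \<mu>"
    and lim: "(wronskian f f1 (\<lambda>x. of_real (x powr m)) (\<lambda>x. of_real (m * x powr (m - 1))) \<longlongrightarrow> 0) (at_right 0)"
  obtains C where "0 \<le> C" "\<And>x. 0 < x \<Longrightarrow> x \<le> 1 \<Longrightarrow>
    norm (wronskian f f1 (\<lambda>x. of_real (x powr m)) (\<lambda>x. of_real (m * x powr (m - 1))) x) \<le> C * x powr (1 + \<mu>)"
proof -
  let ?p = "\<lambda>x. complex_of_real (x powr m)"
  let ?w = "wronskian f f1 ?p (\<lambda>x. of_real (m * x powr (m - 1)))"
  let ?N = "integral\<^sup>L half_line (\<lambda>x. (norm (g x))\<^sup>2)"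
  have mm: "m\<^sup>2 - m = \<nu>\<^sup>2 - 1/4"
    unfolding m \<mu>(3)[symmetric] by (simp add: power2_eq_square algebra_simps)
  note p = bessel_ode_powr[OF mm] and psq = square_integrable_powr_near_0[of m]
  have m_gt: "-1/2 < m"
    using \<mu> m by simp
  define C where "C = ?N / 2 + 1 / (2 * (2 + 2 * \<mu>))"
  show thesis
  proof (rule that[of C])
    have "0 \<le> ?N"
      by (intro integral_nonneg_AE) simp
    then show "0 \<le> C"
      using \<mu> by (simp add: C_def)
    fix x :: real
    assume x: "0 < x" "x \<le> 1"
    note tend = wronskian_tendsto_0[OF ode g p psq[OF m_gt] x]
    have "?w x - integral {0..x} (\<lambda>t. g t * cnj (?p t)) = 0"
      using tendsto_unique[OF _ tend(2) lim] by simp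
    then have "norm (?w x) = norm (integral {0..x} (\<lambda>t. g t * cnj (?p t)))"
      by simp
    also have "\<dots> \<le> integral {0..x} (\<lambda>t. x powr (1 + \<mu>) / 2 * (norm (g t))\<^sup>2
        + 1 / (2 * x powr (1 + \<mu>)) * t powr (1 + 2 * \<mu>))"
    proof (rule integral_norm_bound_integral[OF tend(1)])
      show "(\<lambda>t. x powr (1 + \<mu>) / 2 * (norm (g t))\<^sup>2 + 1 / (2 * x powr (1 + \<mu>)) * t powr (1 + 2 * \<mu>)) integrable_on {0..x}"
      proof (intro integrable_add integrable_on_mult_right)
        show "(\<lambda>t. (norm (g t))\<^sup>2) integrable_on {0..x}"
          by (intro half_line_integrable_on square_integrable_integrable g) simp
        show "(\<lambda>t. t powr (1 + 2 * \<mu>)) integrable_on {0..x}"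
          using has_integral_powr_from_0[of "1 + 2 * \<mu>" x] \<mu> x by auto
      qed
      fix t
      assume t: "t \<in> {0..x}"
      define \<kappa> where "\<kappa> = x powr (1 + \<mu>)"
      have "0 < \<kappa>"
        using x by (simp add: \<kappa>_def)
      have pt: "(t powr m)\<^sup>2 = t powr (1 + 2 * \<mu>)"
        using t m by (simp add: power2_eq_square powr_add[symmetric])
      have "0 \<le> (\<kappa> * norm (g t) - t powr m)\<^sup>2 / (2 * \<kappa>)"
        using \<open>0 < \<kappa>\<close> by simp
      also have "\<dots> = \<kappa> / 2 * (norm (g t))\<^sup>2 + 1 / (2 * \<kappa>) * (t powr m)\<^sup>2 - norm (g t) * t powr m"
        using \<open>0 < \<kappa>\<close> by (simp add: power2_eq_square field_simps)
      finally show "norm (g t * cnj (?p t)) \<le> x powr (1 + \<mu>) / 2 * (norm (g t))\<^sup>2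
          + 1 / (2 * x powr (1 + \<mu>)) * t powr (1 + 2 * \<mu>)"
        unfolding pt \<kappa>_def by (simp add: norm_mult)
    qed
    also have "\<dots> = x powr (1 + \<mu>) / 2 * integral {0..x} (\<lambda>t. (norm (g t))\<^sup>2)
        + 1 / (2 * x powr (1 + \<mu>)) * (x powr (2 + 2 * \<mu>) / (2 + 2 * \<mu>))"
    proof -
      have "((\<lambda>t. t powr (1 + 2 * \<mu>)) has_integral (x powr (2 + 2 * \<mu>) / (2 + 2 * \<mu>))) {0..x}"
        using has_integral_powr_from_0[of "1 + 2 * \<mu>" x] \<mu> x by simp
      moreover have "((\<lambda>t. (norm (g t))\<^sup>2) has_integral integral {0..x} (\<lambda>t. (norm (g t))\<^sup>2)) {0..x}"
        by (intro integrable_integral half_line_integrable_on square_integrable_integrable g) simp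
      ultimately show ?thesis
        by (intro integral_unique has_integral_add has_integral_mult_right)
    qed
    also have "\<dots> \<le> x powr (1 + \<mu>) / 2 * ?N + 1 / (2 * x powr (1 + \<mu>)) * (x powr (2 + 2 * \<mu>) / (2 + 2 * \<mu>))"
      by (intro add_right_mono mult_left_mono half_line_integral_le square_integrable_integrable g) auto
    also have "\<dots> = C * x powr (1 + \<mu>)"
    proof -
      have "x powr (2 + 2 * \<mu>) = x powr (1 + \<mu>) * x powr (1 + \<mu>)"
        by (simp add: powr_add[symmetric])
      moreover have "x powr (1 + \<mu>) \<noteq> 0" "2 + 2 * \<mu> \<noteq> 0"
        using x \<mu> by auto
      ultimately show ?thesis
        unfolding C_def by (simp add: divide_simps) (simp add: algebra_simps)
    qed
    finally show "norm (?w x) \<le> C * x powr (1 + \<mu>)" .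
  qed
qed

text \<open>The boundary term is \<open>- [f, p] \<cdot> cnj (f / p)\<close>, and \<open>f / p\<close> is bounded near the origin since
  \<open>(f / p)' = - [f, p] / p\<^sup>2 = O(x\<^sup>-\<^sup>\<mu>)\<close> with \<open>\<mu> < 1\<close>.\<close>

lemma bessel_energy_boundary_term_vanishes:
  assumes ode: "bessel_ode \<nu> f f1 f2 g" and g: "square_integrable g"
    and \<mu>: "-1 < \<mu>" "\<mu> < 1" "\<mu>\<^sup>2 = \<nu>\<^sup>2" and m: "m = 1/2 + \<mu>"
    and lim: "(wronskian f f1 (\<lambda>x. of_real (x powr m)) (\<lambda>x. of_real (m * x powr (m - 1))) \<longlongrightarrow> 0) (at_right 0)"
  shows "((\<lambda>x. f1 x * cnj (f x) - of_real (m / x) * (f x * cnj (f x))) \<longlongrightarrow> 0) (at_right 0)"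
proof -
  note F = bessel_odeD[OF ode]
  let ?p = "\<lambda>x. complex_of_real (x powr m)"
  let ?w = "wronskian f f1 ?p (\<lambda>x. of_real (m * x powr (m - 1)))"
  obtain C where "0 \<le> C" and C: "\<And>x. 0 < x \<Longrightarrow> x \<le> 1 \<Longrightarrow> norm (?w x) \<le> C * x powr (1 + \<mu>)"
    using wronskian_powr_bound[OF ode g \<mu> m lim] by blast
  define u where "u x = f x * of_real (x powr (- m))" for x
  have u': "(u has_vector_derivative - (?w x * of_real (x powr (- 2 * m)))) (at x)" if x: "0 < x" for x
  proof -
    have "((\<lambda>x. x powr (- m)) has_real_derivative - m * x powr (- m - 1)) (at x)"
      using x by (auto intro!: derivative_eq_intros)
    then have "((\<lambda>x. complex_of_real (x powr (- m))) has_vector_derivative of_real (- m * x powr (- m - 1))) (at x)"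
      by (intro has_vector_derivative_of_real) (simp add: has_real_derivative_iff_has_vector_derivative)
    then have "(u has_vector_derivative f x * of_real (- m * x powr (- m - 1)) + f1 x * of_real (x powr (- m))) (at x)"
      unfolding u_def by (intro has_vector_derivative_mult F(1) x)
    moreover have "x powr (- m - 1) = x powr (m - 1) * x powr (- 2 * m)" "x powr (- m) = x powr m * x powr (- 2 * m)"
      by (simp_all add: powr_add[symmetric])
    ultimately show ?thesis
      by (simp add: wronskian_def algebra_simps)
  qed
  define M where "M = norm (u 1) + C / (1 - \<mu>)"
  have "0 \<le> M"
    using \<open>0 \<le> C\<close> \<mu> by (simp add: M_def)
  have u_bound: "norm (u x) \<le> M" if x: "0 < x" "x < 1" for x
  proof -
    have "norm (u 1 - u x) \<le> C / (1 - \<mu>) * 1 powr (1 - \<mu>) - C / (1 - \<mu>) * x powr (1 - \<mu>)"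
    proof (rule differentiable_bound_general[OF x(2)])
      show "continuous_on {x..1} u"
        using x by (intro continuous_at_imp_continuous_on ballI has_vector_derivative_continuous[OF u']) auto
      show "continuous_on {x..1} (\<lambda>t. C / (1 - \<mu>) * t powr (1 - \<mu>))"
        using x by (intro continuous_intros) auto
      fix t
      assume t: "x < t" "t < 1"
      show "(u has_vector_derivative - (?w t * of_real (t powr (- 2 * m)))) (at t)"
        using t x by (intro u') simp
      have "((\<lambda>t. C / (1 - \<mu>) * t powr (1 - \<mu>)) has_real_derivative C * t powr (- \<mu>)) (at t)"
        using t x \<mu> by (auto intro!: derivative_eq_intros)
      then show "((\<lambda>t. C / (1 - \<mu>) * t powr (1 - \<mu>)) has_vector_derivative C * t powr (- \<mu>)) (at t)"
        by (simp add: has_real_derivative_iff_has_vector_derivative)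
      have "norm (- (?w t * of_real (t powr (- 2 * m)))) = norm (?w t) * t powr (- 2 * m)"
        by (simp add: norm_mult)
      also have "\<dots> \<le> C * t powr (1 + \<mu>) * t powr (- 2 * m)"
        using t x by (intro mult_right_mono C) auto
      also have "\<dots> = C * t powr (- \<mu>)"
        using m by (simp add: mult.assoc powr_add[symmetric])
      finally show "norm (- (?w t * of_real (t powr (- 2 * m)))) \<le> C * t powr (- \<mu>)" .
    qed
    also have "\<dots> \<le> C / (1 - \<mu>)"
      using \<open>0 \<le> C\<close> \<mu> by simp
    finally show ?thesis
      unfolding M_def using norm_triangle_ineq2[of "u x" "u 1"] by (simp add: norm_minus_commute)
  qed
  have V: "f1 x * cnj (f x) - of_real (m / x) * (f x * cnj (f x)) = - (?w x * cnj (u x))" if x: "0 < x" for x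
  proof -
    have "x powr (m - 1) = x powr m / x"
      using x by (simp add: powr_diff)
    moreover have "complex_of_real (x powr m) * of_real (x powr (- m)) = 1"
      using x by (simp add: powr_minus flip: of_real_mult)
    ultimately show ?thesis
      by (simp add: wronskian_def u_def algebra_simps)
  qed
  show ?thesis
  proof (rule Lim_null_comparison)
    show "\<forall>\<^sub>F x in at_right 0. norm (f1 x * cnj (f x) - of_real (m / x) * (f x * cnj (f x))) \<le> C * x powr (1 + \<mu>) * M"
      unfolding eventually_at_right_field
    proof (intro exI[of _ 1] conjI allI impI)
      fix x :: real
      assume x: "0 < x" "x < 1"
      show "norm (f1 x * cnj (f x) - of_real (m / x) * (f x * cnj (f x))) \<le> C * x powr (1 + \<mu>) * M"
        unfolding V[OF x(1)] norm_minus_cancel norm_mult complex_mod_cnj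
        using x \<open>0 \<le> C\<close> by (intro mult_mono C u_bound) auto
    qed simp
    have "((\<lambda>x. x powr (1 + \<mu>)) \<longlongrightarrow> 0) (at_right 0)"
      using \<mu> by real_asymp
    then show "((\<lambda>x. C * x powr (1 + \<mu>) * M) \<longlongrightarrow> 0) (at_right 0)"
      by (auto intro!: tendsto_mult_left_zero tendsto_mult_right_zero)
  qed
qed

lemma inverse_Suc_at_right_0: "filterlim (\<lambda>n. inverse (real (Suc n))) (at_right 0) sequentially"
  by (rule tendsto_imp_filterlim_at_right[OF LIMSEQ_inverse_real_of_nat]) simp

text \<open>The form is the limit of integrals of \<open>\<bar>D f\<bar>\<^sup>2\<close> over intervals exhausting the half-line.\<close>

lemma bessel_form_nonneg:
  assumes ode: "bessel_ode \<nu> f f1 f2 g" and f: "square_integrable f" and g: "square_integrable g"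
    and \<mu>: "-1 < \<mu>" "\<mu> < 1" "\<mu>\<^sup>2 = \<nu>\<^sup>2" and m: "m = 1/2 + \<mu>"
    and lim: "(wronskian f f1 (\<lambda>x. of_real (x powr m)) (\<lambda>x. of_real (m * x powr (m - 1))) \<longlongrightarrow> 0) (at_right 0)"
  shows "cinner (abs_l2 g) (abs_l2 f) \<in> \<real>\<^sub>\<ge>\<^sub>0"
proof -
  obtain b where b: "\<And>n. 1 \<le> b n" "filterlim b at_top sequentially"
      "(\<lambda>n. f (b n)) \<longlonglongrightarrow> 0" "(\<lambda>n. f1 (b n)) \<longlonglongrightarrow> 0"
    using bessel_vanishes_along_sequence[OF ode f g ode f g] by metis
  define a where "a n = inverse (real (Suc n))" for n
  have a: "0 < a n" "a n \<le> b n" for n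
  proof -
    show "0 < a n"
      by (simp add: a_def)
    have "a n \<le> 1"
      by (simp add: a_def field_simps)
    then show "a n \<le> b n"
      using b(1)[of n] by linarith
  qed
  have a0: "a \<longlonglongrightarrow> 0"
    unfolding a_def by (rule LIMSEQ_inverse_real_of_nat)
  have mm: "m\<^sup>2 - m = \<nu>\<^sup>2 - 1/4"
    unfolding m \<mu>(3)[symmetric] by (simp add: power2_eq_square algebra_simps)
  define V where "V x = f1 x * cnj (f x) - of_real (m / x) * (f x * cnj (f x))" for x
  have "(V \<longlongrightarrow> 0) (at_right 0)"
    unfolding V_def by (rule bessel_energy_boundary_term_vanishes[OF ode g \<mu> m lim])
  then have Va: "(\<lambda>n. V (a n)) \<longlonglongrightarrow> 0"
    unfolding a_def by (rule filterlim_compose[OF _ inverse_Suc_at_right_0])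
  have "(\<lambda>n. m / b n) \<longlonglongrightarrow> 0"
    by (rule tendsto_divide_0[OF tendsto_const filterlim_at_top_imp_at_infinity[OF b(2)]])
  then have "(\<lambda>n. V (b n)) \<longlonglongrightarrow> 0 * cnj 0 - of_real 0 * (0 * cnj 0)"
    unfolding V_def by (intro tendsto_diff tendsto_mult tendsto_cnj tendsto_of_real b)
  then have Vb: "(\<lambda>n. V (b n)) \<longlonglongrightarrow> 0"
    by simp
  let ?D = "\<lambda>x. (norm (f1 x - of_real (m / x) * f x))\<^sup>2"
  have int: "integrable half_line (\<lambda>x. g x * cnj (f x))"
    by (rule integrable_mult_cnj[OF g f])
  have pos: "V (b n) - V (a n) + integral {a n..b n} (\<lambda>x. g x * cnj (f x)) \<in> \<real>\<^sub>\<ge>\<^sub>0" for n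
  proof -
    have "((\<lambda>x. g x * cnj (f x)) has_integral integral {a n..b n} (\<lambda>x. g x * cnj (f x))) {a n..b n}"
      using a(1)[of n] by (intro integrable_integral half_line_integrable_on[OF int]) simp
    from has_integral_add[OF bessel_energy_identity[OF ode mm a(1)[of n] a(2)[of n]] this]
    have D: "((\<lambda>x. complex_of_real (?D x)) has_integral
        V (b n) - V (a n) + integral {a n..b n} (\<lambda>x. g x * cnj (f x))) {a n..b n}"
      by (simp add: V_def)
    have "?D integrable_on {a n..b n}"
      using has_integral_linear[OF D bounded_linear_Re] by (auto simp: o_def)
    then have "((\<lambda>x. complex_of_real (?D x)) has_integral of_real (integral {a n..b n} ?D)) {a n..b n}"
      by (intro has_integral_of_real integrable_integral)
    then have "V (b n) - V (a n) + integral {a n..b n} (\<lambda>x. g x * cnj (f x)) = of_real (integral {a n..b n} ?D)"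
      using D has_integral_unique by blast
    moreover have "0 \<le> integral {a n..b n} ?D"
      by (rule integral_nonneg) (use \<open>?D integrable_on {a n..b n}\<close> in auto)
    ultimately show ?thesis
      by (simp del: of_real_power)
  qed
  have lim: "(\<lambda>n. V (b n) - V (a n) + integral {a n..b n} (\<lambda>x. g x * cnj (f x)))
      \<longlonglongrightarrow> 0 - 0 + integral\<^sup>L half_line (\<lambda>x. g x * cnj (f x))"
    by (intro tendsto_add tendsto_diff Va Vb half_line_integral_limit[OF int a(1) a0 b(2)])
  have "0 - 0 + integral\<^sup>L half_line (\<lambda>x. g x * cnj (f x)) \<in> \<real>\<^sub>\<ge>\<^sub>0"
    by (rule closed_sequentially[OF closed_nonneg_Reals_complex pos lim])
  then show ?thesis
    by (simp add: cinner_abs_l2 f g)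
qed

text \<open>There is no contribution from infinity, where all functions in the maximal domain and their
  derivatives vanish along a common sequence.\<close>

lemma bessel_green:
  assumes ode: "bessel_ode \<nu> f f1 f2 g" and f: "square_integrable f" and g: "square_integrable g"
    and ode': "bessel_ode \<nu> h h1 h2 k" and h: "square_integrable h" and k: "square_integrable k"
    and lim: "(wronskian f f1 h h1 \<longlongrightarrow> L) (at_right 0)"
  shows "cinner (abs_l2 g) (abs_l2 h) - cinner (abs_l2 f) (abs_l2 k) = - L"
proof -
  obtain b where b: "\<And>n. 1 \<le> b n" "filterlim b at_top sequentially"
      "(\<lambda>n. f (b n)) \<longlonglongrightarrow> 0" "(\<lambda>n. f1 (b n)) \<longlonglongrightarrow> 0" "(\<lambda>n. h (b n)) \<longlonglongrightarrow> 0" "(\<lambda>n. h1 (b n)) \<longlonglongrightarrow> 0"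
    using bessel_vanishes_along_sequence[OF ode f g ode' h k] by metis
  define a where "a n = inverse (real (Suc n))" for n
  have a: "0 < a n" "a n \<le> b n" for n
  proof -
    show "0 < a n"
      by (simp add: a_def)
    have "a n \<le> 1"
      by (simp add: a_def field_simps)
    then show "a n \<le> b n"
      using b(1)[of n] by linarith
  qed
  have a0: "a \<longlonglongrightarrow> 0"
    unfolding a_def by (rule LIMSEQ_inverse_real_of_nat)
  let ?W = "wronskian f f1 h h1" and ?i = "\<lambda>x. g x * cnj (h x) - f x * cnj (k x)"
  have int: "integrable half_line ?i"
    by (intro Bochner_Integration.integrable_diff integrable_mult_cnj f g h k)
  have "integral {a n..b n} ?i = ?W (b n) - ?W (a n)" for n
    using wronskian_green[OF ode ode' a(1)[of n] a(2)[of n]] by (rule integral_unique)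
  moreover have "(\<lambda>n. ?W (b n)) \<longlonglongrightarrow> 0 * cnj 0 - 0 * cnj 0"
    unfolding wronskian_def by (intro tendsto_diff tendsto_mult tendsto_cnj b)
  moreover have "(\<lambda>n. ?W (a n)) \<longlonglongrightarrow> L"
    unfolding a_def by (rule filterlim_compose[OF lim inverse_Suc_at_right_0])
  ultimately have "(\<lambda>n. integral {a n..b n} ?i) \<longlonglongrightarrow> 0 * cnj 0 - 0 * cnj 0 - L"
    by (simp only: tendsto_diff)
  moreover have "(\<lambda>n. integral {a n..b n} ?i) \<longlonglongrightarrow> integral\<^sup>L half_line ?i"
    by (rule half_line_integral_limit[OF int a(1) a0 b(2)])
  ultimately have "integral\<^sup>L half_line ?i = - L"
    using LIMSEQ_unique by fastforce
  then show ?thesis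
    by (simp add: cinner_abs_l2 f g h k integrable_mult_cnj)
qed

subsection \<open>The adjoint of the minimal operator\<close>

definition bessel_maximal :: "real \<Rightarrow> l2_op"
  where "bessel_maximal \<nu> = {(abs_l2 f, abs_l2 g) | f g. bessel_pair \<nu> f g}"

definition bessel_compact_support :: "real \<Rightarrow> l2_op"
  where "bessel_compact_support \<nu> = {(abs_l2 f, abs_l2 g) | f g. bessel_pair \<nu> f g \<and>
      (\<exists>K. compact K \<and> K \<subseteq> {0<..} \<and> (\<forall>x>0. x \<notin> K \<longrightarrow> f x = 0))}"

lemma bessel_minimal_eq: "bessel_minimal \<nu> = closure (bessel_compact_support \<nu>)"
  by (simp add: bessel_minimal_def bessel_compact_support_def)

lemma AE_half_lineI:
  assumes "negligible N" "\<And>x. 0 < x \<Longrightarrow> x \<notin> N \<Longrightarrow> P x"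
  shows "AE x in half_line. P x"
proof -
  have "AE x in lebesgue. x \<in> {0<..} \<longrightarrow> P x"
    unfolding eventually_ae_filter_negligible using assms by (intro exI[of _ N]) auto
  then show ?thesis
    by (subst AE_restrict_space_iff) auto
qed

lemma AE_half_lineD:
  assumes "AE x in half_line. P x"
  shows "negligible {x. 0 < x \<and> \<not> P x}"
proof -
  have "AE x in lebesgue. x \<in> {0<..} \<longrightarrow> P x"
    using assms by (subst (asm) AE_restrict_space_iff) auto
  then show ?thesis
    unfolding eventually_ae_filter_negligible by (auto intro: negligible_subset)
qed

lemma vector_derivative_zero_on_open:
  assumes "(f has_vector_derivative f') (at x)" "open S" "x \<in> S" "\<And>y. y \<in> S \<Longrightarrow> f y = 0"
  shows "f' = 0"
proof -
  have "((\<lambda>y. 0) has_vector_derivative f') (at x)"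
    by (rule has_vector_derivative_transform_within_open[OF assms(1-3)]) (simp add: assms(4))
  then show ?thesis
    using vector_derivative_unique_at has_vector_derivative_const by blast
qed

lemma bessel_maximal_subset_adjoint: "bessel_maximal \<nu> \<subseteq> adjoint_op (bessel_compact_support \<nu>)"
proof (rule subrelI)
  fix u v
  assume "(u, v) \<in> bessel_maximal \<nu>"
  then obtain h k h1 h2 where uv: "u = abs_l2 h" "v = abs_l2 k" and h: "square_integrable h" "square_integrable k"
      "bessel_ode \<nu> h h1 h2 k"
    unfolding bessel_maximal_def bessel_pair_iff by blast
  show "(u, v) \<in> adjoint_op (bessel_compact_support \<nu>)"
    unfolding adjoint_op_iff
  proof (intro allI impI)
    fix p q
    assume "(p, q) \<in> bessel_compact_support \<nu>"
    then obtain f g f1 f2 K where pq: "p = abs_l2 f" "q = abs_l2 g" and f: "square_integrable f" "square_integrable g"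
        "bessel_ode \<nu> f f1 f2 g" and K: "compact K" "K \<subseteq> {0<..}" "\<And>x. 0 < x \<Longrightarrow> x \<notin> K \<Longrightarrow> f x = 0"
      unfolding bessel_compact_support_def bessel_pair_iff by blast
    have "open (- K)" "0 \<in> - K"
      using K compact_imp_closed by (auto simp: open_Compl)
    then obtain d where "0 < d" and d: "ball 0 d \<subseteq> - K"
      using open_contains_ball by blast
    have "wronskian f f1 h h1 x = 0" if x: "0 < x" "x < d" for x
    proof -
      have f0: "f y = 0" if "y \<in> {0<..<d}" for y
      proof (rule K(3))
        have "y \<in> ball 0 d"
          using that by (simp add: dist_real_def)
        then show "y \<notin> K"
          using d by blast
      qed (use that in simp)
      moreover have "f1 x = 0"
        by (rule vector_derivative_zero_on_open[OF bessel_odeD(1)[OF f(3) x(1)], of "{0<..<d}"]) (use x f0 in auto)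
      ultimately show ?thesis
        using x by (simp add: wronskian_def)
    qed
    then have "\<forall>\<^sub>F x in at_right 0. wronskian f f1 h h1 x = 0"
      unfolding eventually_at_right_field using \<open>0 < d\<close> by blast
    then have "(wronskian f f1 h h1 \<longlongrightarrow> 0) (at_right 0)"
      by (rule tendsto_eventually)
    from bessel_green[OF f(3,1,2) h(3,1,2) this] show "cinner q u = cinner p v"
      by (simp add: uv pq)
  qed
qed

lemma square_integrable_bounded_mult:
  assumes g: "square_integrable g" and \<phi>: "\<phi> \<in> borel_measurable half_line"
    and bound: "\<And>x. 0 < x \<Longrightarrow> norm (\<phi> x) \<le> C"
  shows "square_integrable (\<lambda>x. \<phi> x * g x)"
  unfolding square_integrable_def
proof
  have [measurable]: "g \<in> borel_measurable half_line" "\<phi> \<in> borel_measurable half_line"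
    using g \<phi> by (auto simp: square_integrable_def)
  show "(\<lambda>x. \<phi> x * g x) \<in> borel_measurable half_line"
    by measurable
  show "integrable half_line (\<lambda>x. (norm (\<phi> x * g x))\<^sup>2)"
  proof (rule Bochner_Integration.integrable_bound)
    show "integrable half_line (\<lambda>x. C\<^sup>2 * (norm (g x))\<^sup>2)"
      using g by (intro integrable_mult_right square_integrable_integrable)
    show "AE x in half_line. norm ((norm (\<phi> x * g x))\<^sup>2) \<le> norm (C\<^sup>2 * (norm (g x))\<^sup>2)"
      using bound by (intro AE_I2) (auto simp: norm_mult power_mult_distrib intro!: mult_right_mono power_mono)
  qed measurable
qed

lemma square_integrable_localize:
  assumes "square_integrable g" "0 < a"
  shows "square_integrable (\<lambda>x. if x \<in> {a..b} then g x else 0)"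
proof -
  have "(\<lambda>x. indicator {a..b} x :: complex) \<in> borel_measurable half_line"
    by (intro measurable_restrict_space1 borel_measurable_indicator) auto
  from square_integrable_bounded_mult[OF assms(1) this, of 1]
  have "square_integrable (\<lambda>x. indicator {a..b} x * g x)"
    by (simp add: indicator_def)
  moreover have "(\<lambda>x. indicator {a..b} x * g x) = (\<lambda>x. if x \<in> {a..b} then g x else 0)"
    by (auto simp: indicator_def)
  ultimately show ?thesis
    by simp
qed

lemma square_integrable_continuous_localized:
  assumes "continuous_on {0<..} g" "0 < a"
  shows "square_integrable (\<lambda>x. if x \<in> {a..b} then g x else 0)"
proof -
  have "bounded (g ` {a..b})"
    using assms by (intro compact_imp_bounded compact_continuous_image continuous_on_subset[OF assms(1)]) auto
  then obtain C where "\<forall>y\<in>g ` {a..b}. norm y \<le> C"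
    unfolding bounded_iff by blast
  then have C: "norm (g x) \<le> C" if "x \<in> {a..b}" for x
    using that by blast
  have meas: "(\<lambda>x. indicator {a..b} x * g x) \<in> borel_measurable half_line"
    by (intro borel_measurable_times continuous_on_measurable_half_line assms measurable_restrict_space1
        borel_measurable_indicator) auto
  have eq: "(\<lambda>x. indicator {a..b} x * g x) = (\<lambda>x. if x \<in> {a..b} then g x else 0)"
    by (auto simp: indicator_def)
  have "(\<lambda>x. (norm (if x \<in> {a..b} then g x else 0))\<^sup>2) absolutely_integrable_on {0<..}"
  proof (rule measurable_bounded_by_integrable_imp_absolutely_integrable)
    have "{a..b} \<inter> {0<..} = {a..b}"
      using assms(2) by auto
    then show "(\<lambda>x::real. if x \<in> {a..b} then C\<^sup>2 else 0) integrable_on {0<..}"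
      unfolding integrable_restrict_Int by (simp add: integrable_const_ivl)
    show "(\<lambda>x. (norm (if x \<in> {a..b} then g x else 0))\<^sup>2) \<in> borel_measurable half_line"
      using meas unfolding eq by measurable
    show "norm ((norm (if x \<in> {a..b} then g x else 0))\<^sup>2) \<le> (if x \<in> {a..b} then C\<^sup>2 else 0)" for x
      using C[of x] by (auto intro!: power_mono)
  qed simp
  then show ?thesis
    using meas unfolding eq by (simp add: square_integrable_def half_line_absolutely_integrable)
qed

lemma square_integrable_imp_integrable_on:
  assumes "square_integrable g" "0 < a"
  shows "g integrable_on {a..b}" "(\<lambda>x. (norm (g x))\<^sup>2) integrable_on {a..b}"
proof -
  show "(\<lambda>x. (norm (g x))\<^sup>2) integrable_on {a..b}"
    using assms by (intro half_line_integrable_on square_integrable_integrable) auto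
  have "square_integrable (\<lambda>x. if x \<in> {a..b} then 1 else 0)"
    using assms(2) by (intro square_integrable_continuous_localized) auto
  from half_line_integrable_on[OF integrable_mult_cnj[OF assms(1) this], of a b]
  have "(\<lambda>x. g x * cnj (if x \<in> {a..b} then 1 else 0)) integrable_on {a..b}"
    using assms(2) by simp
  then show "g integrable_on {a..b}"
    by (rule integrable_eq) auto
qed

lemma half_line_integral_localized:
  fixes h :: "real \<Rightarrow> complex"
  assumes "integrable half_line h" "0 < a" "\<And>x. 0 < x \<Longrightarrow> x \<notin> {a..b} \<Longrightarrow> h x = 0"
  shows "integral\<^sup>L half_line h = integral {a..b} h"
proof -
  have "integral\<^sup>L half_line h = integral {0<..} (\<lambda>x. if x \<in> {a..b} then h x else 0)"
    unfolding half_line_integral_eq[OF assms(1)] using assms(3) by (intro integral_cong) auto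
  also have "\<dots> = integral {a..b} h"
  proof -
    have "{a..b} \<inter> {0<..} = {a..b}"
      using assms(2) by auto
    then show ?thesis
      by (simp only: integral_restrict_Int)
  qed
  finally show ?thesis .
qed

lemma locally_integrable_primitive:
  fixes k :: "real \<Rightarrow> complex"
  assumes k: "\<And>s t. 0 < s \<Longrightarrow> k integrable_on {s..t}"
  obtains F where "\<And>s t. 0 < s \<Longrightarrow> s \<le> t \<Longrightarrow> (k has_integral F t - F s) {s..t}"
    "AE x in half_line. (F has_vector_derivative k x) (at x)"
proof -
  \<comment> \<open>the oriented integral from 1 to x; one of the two intervals is empty or a point\<close>
  define F where "F x = integral {1..x} k - integral {x..1} k" for x
  have F: "integral {s..t} k = F t - F s" if st: "0 < s" "s \<le> t" for s t
  proof -
    note combine = Henstock_Kurzweil_Integration.integral_combine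
    consider "t \<le> 1" | "1 \<le> s" | "s \<le> 1" "1 \<le> t"
      by linarith
    then show ?thesis
    proof cases
      case 1
      have "integral {1..t} k = 0" "integral {1..s} k = 0"
        using 1 st by (cases "t = 1"; cases "s = 1"; simp)+
      moreover have "integral {s..t} k + integral {t..1} k = integral {s..1} k"
        using 1 st by (intro combine k) auto
      ultimately show ?thesis
        by (simp add: F_def algebra_simps)
    next
      case 2
      have "integral {t..1} k = 0" "integral {s..1} k = 0"
        using 2 st by (cases "t = 1"; cases "s = 1"; simp)+
      moreover have "integral {1..s} k + integral {s..t} k = integral {1..t} k"
        using 2 st by (intro combine k) auto
      ultimately show ?thesis
        by (simp add: F_def algebra_simps)
    next
      case 3
      have "integral {t..1} k = 0" "integral {1..s} k = 0"
        using 3 st by (cases "t = 1"; cases "s = 1"; simp)+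
      moreover have "integral {s..1} k + integral {1..t} k = integral {s..t} k"
        using 3 st by (intro combine k) auto
      ultimately show ?thesis
        by (simp add: F_def add.commute)
    qed
  qed
  define a b where "a n = inverse (real (Suc n))" and "b n = real (Suc n)" for n
  define N where "N n = {x \<in> {a n<..<b n}. \<not> ((\<lambda>u. integral {a n..u} k) has_vector_derivative k x) (at x)}" for n
  have a: "0 < a n" for n
    by (simp add: a_def)
  have "negligible (N n)" for n
    unfolding N_def by (rule integral_has_vector_derivative_AE[OF k[OF a]])
  then have "negligible (\<Union>n. N n)"
    by (intro negligible_countable_Union) auto
  moreover have "(F has_vector_derivative k x) (at x)" if x: "0 < x" "x \<notin> (\<Union>n. N n)" for x
  proof -
    obtain n where n: "a n < x" "x < b n"
    proof -
      obtain n1 where n1: "inverse (real (Suc n1)) < x"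
        using reals_Archimedean[OF x(1)] by blast
      obtain n2 where n2: "x < real n2"
        using reals_Archimedean2 by blast
      have "a (max n1 n2) \<le> inverse (real (Suc n1))"
        unfolding a_def by (intro le_imp_inverse_le) auto
      moreover have "real n2 \<le> b (max n1 n2)"
        by (simp add: b_def)
      ultimately show thesis
        using n1 n2 by (intro that[of "max n1 n2"]) auto
    qed
    then have "((\<lambda>u. integral {a n..u} k) has_vector_derivative k x) (at x)"
      using x(2) by (auto simp: N_def)
    then have "((\<lambda>u. F (a n) + integral {a n..u} k) has_vector_derivative k x) (at x)"
      by (auto intro!: derivative_eq_intros)
    then show ?thesis
      by (rule has_vector_derivative_transform_within_open[where S = "{a n<..}"])
        (use n F[OF a[of n]] in auto)
  qed
  ultimately have AE: "AE x in half_line. (F has_vector_derivative k x) (at x)"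
    by (intro AE_half_lineI[of "\<Union>n. N n"]) auto
  have "(k has_integral F t - F s) {s..t}" if "0 < s" "s \<le> t" for s t
    using integrable_integral[OF k[OF that(1)], of t] F[OF that] by simp
  then show thesis
    using AE that by blast
qed

lemma continuous_primitive:
  fixes k :: "real \<Rightarrow> complex"
  assumes k: "continuous_on {0<..} k"
  obtains F where "\<And>x. 0 < x \<Longrightarrow> (F has_vector_derivative k x) (at x)"
proof -
  have ki: "k integrable_on {s..t}" if "0 < s" for s t
    using that by (intro integrable_continuous_real continuous_on_subset[OF k]) auto
  then obtain F where F: "\<And>s t. 0 < s \<Longrightarrow> s \<le> t \<Longrightarrow> (k has_integral F t - F s) {s..t}"
    using locally_integrable_primitive by metis
  have "(F has_vector_derivative k x) (at x)" if x: "0 < x" for x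
  proof -
    have "continuous_on {x/2..2*x} k"
      using x by (intro continuous_on_subset[OF k]) auto
    then have "((\<lambda>u. integral {x/2..u} k) has_vector_derivative k x) (at x within {x/2..2*x})"
      using x by (intro integral_has_vector_derivative) auto
    moreover have "at x within {x/2..2*x} = at x"
      using x by (intro at_within_interior) auto
    ultimately have "((\<lambda>u. F (x/2) + integral {x/2..u} k) has_vector_derivative k x) (at x)"
      by (auto intro!: derivative_eq_intros)
    then show ?thesis
      by (rule has_vector_derivative_transform_within_open[where S = "{x/2<..}"])
        (use x F[of "x/2", THEN integral_unique] in auto)
  qed
  then show thesis
    by (rule that)
qed

text \<open>The second primitive of a function in \<open>L\<^sup>2(a, b)\<close> that is orthogonal to all affine functions
  has support in \<open>[a, b]\<close>.\<close>

lemma double_primitive_compact_support: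
  assumes ab: "0 < a" "a \<le> b"
    and \<psi>: "square_integrable \<psi>" "\<And>x. 0 < x \<Longrightarrow> x \<notin> {a..b} \<Longrightarrow> \<psi> x = 0"
    and mom0: "(\<psi> has_integral 0) {a..b}" and mom1: "((\<lambda>x. of_real (x - c) * \<psi> x) has_integral 0) {a..b}"
  obtains \<phi> \<phi>1 where "bessel_ode \<nu> \<phi> \<phi>1 \<psi> (\<lambda>x. - \<psi> x + of_real ((\<nu>\<^sup>2 - 1/4) / x\<^sup>2) * \<phi> x)"
    "\<And>x. 0 < x \<Longrightarrow> x \<notin> {a<..<b} \<Longrightarrow> \<phi> x = 0" "\<And>x. 0 < x \<Longrightarrow> x \<notin> {a<..<b} \<Longrightarrow> \<phi>1 x = 0"
proof -
  obtain \<Phi> where \<Phi>: "\<And>s t. 0 < s \<Longrightarrow> s \<le> t \<Longrightarrow> (\<psi> has_integral \<Phi> t - \<Phi> s) {s..t}"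
      and \<Phi>': "AE x in half_line. (\<Phi> has_vector_derivative \<psi> x) (at x)"
    using locally_integrable_primitive[OF square_integrable_imp_integrable_on(1)[OF \<psi>(1)]] by blast
  define \<phi>1 where "\<phi>1 x = \<Phi> x - \<Phi> a" for x
  have \<phi>1_int: "(\<psi> has_integral \<phi>1 t - \<phi>1 s) {s..t}" if "0 < s" "s \<le> t" for s t
    using \<Phi>[OF that] by (simp add: \<phi>1_def)
  have ac: "locally_absolutely_continuous \<phi>1"
    by (rule locally_absolutely_continuousI_integral[OF \<phi>1_int]) (auto intro: square_integrable_imp_integrable_on \<psi>)
  have \<phi>1': "AE x in half_line. (\<phi>1 has_vector_derivative \<psi> x) (at x)"
    using \<Phi>' unfolding \<phi>1_def by eventually_elim (auto intro!: derivative_eq_intros)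
  have zero: "\<phi>1 t - \<phi>1 s = 0" if "0 < s" "s \<le> t" "t \<le> a \<or> b \<le> s" for s t
  proof -
    have "negligible {a, b}"
      by simp
    then have "(\<psi> has_integral 0) {s..t}"
      by (rule has_integral_spike[OF _ _ has_integral_0]) (use that \<psi>(2) in auto)
    then show ?thesis
      using \<phi>1_int[OF that(1,2)] has_integral_unique by blast
  qed
  have \<phi>1_a: "\<phi>1 a = 0"
    by (simp add: \<phi>1_def)
  have \<phi>1_b: "\<phi>1 b = 0"
    using has_integral_unique[OF \<phi>1_int[OF ab] mom0] \<phi>1_a by simp
  have \<phi>1_0: "\<phi>1 x = 0" if "0 < x" "x \<notin> {a<..<b}" for x
  proof (cases "x \<le> a")
    case True
    then show ?thesis
      using zero[of x a] that \<phi>1_a by simp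
  next
    case False
    then show ?thesis
      using zero[of b x] that \<phi>1_b ab by simp
  qed
  obtain \<Psi> where \<Psi>: "\<And>x. 0 < x \<Longrightarrow> (\<Psi> has_vector_derivative \<phi>1 x) (at x)"
    using continuous_primitive[OF locally_absolutely_continuous_imp_continuous_on[OF ac]] by blast
  define \<phi> where "\<phi> x = \<Psi> x - \<Psi> a" for x
  have \<phi>': "(\<phi> has_vector_derivative \<phi>1 x) (at x)" if "0 < x" for x
    using \<Psi>[OF that] unfolding \<phi>_def by (auto intro!: derivative_eq_intros)
  have \<phi>_int: "(\<phi>1 has_integral \<phi> t - \<phi> s) {s..t}" if "0 < s" "s \<le> t" for s t
    using that by (intro fundamental_theorem_of_calculus has_vector_derivative_at_within[OF \<phi>']) auto
  have \<phi>_b: "\<phi> b = 0"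
  proof -
    have id': "((\<lambda>x. complex_of_real (x - c)) has_vector_derivative 1) (at x)" for x
      by (auto intro!: derivative_eq_intros)
    have "((\<lambda>x. of_real (x - c) * \<psi> x + 1 * \<phi>1 x) has_integral of_real (b - c) * \<phi>1 b - of_real (a - c) * \<phi>1 a) {a..b}"
    proof (rule locally_absolutely_continuous_FTC[OF _ ab])
      show "locally_absolutely_continuous (\<lambda>x. complex_of_real (x - c) * \<phi>1 x)"
        by (intro locally_absolutely_continuous_mult ac locally_absolutely_continuous_C1[OF id']) auto
      show "AE x in half_line. ((\<lambda>x. of_real (x - c) * \<phi>1 x) has_vector_derivative of_real (x - c) * \<psi> x + 1 * \<phi>1 x) (at x)"
        using \<phi>1' by eventually_elim (intro has_vector_derivative_mult id')
    qed
    from has_integral_diff[OF this mom1] have "(\<phi>1 has_integral 0) {a..b}"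
      by (simp add: \<phi>1_a \<phi>1_b)
    then show ?thesis
      using has_integral_unique[OF \<phi>_int[OF ab]] by (simp add: \<phi>_def)
  qed
  have \<phi>_const: "\<phi> t - \<phi> s = 0" if "0 < s" "s \<le> t" "t \<le> a \<or> b \<le> s" for s t
  proof -
    have "(\<phi>1 has_integral 0) {s..t}"
      by (rule has_integral_spike[OF negligible_empty _ has_integral_0]) (use that in \<open>auto intro!: \<phi>1_0\<close>)
    then show ?thesis
      using \<phi>_int[OF that(1,2)] has_integral_unique by blast
  qed
  have \<phi>_0: "\<phi> x = 0" if "0 < x" "x \<notin> {a<..<b}" for x
  proof (cases "x \<le> a")
    case True
    then show ?thesis
      using \<phi>_const[of x a] that by (simp add: \<phi>_def)
  next
    case False
    then show ?thesis
      using \<phi>_const[of b x] that \<phi>_b ab by simp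
  qed
  have "bessel_ode \<nu> \<phi> \<phi>1 \<psi> (\<lambda>x. - \<psi> x + of_real ((\<nu>\<^sup>2 - 1/4) / x\<^sup>2) * \<phi> x)"
    using \<phi>' ac \<phi>1' by (auto simp: bessel_ode_def)
  then show thesis
    using that \<phi>_0 \<phi>1_0 by blast
qed

text \<open>Let \<open>v = A\<^sup>* u\<close> and let \<open>F'' = q u - v\<close> with \<open>q\<close> the potential of \<open>\<tau>\<^sub>\<nu>\<close>. Two integrations by parts
  show that \<open>u - F\<close> is orthogonal to \<open>\<phi>''\<close> for all \<open>\<phi>\<close> with support in \<open>[a, b]\<close>. Taking for \<open>\<phi>''\<close> the
  component \<open>\<psi>\<close> of \<open>u - F\<close> orthogonal to the affine functions gives \<open>\<psi> = 0\<close>.\<close>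

lemma adjoint_affine_on_interval:
  assumes adj: "(abs_l2 g, abs_l2 h) \<in> adjoint_op (bessel_compact_support \<nu>)"
    and g: "square_integrable g" and h: "square_integrable h"
    and F1: "locally_absolutely_continuous F1"
      "AE x in half_line. (F1 has_vector_derivative of_real ((\<nu>\<^sup>2 - 1/4) / x\<^sup>2) * g x - h x) (at x)"
    and F: "\<And>x. 0 < x \<Longrightarrow> (F has_vector_derivative F1 x) (at x)" and ab: "0 < a" "a < b"
  obtains \<alpha> \<beta> where "AE x in half_line. x \<in> {a..b} \<longrightarrow> g x = F x + \<alpha> + \<beta> * of_real x"
proof -
  define q where "q x = complex_of_real ((\<nu>\<^sup>2 - 1/4) / x\<^sup>2)" for x
  define c where "c = (a + b) / 2"
  define G where "G x = (if x \<in> {a..b} then g x - F x else 0)" for x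
  have F1_cont: "continuous_on {0<..} F1"
    by (rule locally_absolutely_continuous_imp_continuous_on[OF F1(1)])
  have F_ac: "locally_absolutely_continuous F"
    by (rule locally_absolutely_continuous_C1[OF F F1_cont])
  have F_cont: "continuous_on {0<..} F"
    by (rule locally_absolutely_continuous_imp_continuous_on[OF F_ac])
  have G: "square_integrable G"
    using square_integrable_diff[OF square_integrable_localize[OF g ab(1), of b]
        square_integrable_continuous_localized[OF F_cont ab(1), of b]]
    unfolding G_def by (rule arg_cong[where f = square_integrable, THEN iffD1, rotated]) auto
  have lin: "square_integrable (\<lambda>x. if x \<in> {a..b} then of_real (x - c) else 0)"
    by (intro square_integrable_continuous_localized ab continuous_intros)
  have G_int: "G integrable_on {a..b}"
    by (rule square_integrable_imp_integrable_on(1)[OF G ab(1)])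
  have cG_int: "(\<lambda>x. of_real (x - c) * G x) integrable_on {a..b}"
  proof (rule integrable_eq)
    show "(\<lambda>x. G x * cnj (if x \<in> {a..b} then of_real (x - c) else 0)) integrable_on {a..b}"
      using ab by (intro half_line_integrable_on integrable_mult_cnj G lin) simp
  qed auto
  define k2 where "k2 = ((b - c) ^ 3 - (a - c) ^ 3) / 3"
  have "0 < k2"
  proof -
    have "b - c = (b - a) / 2" "a - c = - ((b - a) / 2)"
      by (simp_all add: c_def field_simps)
    then have "k2 = 2 * ((b - a) / 2) ^ 3 / 3"
      unfolding k2_def by (simp only:) simp
    moreover have "0 < ((b - a) / 2) ^ 3"
      using ab by (intro zero_less_power) simp
    ultimately show ?thesis
      by linarith
  qed
  have mom1: "((\<lambda>x. complex_of_real (x - c)) has_integral 0) {a..b}"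
  proof -
    have "((\<lambda>x. x - c) has_integral ((b - c)\<^sup>2 / 2 - (a - c)\<^sup>2 / 2)) {a..b}"
      using ab by (intro fundamental_theorem_of_calculus)
        (auto intro!: derivative_eq_intros simp: has_real_derivative_iff_has_vector_derivative[symmetric])
    moreover have "(b - c)\<^sup>2 = (a - c)\<^sup>2"
      by (simp add: c_def power2_eq_square field_simps)
    ultimately have "((\<lambda>x. x - c) has_integral 0) {a..b}"
      by simp
    from has_integral_of_real[OF this] show ?thesis
      by simp
  qed
  have mom2: "((\<lambda>x. complex_of_real (x - c) * of_real (x - c)) has_integral of_real k2) {a..b}"
  proof -
    have "((\<lambda>x. (x - c)\<^sup>2) has_integral ((b - c) ^ 3 / 3 - (a - c) ^ 3 / 3)) {a..b}"
      using ab by (intro fundamental_theorem_of_calculus)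
        (auto intro!: derivative_eq_intros simp: has_real_derivative_iff_has_vector_derivative[symmetric])
    then have "((\<lambda>x. (x - c)\<^sup>2) has_integral k2) {a..b}"
      by (simp add: k2_def diff_divide_distrib)
    from has_integral_of_real[OF this] show ?thesis
      by (simp add: power2_eq_square)
  qed
  \<comment> \<open>the affine part of G: its coefficients with respect to 1 and x - c, which are orthogonal on [a, b]\<close>
  define \<alpha> where "\<alpha> = integral {a..b} G / of_real (b - a)"
  define \<beta> where "\<beta> = integral {a..b} (\<lambda>x. of_real (x - c) * G x) / of_real k2"
  define \<psi> where "\<psi> x = (if x \<in> {a..b} then G x - (\<alpha> + \<beta> * of_real (x - c)) else 0)" for x
  have aff: "square_integrable (\<lambda>x. if x \<in> {a..b} then \<alpha> + \<beta> * of_real (x - c) else 0)"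
    by (intro square_integrable_continuous_localized ab continuous_intros)
  have \<psi>: "square_integrable \<psi>"
    using square_integrable_diff[OF G aff]
    unfolding \<psi>_def by (rule arg_cong[where f = square_integrable, THEN iffD1, rotated]) (auto simp: G_def)
  have \<psi>_mom0: "(\<psi> has_integral 0) {a..b}"
  proof -
    have "((\<lambda>x. G x - (\<alpha> + \<beta> * of_real (x - c))) has_integral
        (integral {a..b} G - ((b - a) *\<^sub>R \<alpha> + \<beta> * 0))) {a..b}"
      using ab has_integral_const_real[of \<alpha> a b]
      by (intro has_integral_diff has_integral_add has_integral_mult_right integrable_integral G_int mom1) simp
    moreover have "integral {a..b} G - ((b - a) *\<^sub>R \<alpha> + \<beta> * 0) = 0"
      using ab by (simp add: \<alpha>_def scaleR_conv_of_real flip: of_real_diff)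
    ultimately have "((\<lambda>x. G x - (\<alpha> + \<beta> * of_real (x - c))) has_integral 0) {a..b}"
      by (simp only:)
    then show ?thesis
      by (rule has_integral_eq[rotated]) (simp add: \<psi>_def)
  qed
  have \<psi>_mom1: "((\<lambda>x. of_real (x - c) * \<psi> x) has_integral 0) {a..b}"
  proof -
    have "((\<lambda>x. of_real (x - c) * G x - (\<alpha> * of_real (x - c) + \<beta> * (of_real (x - c) * of_real (x - c)))) has_integral
        (integral {a..b} (\<lambda>x. of_real (x - c) * G x) - (\<alpha> * 0 + \<beta> * of_real k2))) {a..b}"
      by (intro has_integral_diff has_integral_add has_integral_mult_right integrable_integral cG_int mom1 mom2)
    moreover have "integral {a..b} (\<lambda>x. of_real (x - c) * G x) - (\<alpha> * 0 + \<beta> * of_real k2) = 0"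
      using \<open>0 < k2\<close> by (simp add: \<beta>_def)
    ultimately have "((\<lambda>x. of_real (x - c) * G x - (\<alpha> * of_real (x - c) + \<beta> * (of_real (x - c) * of_real (x - c)))) has_integral 0) {a..b}"
      by (simp only:)
    then show ?thesis
      by (rule has_integral_eq[rotated]) (simp add: \<psi>_def algebra_simps)
  qed
  have \<psi>_0: "\<psi> x = 0" if "0 < x" "x \<notin> {a..b}" for x
    using that by (auto simp: \<psi>_def)
  have "\<exists>\<phi> \<phi>1. bessel_ode \<nu> \<phi> \<phi>1 \<psi> (\<lambda>x. - \<psi> x + q x * \<phi> x) \<and>
      (\<forall>x>0. x \<notin> {a<..<b} \<longrightarrow> \<phi> x = 0) \<and> (\<forall>x>0. x \<notin> {a<..<b} \<longrightarrow> \<phi>1 x = 0)"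
  proof (rule double_primitive_compact_support[OF ab(1) less_imp_le[OF ab(2)] \<psi> \<psi>_0 \<psi>_mom0 \<psi>_mom1,
          of \<nu>, folded q_def])
    fix \<phi> \<phi>1
    assume *: "bessel_ode \<nu> \<phi> \<phi>1 \<psi> (\<lambda>x. - \<psi> x + q x * \<phi> x)"
      "\<And>x. 0 < x \<Longrightarrow> x \<notin> {a<..<b} \<Longrightarrow> \<phi> x = 0" "\<And>x. 0 < x \<Longrightarrow> x \<notin> {a<..<b} \<Longrightarrow> \<phi>1 x = 0"
    show ?thesis
      by (intro exI[of _ \<phi>] exI[of _ \<phi>1] conjI allI impI *)
  qed
  then obtain \<phi> \<phi>1 where ode: "bessel_ode \<nu> \<phi> \<phi>1 \<psi> (\<lambda>x. - \<psi> x + q x * \<phi> x)"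
      and \<phi>0: "\<And>x. 0 < x \<Longrightarrow> x \<notin> {a<..<b} \<Longrightarrow> \<phi> x = 0" and \<phi>10: "\<And>x. 0 < x \<Longrightarrow> x \<notin> {a<..<b} \<Longrightarrow> \<phi>1 x = 0"
    by (elim exE conjE) blast
  have \<phi>0': "\<phi> x = 0" if "0 < x" "x \<notin> {a..b}" for x
    using that by (intro \<phi>0) auto
  note O = bessel_odeD[OF ode]
  have q_cont: "continuous_on {0<..} q"
    unfolding q_def by (intro continuous_intros) auto
  have loc: "square_integrable u" if "continuous_on {0<..} u" "\<And>x. 0 < x \<Longrightarrow> x \<notin> {a..b} \<Longrightarrow> u x = 0" for u
  proof (rule square_integrable_cong_AE[OF square_integrable_continuous_localized[OF that(1) ab(1), of b]])
    show "u \<in> borel_measurable half_line"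
      by (rule continuous_on_measurable_half_line[OF that(1)])
    show "AE x in half_line. (if x \<in> {a..b} then u x else 0) = u x"
      by (rule AE_I2) (use that(2) in auto)
  qed
  have \<phi>_sq: "square_integrable \<phi>"
    by (rule loc[OF O(5)]) (auto intro!: \<phi>0)
  have q\<phi>_sq: "square_integrable (\<lambda>x. q x * \<phi> x)"
    by (rule loc) (auto intro!: continuous_intros q_cont O(5) simp: \<phi>0)
  have \<psi>q_sq: "square_integrable (\<lambda>x. - \<psi> x + q x * \<phi> x)"
    using square_integrable_diff[OF q\<phi>_sq \<psi>] by simp
  have "(abs_l2 \<phi>, abs_l2 (\<lambda>x. - \<psi> x + q x * \<phi> x)) \<in> bessel_compact_support \<nu>"
    unfolding bessel_compact_support_def bessel_pair_iff
  proof (intro CollectI exI conjI)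
    show "compact {a..b}" "{a..b} \<subseteq> {0<..}"
      using ab by auto
    show "\<forall>x>0. x \<notin> {a..b} \<longrightarrow> \<phi> x = 0"
      using \<phi>0 by auto
    show "bessel_ode \<nu> \<phi> \<phi>1 \<psi> (\<lambda>x. - \<psi> x + q x * \<phi> x)"
      by (rule ode)
  qed (use \<phi>_sq \<psi>q_sq in auto)
  from adjoint_op_eqD[OF adj this, unfolded cinner_abs_l2[OF \<psi>q_sq g] cinner_abs_l2[OF \<phi>_sq h]]
  have "(\<integral>x. (- \<psi> x + q x * \<phi> x) * cnj (g x) \<partial>half_line) - (\<integral>x. \<phi> x * cnj (h x) \<partial>half_line) = 0"
    by (simp only: right_minus_eq)
  then have "(\<integral>x. (- \<psi> x + q x * \<phi> x) * cnj (g x) - \<phi> x * cnj (h x) \<partial>half_line) = 0"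
    by (simp only: Bochner_Integration.integral_diff[OF integrable_mult_cnj[OF \<psi>q_sq g] integrable_mult_cnj[OF \<phi>_sq h]])
  moreover have int: "integrable half_line (\<lambda>x. (- \<psi> x + q x * \<phi> x) * cnj (g x) - \<phi> x * cnj (h x))"
    by (intro Bochner_Integration.integrable_diff integrable_mult_cnj \<psi>q_sq g \<phi>_sq h)
  moreover have "(\<integral>x. (- \<psi> x + q x * \<phi> x) * cnj (g x) - \<phi> x * cnj (h x) \<partial>half_line)
      = integral {a..b} (\<lambda>x. (- \<psi> x + q x * \<phi> x) * cnj (g x) - \<phi> x * cnj (h x))"
    by (rule half_line_integral_localized[OF int ab(1)]) (simp del: atLeastAtMost_iff add: \<phi>0' \<psi>_0)
  ultimately have "integral {a..b} (\<lambda>x. (- \<psi> x + q x * \<phi> x) * cnj (g x) - \<phi> x * cnj (h x)) = 0"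
    by (simp only:)
  then have I1: "((\<lambda>x. (- \<psi> x + q x * \<phi> x) * cnj (g x) - \<phi> x * cnj (h x)) has_integral 0) {a..b}"
    using integrable_integral[OF half_line_integrable_on[OF int less_imp_le[OF ab(1)], of b]] by (simp only:)
  have "((\<lambda>x. \<phi> x * cnj (q x * g x - h x) + \<phi>1 x * cnj (F1 x) - (\<phi>1 x * cnj (F1 x) + \<psi> x * cnj (F x)))
      has_integral (\<phi> b * cnj (F1 b) - \<phi>1 b * cnj (F b)) - (\<phi> a * cnj (F1 a) - \<phi>1 a * cnj (F a))) {a..b}"
  proof (rule locally_absolutely_continuous_FTC)
    show "locally_absolutely_continuous (\<lambda>x. \<phi> x * cnj (F1 x) - \<phi>1 x * cnj (F x))"
      by (intro locally_absolutely_continuous_diff locally_absolutely_continuous_mult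
          locally_absolutely_continuous_cnj O(2,4) F1(1) F_ac)
    show "AE x in half_line. ((\<lambda>x. \<phi> x * cnj (F1 x) - \<phi>1 x * cnj (F x)) has_vector_derivative
        \<phi> x * cnj (q x * g x - h x) + \<phi>1 x * cnj (F1 x) - (\<phi>1 x * cnj (F1 x) + \<psi> x * cnj (F x))) (at x)"
      using O(6) F1(2) AE_space
    proof eventually_elim
      case (elim x)
      then have x: "0 < x"
        by simp
      show ?case
        by (intro has_vector_derivative_diff has_vector_derivative_mult has_vector_derivative_cnj'
            O(1)[OF x] F[OF x] elim(1) elim(2)[folded q_def])
    qed
  qed (use ab in auto)
  moreover have "\<phi> a = 0" "\<phi> b = 0" "\<phi>1 a = 0" "\<phi>1 b = 0"
    using ab by (auto intro!: \<phi>0 \<phi>10)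
  ultimately have I2: "((\<lambda>x. \<phi> x * cnj (q x * g x - h x) - \<psi> x * cnj (F x)) has_integral 0) {a..b}"
    by (simp add: algebra_simps)
  have I3: "((\<lambda>x. cnj \<alpha> * \<psi> x + cnj \<beta> * (of_real (x - c) * \<psi> x)) has_integral cnj \<alpha> * 0 + cnj \<beta> * 0) {a..b}"
    by (intro has_integral_add has_integral_mult_right \<psi>_mom0 \<psi>_mom1)
  have "((\<lambda>x. \<psi> x * cnj (\<psi> x)) has_integral ((0 - 0) - (cnj \<alpha> * 0 + cnj \<beta> * 0))) {a..b}"
  proof (rule has_integral_eq[OF _ has_integral_diff[OF has_integral_diff[OF I2 I1] I3]])
    fix x
    assume "x \<in> {a..b}"
    moreover have "cnj (q x) = q x"
      by (simp add: q_def)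
    ultimately show "\<phi> x * cnj (q x * g x - h x) - \<psi> x * cnj (F x)
        - ((- \<psi> x + q x * \<phi> x) * cnj (g x) - \<phi> x * cnj (h x))
        - (cnj \<alpha> * \<psi> x + cnj \<beta> * (of_real (x - c) * \<psi> x)) = \<psi> x * cnj (\<psi> x)"
      by (simp add: \<psi>_def G_def algebra_simps)
  qed
  then have "integral {a..b} (\<lambda>x. \<psi> x * cnj (\<psi> x)) = 0"
    by (simp add: integral_unique)
  then have "cinner (abs_l2 \<psi>) (abs_l2 \<psi>) = 0"
    unfolding cinner_abs_l2[OF \<psi> \<psi>]
    by (subst half_line_integral_localized[OF integrable_mult_cnj[OF \<psi> \<psi>] ab(1), of b]) (auto simp: \<psi>_def)
  then have "abs_l2 \<psi> = abs_l2 (\<lambda>x. 0)"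
    by (simp add: cinner_self zero_l2.abs_eq)
  then have "AE x in half_line. \<psi> x = 0"
    using abs_l2_eq_iff[OF \<psi> square_integrable_0] by simp
  then have "AE x in half_line. x \<in> {a..b} \<longrightarrow> g x = F x + (\<alpha> - \<beta> * of_real c) + \<beta> * of_real x"
    by eventually_elim (auto simp: \<psi>_def G_def algebra_simps)
  then show thesis
    by (rule that)
qed

theorem adjoint_bessel_minimal: "adjoint_op (bessel_minimal \<nu>) = bessel_maximal \<nu>"
proof (rule antisym)
  show "bessel_maximal \<nu> \<subseteq> adjoint_op (bessel_minimal \<nu>)"
    using bessel_maximal_subset_adjoint by (simp add: bessel_minimal_eq adjoint_op_closure)
  show "adjoint_op (bessel_minimal \<nu>) \<subseteq> bessel_maximal \<nu>"
  proof (rule subrelI)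
    fix u v
    assume uv: "(u, v) \<in> adjoint_op (bessel_minimal \<nu>)"
    obtain g h where g: "square_integrable g" "u = abs_l2 g" and h: "square_integrable h" "v = abs_l2 h"
      by (metis l2_cases)
    have adj: "(abs_l2 g, abs_l2 h) \<in> adjoint_op (bessel_compact_support \<nu>)"
      using uv by (simp add: bessel_minimal_eq adjoint_op_closure g h)
    define q where "q x = complex_of_real ((\<nu>\<^sup>2 - 1/4) / x\<^sup>2)" for x
    let ?k = "\<lambda>x. q x * g x - h x"
    have k: "?k integrable_on {s..t}" "(\<lambda>x. (norm (?k x))\<^sup>2) integrable_on {s..t}" if "0 < s" for s t
    proof -
      let ?i = "\<lambda>x. if x \<in> {s..t} then q x else 0"
      have q_cont: "continuous_on {0<..} q"
        unfolding q_def by (intro continuous_intros) auto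
      have "bounded (q ` {s..t})"
        using that by (intro compact_imp_bounded compact_continuous_image continuous_on_subset[OF q_cont]) auto
      then obtain C where C: "\<forall>y\<in>q ` {s..t}. norm y \<le> C"
        unfolding bounded_iff by blast
      have "square_integrable (\<lambda>x. ?i x * g x)"
      proof (rule square_integrable_bounded_mult[OF g(1)])
        show "?i \<in> borel_measurable half_line"
          using square_integrable_continuous_localized[OF q_cont that, of t] by (simp add: square_integrable_def)
        show "norm (?i x) \<le> \<bar>C\<bar>" if "0 < x" for x
          using C by (auto intro: order_trans[OF _ abs_ge_self])
      qed
      then have "square_integrable (\<lambda>x. ?i x * g x - h x)"
        by (intro square_integrable_diff h)
      note * = square_integrable_imp_integrable_on[OF this that, of t]
      show "?k integrable_on {s..t}"
        using *(1) by (rule integrable_eq) auto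
      show "(\<lambda>x. (norm (?k x))\<^sup>2) integrable_on {s..t}"
        using *(2) by (rule integrable_eq) auto
    qed
    obtain F1 where F1: "\<And>s t. 0 < s \<Longrightarrow> s \<le> t \<Longrightarrow> (?k has_integral F1 t - F1 s) {s..t}"
        and F1': "AE x in half_line. (F1 has_vector_derivative ?k x) (at x)"
      using locally_integrable_primitive[OF k(1)] by blast
    have F1_ac: "locally_absolutely_continuous F1"
      using k(2) by (intro locally_absolutely_continuousI_integral[OF F1]) auto
    obtain F where F: "\<And>x. 0 < x \<Longrightarrow> (F has_vector_derivative F1 x) (at x)"
      using continuous_primitive[OF locally_absolutely_continuous_imp_continuous_on[OF F1_ac]] by blast
    have "\<forall>n. \<exists>\<alpha> \<beta>. AE x in half_line. x \<in> {inverse (real (n + 2))..real (n + 2)} \<longrightarrow> g x = F x + \<alpha> + \<beta> * of_real x"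
    proof
      fix n
      have "inverse (real (n + 2)) < 1"
        by (simp add: field_simps)
      then have ab: "0 < inverse (real (n + 2))" "inverse (real (n + 2)) < real (n + 2)"
        by auto
      show "\<exists>\<alpha> \<beta>. AE x in half_line. x \<in> {inverse (real (n + 2))..real (n + 2)} \<longrightarrow> g x = F x + \<alpha> + \<beta> * of_real x"
        by (rule adjoint_affine_on_interval[OF adj g(1) h(1) F1_ac F1'[unfolded q_def] F ab]) (assumption, intro exI)
    qed
    then have "\<exists>\<alpha>. \<forall>n. \<exists>\<beta>. AE x in half_line. x \<in> {inverse (real (n + 2))..real (n + 2)} \<longrightarrow> g x = F x + \<alpha> n + \<beta> * of_real x"
      by (rule choice)
    then obtain \<alpha> where "\<forall>n. \<exists>\<beta>. AE x in half_line. x \<in> {inverse (real (n + 2))..real (n + 2)} \<longrightarrow> g x = F x + \<alpha> n + \<beta> * of_real x"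
      by (elim exE)
    then have "\<exists>\<beta>. \<forall>n. AE x in half_line. x \<in> {inverse (real (n + 2))..real (n + 2)} \<longrightarrow> g x = F x + \<alpha> n + \<beta> n * of_real x"
      by (rule choice)
    then obtain \<beta> where "\<forall>n. AE x in half_line. x \<in> {inverse (real (n + 2))..real (n + 2)} \<longrightarrow> g x = F x + \<alpha> n + \<beta> n * of_real x"
      by (elim exE)
    then have aff: "AE x in half_line. x \<in> {inverse (real (n + 2))..real (n + 2)} \<longrightarrow> g x = F x + \<alpha> n + \<beta> n * of_real x" for n
      by (rule spec)
    have same: "\<alpha> n = \<alpha> 0" "\<beta> n = \<beta> 0" for n
    proof -
      have "AE x in half_line. x \<in> {1..2} \<longrightarrow> \<alpha> n + \<beta> n * of_real x = \<alpha> 0 + \<beta> 0 * of_real x"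
        using aff[of n] aff[of 0]
      proof eventually_elim
        case (elim x)
        show ?case
        proof
          assume x: "x \<in> {1..2}"
          have "inverse (real (n + 2)) \<le> 1"
            by (simp add: field_simps)
          then show "\<alpha> n + \<beta> n * of_real x = \<alpha> 0 + \<beta> 0 * of_real x"
            using elim x by auto
        qed
      qed
      from AE_half_lineD[OF this]
      have N: "negligible {x. 0 < x \<and> \<not> (x \<in> {1..2} \<longrightarrow> \<alpha> n + \<beta> n * of_real x = \<alpha> 0 + \<beta> 0 * of_real x)}" (is "negligible ?N") .
      have point: "\<exists>x\<in>{s<..<t}. \<alpha> n + \<beta> n * of_real x = \<alpha> 0 + \<beta> 0 * of_real x" if "1 \<le> s" "s < t" "t \<le> 2" for s t :: real
      proof (rule ccontr)
        assume "\<not> ?thesis"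
        then have "{s<..<t} \<subseteq> ?N"
          using that by auto
        then have "negligible {s<..<t}"
          using N negligible_subset by blast
        then show False
          using that open_not_negligible[of "{s<..<t}"] by auto
      qed
      obtain x where x: "x < 3/2" "\<alpha> n + \<beta> n * of_real x = \<alpha> 0 + \<beta> 0 * of_real x"
        using point[of 1 "3/2"] by auto
      obtain y where y: "3/2 < y" "\<alpha> n + \<beta> n * of_real y = \<alpha> 0 + \<beta> 0 * of_real y"
        using point[of "3/2" 2] by auto
      have "(p - p') * (t - s) = 0" if "r + p * s = r' + p' * s" "r + p * t = r' + p' * t"
        for p p' r r' s t :: complex
        using that by algebra
      from this[OF x(2) y(2)] show "\<beta> n = \<beta> 0"
        using x(1) y(1) by simp
      then show "\<alpha> n = \<alpha> 0"
        using x(2) by simp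
    qed
    define f where "f x = F x + \<alpha> 0 + \<beta> 0 * of_real x" for x
    have fg: "AE x in half_line. f x = g x"
    proof -
      have "AE x in half_line. x \<in> {inverse (real (n + 2))..real (n + 2)} \<longrightarrow> g x = f x" for n
        using aff[of n] unfolding f_def same(1)[of n] same(2)[of n] .
      then have "AE x in half_line. \<forall>n. x \<in> {inverse (real (n + 2))..real (n + 2)} \<longrightarrow> g x = f x"
        unfolding AE_all_countable by (rule allI)
      then show ?thesis
        using AE_space
      proof eventually_elim
        case (elim x)
        then have x: "0 < x"
          by simp
        obtain n1 where n1: "inverse (real (Suc n1)) < x"
          using reals_Archimedean[OF x] by blast
        obtain n2 where n2: "x < real n2"
          using reals_Archimedean2 by blast
        have "inverse (real (n1 + n2 + 2)) \<le> inverse (real (Suc n1))"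
          by (intro le_imp_inverse_le) auto
        then have "inverse (real (n1 + n2 + 2)) \<le> x"
          using n1 by linarith
        then have "x \<in> {inverse (real (n1 + n2 + 2))..real (n1 + n2 + 2)}"
          using n2 by simp
        then show ?case
          using elim(1) by fastforce
      qed
    qed
    define f1 where "f1 x = F1 x + \<beta> 0" for x
    have f': "(f has_vector_derivative f1 x) (at x)" if "0 < x" for x
      unfolding f_def f1_def using F[OF that] by (auto intro!: derivative_eq_intros)
    have f1_ac: "locally_absolutely_continuous f1"
      unfolding f1_def by (intro locally_absolutely_continuous_add F1_ac locally_absolutely_continuous_const)
    have ode: "bessel_ode \<nu> f f1 (\<lambda>x. q x * f x - h x) h"
      unfolding bessel_ode_def
    proof (intro conjI allI impI f' f1_ac)
      show "AE x in half_line. (f1 has_vector_derivative q x * f x - h x) (at x)"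
        using F1' fg by eventually_elim (auto simp: f1_def[abs_def] intro!: derivative_eq_intros)
      show "h x = - (q x * f x - h x) + complex_of_real ((\<nu>\<^sup>2 - 1/4) / x\<^sup>2) * f x" for x
        by (simp add: q_def)
    qed
    have f_sq: "square_integrable f"
      using fg by (intro square_integrable_cong_AE[OF g(1)] continuous_on_measurable_half_line bessel_odeD(5)[OF ode])
        (auto elim: eventually_mono)
    have "bessel_pair \<nu> f h"
      unfolding bessel_pair_iff using f_sq h(1) ode by blast
    moreover have "(u, v) = (abs_l2 f, abs_l2 h)"
      using fg abs_l2_eq_iff[OF f_sq g(1)] by (simp add: g(2) h(2))
    ultimately show "(u, v) \<in> bessel_maximal \<nu>"
      unfolding bessel_maximal_def by blast
  qed
qed

subsection \<open>Boundary values\<close>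

lemma continuous_AE_eq_imp_eq:
  fixes f g :: "real \<Rightarrow> complex"
  assumes f: "continuous_on {0<..} f" and g: "continuous_on {0<..} g"
    and AE: "AE x in half_line. f x = g x" and x: "0 < x"
  shows "f x = g x"
proof (rule ccontr)
  assume "f x \<noteq> g x"
  let ?S = "{0<..} \<inter> (\<lambda>x. f x - g x) -` (- {0})"
  have "open ?S"
    by (intro continuous_open_preimage continuous_on_diff f g) auto
  moreover have "negligible ?S"
    by (rule negligible_subset[OF AE_half_lineD[OF AE]]) auto
  moreover have "x \<in> ?S"
    using x \<open>f x \<noteq> g x\<close> by simp
  ultimately show False
    using open_not_negligible by blast
qed

lemma continuous_rep_abs_l2:
  assumes "square_integrable f" "continuous_on {0<..} f" "0 < x"
  shows "continuous_rep (abs_l2 f) x = f x"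
proof -
  have "\<exists>h. square_integrable h \<and> abs_l2 h = abs_l2 f \<and> continuous_on {0<..} h"
    using assms by blast
  from someI_ex[OF this]
  have rep: "square_integrable (continuous_rep (abs_l2 f))" "abs_l2 (continuous_rep (abs_l2 f)) = abs_l2 f"
      "continuous_on {0<..} (continuous_rep (abs_l2 f))"
    by (simp_all add: continuous_rep_def)
  show ?thesis
    using rep(2) abs_l2_eq_iff[OF rep(1) assms(1)]
    by (intro continuous_AE_eq_imp_eq[OF rep(3) assms(2) _ assms(3)]) simp
qed

lemma bracket_0_eq:
  assumes ode: "bessel_ode \<nu> f f1 f2 g" and f: "square_integrable f"
    and p: "\<And>x. 0 < x \<Longrightarrow> ((\<lambda>x. complex_of_real (p x)) has_vector_derivative of_real (p1 x)) (at x)"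
    and lim: "(wronskian f f1 (\<lambda>x. of_real (p x)) (\<lambda>x. of_real (p1 x)) \<longlongrightarrow> L) (at_right 0)"
  shows "bracket_0 (abs_l2 f) p = L"
proof -
  note F = bessel_odeD[OF ode]
  have "lagrange_bracket (continuous_rep (abs_l2 f)) (\<lambda>x. of_real (p x)) x
      = wronskian f f1 (\<lambda>x. of_real (p x)) (\<lambda>x. of_real (p1 x)) x" if x: "0 < x" for x
  proof -
    have "(continuous_rep (abs_l2 f) has_vector_derivative f1 x) (at x)"
      by (rule has_vector_derivative_transform_within_open[OF F(1)[OF x], of "{0<..}"])
        (use x in \<open>auto simp: continuous_rep_abs_l2[OF f F(5)]\<close>)
    then show ?thesis
      by (simp add: lagrange_bracket_def wronskian_def vector_derivative_at[OF p[OF x]]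
          vector_derivative_at continuous_rep_abs_l2[OF f F(5) x])
  qed
  then have "\<forall>\<^sub>F x in at_right 0. wronskian f f1 (\<lambda>x. of_real (p x)) (\<lambda>x. of_real (p1 x)) x
      = lagrange_bracket (continuous_rep (abs_l2 f)) (\<lambda>x. of_real (p x)) x"
    by (auto simp: eventually_at_right_field intro!: exI[of _ 1])
  from Lim_transform_eventually[OF lim this] show ?thesis
    unfolding bracket_0_def by (intro tendsto_Lim) auto
qed

text \<open>Only the behaviour at the origin matters for a bracket there, hence the truncation; \<open>p1\<close> is the
  derivative of \<open>p\<close>.\<close>

definition square_integrable_solution :: "real \<Rightarrow> (real \<Rightarrow> real) \<Rightarrow> (real \<Rightarrow> real) \<Rightarrow> bool"
  where "square_integrable_solution \<nu> p p1 \<longleftrightarrow>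
    (\<exists>p2. bessel_ode \<nu> (\<lambda>x. of_real (p x)) (\<lambda>x. of_real (p1 x)) p2 (\<lambda>_. 0)) \<and>
    square_integrable (\<lambda>x. if x \<le> 1 then of_real (p x) else 0)"

lemma wronskian_tendsto_bracket_0:
  assumes ode: "bessel_ode \<nu> f f1 f2 g" and f: "square_integrable f" and g: "square_integrable g"
    and p: "square_integrable_solution \<nu> p p1"
  shows "(wronskian f f1 (\<lambda>x. of_real (p x)) (\<lambda>x. of_real (p1 x)) \<longlongrightarrow> bracket_0 (abs_l2 f) p) (at_right 0)"
proof -
  obtain p2 where p2: "bessel_ode \<nu> (\<lambda>x. of_real (p x)) (\<lambda>x. of_real (p1 x)) p2 (\<lambda>_. 0)"
      and sq: "square_integrable (\<lambda>x. if x \<le> 1 then of_real (p x) else 0)"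
    using p unfolding square_integrable_solution_def by blast
  note lim = wronskian_tendsto_0(2)[OF ode g p2 sq zero_less_one order_refl]
  show ?thesis
    using lim bracket_0_eq[OF ode f bessel_odeD(1)[OF p2] lim] by simp
qed

lemma bessel_ode_add:
  assumes f: "bessel_ode \<nu> f f1 f2 g" and h: "bessel_ode \<nu> h h1 h2 k"
  shows "bessel_ode \<nu> (\<lambda>x. f x + h x) (\<lambda>x. f1 x + h1 x) (\<lambda>x. f2 x + h2 x) (\<lambda>x. g x + k x)"
  unfolding bessel_ode_def
proof (intro conjI allI impI)
  show "AE x in half_line. ((\<lambda>x. f1 x + h1 x) has_vector_derivative f2 x + h2 x) (at x)"
    using bessel_odeD(6)[OF f] bessel_odeD(6)[OF h] by eventually_elim (rule has_vector_derivative_add)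
  show "g x + k x = - (f2 x + h2 x) + of_real ((\<nu>\<^sup>2 - 1/4) / x\<^sup>2) * (f x + h x)" if "0 < x" for x
    unfolding bessel_odeD(7)[OF f that] bessel_odeD(7)[OF h that] distrib_left by simp
qed (intro has_vector_derivative_add locally_absolutely_continuous_add bessel_odeD(1,2)[OF f] bessel_odeD(1,2)[OF h]; assumption)+

lemma bessel_ode_scale:
  assumes f: "bessel_ode \<nu> f f1 f2 g"
  shows "bessel_ode \<nu> (\<lambda>x. c * f x) (\<lambda>x. c * f1 x) (\<lambda>x. c * f2 x) (\<lambda>x. c * g x)"
  unfolding bessel_ode_def
proof (intro conjI allI impI)
  show "AE x in half_line. ((\<lambda>x. c * f1 x) has_vector_derivative c * f2 x) (at x)"
    using bessel_odeD(6)[OF f] by eventually_elim (rule has_vector_derivative_mult_right)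
  show "c * g x = - (c * f2 x) + of_real ((\<nu>\<^sup>2 - 1/4) / x\<^sup>2) * (c * f x)" if "0 < x" for x
    unfolding bessel_odeD(7)[OF f that] by (simp only: distrib_left mult_minus_right mult.left_commute)
  show "((\<lambda>x. c * f x) has_vector_derivative c * f1 x) (at x)" if "0 < x" for x
    by (rule has_vector_derivative_mult_right[OF bessel_odeD(1)[OF f that]])
qed (intro locally_absolutely_continuous_mult locally_absolutely_continuous_const bessel_odeD(2)[OF f])

lemma bessel_maximal_cases:
  assumes "(u, v) \<in> bessel_maximal \<nu>"
  obtains f f1 f2 g where "u = abs_l2 f" "v = abs_l2 g" "square_integrable f" "square_integrable g"
    "bessel_ode \<nu> f f1 f2 g"
  using assms unfolding bessel_maximal_def bessel_pair_iff by blast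

lemma bessel_maximalI:
  assumes "square_integrable f" "square_integrable g" "bessel_ode \<nu> f f1 f2 g"
  shows "(abs_l2 f, abs_l2 g) \<in> bessel_maximal \<nu>"
  using assms unfolding bessel_maximal_def bessel_pair_iff by blast

lemma bracket_0_add:
  assumes u: "(u, v) \<in> bessel_maximal \<nu>" and u': "(u', v') \<in> bessel_maximal \<nu>"
    and p: "square_integrable_solution \<nu> p p1"
  shows "bracket_0 (u + u') p = bracket_0 u p + bracket_0 u' p"
proof -
  obtain f f1 f2 g where f: "u = abs_l2 f" "v = abs_l2 g" "square_integrable f" "square_integrable g"
    "bessel_ode \<nu> f f1 f2 g"
    using bessel_maximal_cases[OF u] .
  obtain h h1 h2 k where h: "u' = abs_l2 h" "v' = abs_l2 k" "square_integrable h" "square_integrable k"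
    "bessel_ode \<nu> h h1 h2 k"
    using bessel_maximal_cases[OF u'] .
  note lims = wronskian_tendsto_bracket_0[OF f(5,3,4) p] wronskian_tendsto_bracket_0[OF h(5,3,4) p]
  obtain p2 where p2: "bessel_ode \<nu> (\<lambda>x. of_real (p x)) (\<lambda>x. of_real (p1 x)) p2 (\<lambda>_. 0)"
    using p unfolding square_integrable_solution_def by blast
  have "(wronskian (\<lambda>x. f x + h x) (\<lambda>x. f1 x + h1 x) (\<lambda>x. of_real (p x)) (\<lambda>x. of_real (p1 x))
      \<longlongrightarrow> bracket_0 u p + bracket_0 u' p) (at_right 0)"
    using tendsto_add[OF lims] by (simp add: wronskian_def[abs_def] f(1) h(1) algebra_simps)
  from bracket_0_eq[OF bessel_ode_add[OF f(5) h(5)] square_integrable_add[OF f(3) h(3)]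
      bessel_odeD(1)[OF p2] this]
  show ?thesis
    by (simp add: f(1) h(1) add_abs_l2 f(3) h(3))
qed

lemma bracket_0_scaleC:
  assumes u: "(u, v) \<in> bessel_maximal \<nu>" and p: "square_integrable_solution \<nu> p p1"
  shows "bracket_0 (scaleC c u) p = c * bracket_0 u p"
proof -
  obtain f f1 f2 g where f: "u = abs_l2 f" "v = abs_l2 g" "square_integrable f" "square_integrable g"
    "bessel_ode \<nu> f f1 f2 g"
    using bessel_maximal_cases[OF u] .
  obtain p2 where p2: "bessel_ode \<nu> (\<lambda>x. of_real (p x)) (\<lambda>x. of_real (p1 x)) p2 (\<lambda>_. 0)"
    using p unfolding square_integrable_solution_def by blast
  have "(wronskian (\<lambda>x. c * f x) (\<lambda>x. c * f1 x) (\<lambda>x. of_real (p x)) (\<lambda>x. of_real (p1 x))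
      \<longlongrightarrow> c * bracket_0 u p) (at_right 0)"
    using tendsto_mult_left[OF wronskian_tendsto_bracket_0[OF f(5,3,4) p], of c]
    by (simp add: wronskian_def[abs_def] f(1) algebra_simps)
  from bracket_0_eq[OF bessel_ode_scale[OF f(5)] square_integrable_scale[OF f(3)]
      bessel_odeD(1)[OF p2] this]
  show ?thesis
    by (simp add: f(1) scaleC_abs_l2 f(3))
qed

text \<open>The Pluecker identity expresses the bracket of two functions by their brackets with a
  fundamental system \<open>p, q\<close>; in the limit this turns Green's identity into that of a boundary
  triplet.\<close>

lemma bessel_maximal_green:
  assumes u: "(u, v) \<in> bessel_maximal \<nu>" and u': "(u', v') \<in> bessel_maximal \<nu>"
    and p: "square_integrable_solution \<nu> p p1" and q: "square_integrable_solution \<nu> q q1"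
    and w: "\<And>x. 0 < x \<Longrightarrow> p x * q1 x - p1 x * q x = w" "w \<noteq> 0"
  shows "cinner v u' - cinner u v'
    = (bracket_0 u q / of_real w) * cnj (bracket_0 u' p) - bracket_0 u p * cnj (bracket_0 u' q / of_real w)"
proof -
  obtain f f1 f2 g where f: "u = abs_l2 f" "v = abs_l2 g" "square_integrable f" "square_integrable g"
    "bessel_ode \<nu> f f1 f2 g"
    using bessel_maximal_cases[OF u] .
  obtain h h1 h2 k where h: "u' = abs_l2 h" "v' = abs_l2 k" "square_integrable h" "square_integrable k"
    "bessel_ode \<nu> h h1 h2 k"
    using bessel_maximal_cases[OF u'] .
  let ?b = "\<lambda>f f1 p p1. wronskian f f1 (\<lambda>x. of_real (p x)) (\<lambda>x. of_real (p1 x))"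
  have lim: "((\<lambda>x. (?b f f1 p p1 x * cnj (?b h h1 q q1 x) - ?b f f1 q q1 x * cnj (?b h h1 p p1 x)) / of_real w)
      \<longlongrightarrow> (bracket_0 u p * cnj (bracket_0 u' q) - bracket_0 u q * cnj (bracket_0 u' p)) / of_real w) (at_right 0)"
    unfolding f(1) h(1)
    by (intro tendsto_divide tendsto_diff tendsto_mult tendsto_cnj tendsto_const
        wronskian_tendsto_bracket_0[OF f(5,3,4)] wronskian_tendsto_bracket_0[OF h(5,3,4)] p q)
      (use w in simp)
  have "(?b f f1 p p1 x * cnj (?b h h1 q q1 x) - ?b f f1 q q1 x * cnj (?b h h1 p p1 x)) / of_real w
      = wronskian f f1 h h1 x" if x: "0 < x" for x
  proof -
    have "complex_of_real (p x) * of_real (q1 x) - of_real (p1 x) * of_real (q x) = of_real w"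
      using w(1)[OF x] by (simp flip: of_real_mult of_real_diff)
    moreover have "(F * P1 - F1 * P) * (H * Q1 - H1 * Q) - (F * Q1 - F1 * Q) * (H * P1 - H1 * P)
        = (F * H1 - F1 * H) * (P * Q1 - P1 * Q)" for F F1 H H1 P P1 Q Q1 :: complex
      by (simp add: algebra_simps)
    ultimately show ?thesis
      using w(2) by (simp add: wronskian_def)
  qed
  then have "\<forall>\<^sub>F x in at_right 0.
      (?b f f1 p p1 x * cnj (?b h h1 q q1 x) - ?b f f1 q q1 x * cnj (?b h h1 p p1 x)) / of_real w
      = wronskian f f1 h h1 x"
    by (auto simp: eventually_at_right_field intro!: exI[of _ 1])
  from bessel_green[OF f(5,3,4) h(5,3,4) Lim_transform_eventually[OF lim this]]
  show ?thesis
    by (simp add: f(1,2) h(1,2) diff_divide_distrib)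
qed

text \<open>Surjectivity needs two functions with linearly independent boundary values.\<close>

lemma bessel_boundary_triplet:
  assumes p: "square_integrable_solution \<nu> p p1" and q: "square_integrable_solution \<nu> q q1"
    and w: "\<And>x. 0 < x \<Longrightarrow> p x * q1 x - p1 x * q x = w" "w \<noteq> 0"
    and e: "(e, e') \<in> bessel_maximal \<nu>" "bracket_0 e p = 0" "bracket_0 e q \<noteq> 0"
    and d: "(d, d') \<in> bessel_maximal \<nu>" "bracket_0 d p \<noteq> 0"
  shows "boundary_triplet (bessel_maximal \<nu>) (\<lambda>u. bracket_0 u p) (\<lambda>u. bracket_0 u q / of_real w)"
  unfolding boundary_triplet_def
proof (intro conjI ballI allI)
  fix \<Gamma> u u' c
  assume \<Gamma>: "\<Gamma> \<in> {\<lambda>u. bracket_0 u p, \<lambda>u. bracket_0 u q / of_real w}"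
    and "u \<in> Domain (bessel_maximal \<nu>)" "u' \<in> Domain (bessel_maximal \<nu>)"
  then obtain v v' where uv: "(u, v) \<in> bessel_maximal \<nu>" "(u', v') \<in> bessel_maximal \<nu>"
    by blast
  show "\<Gamma> (u + u') = \<Gamma> u + \<Gamma> u'"
    using \<Gamma> bracket_0_add[OF uv p] bracket_0_add[OF uv q] by (auto simp: add_divide_distrib)
  show "\<Gamma> (scaleC c u) = c * \<Gamma> u"
    using \<Gamma> bracket_0_scaleC[OF uv(1) p, of c] bracket_0_scaleC[OF uv(1) q, of c] by auto
next
  have "cinner f' g - cinner f g' = (bracket_0 f q / of_real w) * cnj (bracket_0 g p)
      - bracket_0 f p * cnj (bracket_0 g q / of_real w)"
    if "(f, f') \<in> bessel_maximal \<nu>" "(g, g') \<in> bessel_maximal \<nu>" for f f' g g'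
    by (rule bessel_maximal_green[OF that p q w])
  then show "case x of (f, f') \<Rightarrow> \<forall>(g, g')\<in>bessel_maximal \<nu>. cinner f' g - cinner f g' =
      (bracket_0 f q / of_real w) * cnj (bracket_0 g p) - bracket_0 f p * cnj (bracket_0 g q / of_real w)"
    if "x \<in> bessel_maximal \<nu>" for x
    using that by fast
next
  have "(a, b) \<in> (\<lambda>u. (bracket_0 u p, bracket_0 u q / of_real w)) ` Domain (bessel_maximal \<nu>)" for a b
  proof -
    have T: "bessel_maximal \<nu> = adjoint_op (bessel_minimal \<nu>)"
      by (simp add: adjoint_bessel_minimal)
    define s where "s = a / bracket_0 d p"
    define t where "t = (b * of_real w - s * bracket_0 d q) / bracket_0 e q"
    have se: "(scaleC s d, scaleC s d') \<in> bessel_maximal \<nu>" "(scaleC t e, scaleC t e') \<in> bessel_maximal \<nu>"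
      using d(1) e(1) unfolding T by (auto intro: adjoint_op_scaleC)
    have "bracket_0 (scaleC s d + scaleC t e) p = a"
      unfolding bracket_0_add[OF se p] bracket_0_scaleC[OF d(1) p] bracket_0_scaleC[OF e(1) p]
      using d e by (simp add: s_def)
    moreover have "bracket_0 (scaleC s d + scaleC t e) q = b * of_real w"
      unfolding bracket_0_add[OF se q] bracket_0_scaleC[OF d(1) q] bracket_0_scaleC[OF e(1) q]
      using e by (simp add: t_def)
    moreover have "scaleC s d + scaleC t e \<in> Domain (bessel_maximal \<nu>)"
      using se unfolding T by (blast intro: adjoint_op_add)
    ultimately show ?thesis
      using w(2) by (intro image_eqI[of _ _ "scaleC s d + scaleC t e"]) auto
  qed
  then show "(\<lambda>u. (bracket_0 u p, bracket_0 u q / of_real w)) ` Domain (bessel_maximal \<nu>) = UNIV"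
    by auto
qed

subsection \<open>The minimal operator\<close>

lemma bessel_compact_support_subset_maximal: "bessel_compact_support \<nu> \<subseteq> bessel_maximal \<nu>"
  unfolding bessel_compact_support_def bessel_maximal_def by blast

lemma bessel_minimal_symmetric: "bessel_minimal \<nu> \<subseteq> adjoint_op (bessel_minimal \<nu>)"
proof -
  have "bessel_compact_support \<nu> \<subseteq> adjoint_op (bessel_minimal \<nu>)"
    using bessel_compact_support_subset_maximal by (simp add: adjoint_bessel_minimal)
  then show ?thesis
    unfolding bessel_minimal_eq[of \<nu>] by (rule closure_minimal[OF _ closed_adjoint_op])
qed

lemma bessel_compact_support_add:
  assumes "(u, v) \<in> bessel_compact_support \<nu>" "(u', v') \<in> bessel_compact_support \<nu>"
  shows "(u + u', v + v') \<in> bessel_compact_support \<nu>"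
proof -
  obtain f f1 f2 g K where f: "u = abs_l2 f" "v = abs_l2 g" "square_integrable f" "square_integrable g"
      "bessel_ode \<nu> f f1 f2 g" "compact K" "K \<subseteq> {0<..}" "\<forall>x>0. x \<notin> K \<longrightarrow> f x = 0"
    using assms(1) unfolding bessel_compact_support_def bessel_pair_iff by blast
  obtain h h1 h2 k K' where h: "u' = abs_l2 h" "v' = abs_l2 k" "square_integrable h" "square_integrable k"
      "bessel_ode \<nu> h h1 h2 k" "compact K'" "K' \<subseteq> {0<..}" "\<forall>x>0. x \<notin> K' \<longrightarrow> h x = 0"
    using assms(2) unfolding bessel_compact_support_def bessel_pair_iff by blast
  have "bessel_pair \<nu> (\<lambda>x. f x + h x) (\<lambda>x. g x + k x)"
    unfolding bessel_pair_iff using square_integrable_add f(3,4) h(3,4) bessel_ode_add[OF f(5) h(5)] by blast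
  moreover have "\<exists>K. compact K \<and> K \<subseteq> {0<..} \<and> (\<forall>x>0. x \<notin> K \<longrightarrow> f x + h x = 0)"
    using f(6-8) h(6-8) by (intro exI[of _ "K \<union> K'"]) auto
  moreover have "(u + u', v + v') = (abs_l2 (\<lambda>x. f x + h x), abs_l2 (\<lambda>x. g x + k x))"
    by (simp add: f h add_abs_l2)
  ultimately show ?thesis
    unfolding bessel_compact_support_def by blast
qed

lemma bessel_compact_support_scaleC:
  assumes "(u, v) \<in> bessel_compact_support \<nu>"
  shows "(scaleC c u, scaleC c v) \<in> bessel_compact_support \<nu>"
proof -
  obtain f f1 f2 g K where f: "u = abs_l2 f" "v = abs_l2 g" "square_integrable f" "square_integrable g"
      "bessel_ode \<nu> f f1 f2 g" "compact K" "K \<subseteq> {0<..}" "\<forall>x>0. x \<notin> K \<longrightarrow> f x = 0"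
    using assms unfolding bessel_compact_support_def bessel_pair_iff by blast
  have "bessel_pair \<nu> (\<lambda>x. c * f x) (\<lambda>x. c * g x)"
    unfolding bessel_pair_iff using square_integrable_scale f(3,4) bessel_ode_scale[OF f(5)] by blast
  moreover have "\<exists>K. compact K \<and> K \<subseteq> {0<..} \<and> (\<forall>x>0. x \<notin> K \<longrightarrow> c * f x = 0)"
    using f(6-8) by (intro exI[of _ K]) auto
  moreover have "(scaleC c u, scaleC c v) = (abs_l2 (\<lambda>x. c * f x), abs_l2 (\<lambda>x. c * g x))"
    by (simp add: f scaleC_abs_l2)
  ultimately show ?thesis
    unfolding bessel_compact_support_def by blast
qed

lemma bessel_compact_support_0: "(0, 0) \<in> bessel_compact_support \<nu>"
proof -
  have "bessel_ode \<nu> (\<lambda>x. of_real 0) (\<lambda>x. of_real 0) (\<lambda>x. of_real 0) (\<lambda>x. of_real 0)"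
    by (rule bessel_odeI_real) auto
  then have "bessel_pair \<nu> (\<lambda>x. 0) (\<lambda>x. 0)"
    unfolding bessel_pair_iff using square_integrable_0 by auto
  then show ?thesis
    unfolding bessel_compact_support_def zero_l2.abs_eq by (auto intro!: exI[of _ "\<lambda>x. 0"] exI[of _ "{}"])
qed

lemma bounded_linear_scaleC: "bounded_linear (scaleC c)"
  by (rule bounded_linear_intro[of _ "norm c"])
    (simp_all add: scaleC_add_right scaleC_scaleR_commute norm_scaleC mult.commute)

text \<open>A vector \<open>w\<close> orthogonal to the domain satisfies \<open>A\<^sup>* 0 = w\<close>, hence \<open>w = \<tau>\<^sub>\<nu> 0 = 0\<close>.\<close>

lemma bessel_minimal_dense: "closure (Domain (bessel_minimal \<nu>)) = UNIV"
proof -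
  let ?D = "Domain (bessel_compact_support \<nu>)"
  have add: "u + u' \<in> ?D" if "u \<in> ?D" "u' \<in> ?D" for u u'
    using that bessel_compact_support_add by (metis DomainE DomainI)
  have scale: "scaleC c u \<in> ?D" if "u \<in> ?D" for c u
    using that bessel_compact_support_scaleC by (metis DomainE DomainI)
  have scale_closure: "scaleC c u \<in> closure ?D" if "u \<in> closure ?D" for c u
  proof -
    have "scaleC c ` closure ?D \<subseteq> closure ?D"
    proof (rule image_closure_subset)
      show "continuous_on (closure ?D) (scaleC c)"
        by (rule linear_continuous_on[OF bounded_linear_scaleC])
      show "scaleC c ` ?D \<subseteq> closure ?D"
        using scale closure_subset by blast
    qed simp
    then show ?thesis
      using that by blast
  qed
  have "closure ?D = UNIV"
  proof (rule subspace_eq_UNIV_if_orthogonal_trivial)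
    show "subspace (closure ?D)"
    proof (rule subspaceI)
      show "0 \<in> closure ?D"
        using bessel_compact_support_0 closure_subset by blast
      show "r *\<^sub>R u \<in> closure ?D" if "u \<in> closure ?D" for r u
        using scale_closure[OF that] by (simp add: scaleR_eq_scaleC)
      show "u + v \<in> closure ?D" if uv: "u \<in> closure ?D" "v \<in> closure ?D" for u v
      proof -
        obtain U V where UV: "\<forall>n. U n \<in> ?D" "U \<longlonglongrightarrow> u" "\<forall>n. V n \<in> ?D" "V \<longlonglongrightarrow> v"
          using uv unfolding closure_sequential by blast
        show ?thesis
          unfolding closure_sequential
        proof (intro exI[of _ "\<lambda>n. U n + V n"] conjI allI)
          show "U n + V n \<in> ?D" for n
            using UV by (intro add) auto
          show "(\<lambda>n. U n + V n) \<longlonglongrightarrow> u + v"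
            by (intro tendsto_add UV)
        qed
      qed
    qed
    fix w
    assume w: "\<And>m. m \<in> closure ?D \<Longrightarrow> cinner m w = 0"
    have "(0, w) \<in> adjoint_op (bessel_compact_support \<nu>)"
      unfolding adjoint_op_iff
    proof (intro allI impI)
      fix u v
      assume "(u, v) \<in> bessel_compact_support \<nu>"
      then have "u \<in> closure ?D"
        by (intro subsetD[OF closure_subset] DomainI)
      then show "cinner v 0 = cinner u w"
        using w by simp
    qed
    then have "(0, w) \<in> bessel_maximal \<nu>"
      by (simp add: adjoint_bessel_minimal[symmetric] bessel_minimal_eq adjoint_op_closure)
    then obtain f f1 f2 g where f: "0 = abs_l2 f" "w = abs_l2 g" "square_integrable f" "square_integrable g"
        "bessel_ode \<nu> f f1 f2 g"
      using bessel_maximal_cases by metis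
    have "AE x in half_line. f x = 0"
      using f(1) abs_l2_eq_iff[OF f(3) square_integrable_0] by (simp add: zero_l2.abs_eq)
    then have f0: "f x = 0" if "0 < x" for x
      using continuous_AE_eq_imp_eq[OF bessel_odeD(5)[OF f(5)] continuous_on_const _ that] by simp
    then have f10: "f1 x = 0" if "0 < x" for x
      using bessel_odeD(1)[OF f(5) that] that by (intro vector_derivative_zero_on_open[of f "f1 x" x "{0<..}"]) auto
    have "AE x in half_line. g x = 0"
      using bessel_odeD(6)[OF f(5)] AE_space
    proof eventually_elim
      case (elim x)
      then have x: "0 < x"
        by simp
      have "f2 x = 0"
        using elim(1) x f10 by (intro vector_derivative_zero_on_open[of f1 "f2 x" x "{0<..}"]) auto
      then show ?case
        using bessel_odeD(7)[OF f(5) x] f0[OF x] by simp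
    qed
    then show "w = 0"
      using abs_l2_eq_iff[OF f(4) square_integrable_0] by (simp add: zero_l2.abs_eq f(2))
  qed (use scale_closure in auto)
  moreover have "closure ?D \<subseteq> closure (Domain (bessel_minimal \<nu>))"
    unfolding bessel_minimal_eq by (intro closure_mono Domain_mono closure_subset)
  ultimately show ?thesis
    by auto
qed

subsection \<open>Dilations of a test function\<close>

text \<open>The solution \<open>x powr m\<close> is multiplied by a smooth function that is \<open>1\<close> at the origin and decays
  fast enough at infinity; \<open>r\<close> is the dilation parameter. A rational factor keeps all derivatives
  polynomial in \<open>bump\<close>.\<close>

definition bump :: "real \<Rightarrow> real \<Rightarrow> real"
  where "bump r x = inverse (1 + (r * x)\<^sup>2)"

definition test_fun :: "real \<Rightarrow> real \<Rightarrow> real \<Rightarrow> real"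
  where "test_fun m r x = x powr m * (bump r x)\<^sup>2"

definition test_fun' :: "real \<Rightarrow> real \<Rightarrow> real \<Rightarrow> real"
  where "test_fun' m r x = m * x powr (m - 1) * (bump r x)\<^sup>2 - 4 * r\<^sup>2 * x powr (m + 1) * bump r x ^ 3"

text \<open>This is \<open>\<tau>\<^sub>\<nu>\<close> applied to \<open>test_fun\<close> if \<open>m\<^sup>2 - m = \<nu>\<^sup>2 - 1/4\<close>.\<close>

definition test_fun_image :: "real \<Rightarrow> real \<Rightarrow> real \<Rightarrow> real"
  where "test_fun_image m r x = r\<^sup>2 * x powr m * ((8 * m + 4) * bump r x ^ 3 - 24 * (r * x)\<^sup>2 * bump r x ^ 4)"

lemma bump_pos: "0 < bump r x"
  unfolding bump_def by (simp add: add_pos_nonneg)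

lemma bump_le_1: "bump r x \<le> 1"
  unfolding bump_def by (intro inverse_le_1_iff[THEN iffD2]) simp

lemma bump_derivative: "(bump r has_real_derivative - (2 * r\<^sup>2 * x) * (bump r x)\<^sup>2) (at x)"
proof -
  have "1 + (r * x)\<^sup>2 \<noteq> 0"
    by (metis add_pos_nonneg less_irrefl zero_le_power2 zero_less_one)
  then show ?thesis
    unfolding bump_def[abs_def]
    by (auto intro!: derivative_eq_intros simp: power2_eq_square)
qed

lemma continuous_on_bump [continuous_intros]: "continuous_on S (bump r)"
  by (intro continuous_at_imp_continuous_on ballI DERIV_isCont[OF bump_derivative])

lemma bessel_ode_test_fun:
  assumes m: "m\<^sup>2 - m = \<nu>\<^sup>2 - 1/4"
  shows "\<exists>f2. bessel_ode \<nu> (\<lambda>x. of_real (test_fun m r x)) (\<lambda>x. of_real (test_fun' m r x)) f2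
    (\<lambda>x. of_real (test_fun_image m r x))"
proof -
  define f2 where "f2 x = m * (m - 1) * x powr (m - 2) * (bump r x)\<^sup>2 - (8 * m + 4) * r\<^sup>2 * x powr m * bump r x ^ 3
    + 24 * r\<^sup>2 * r\<^sup>2 * x powr (m + 2) * bump r x ^ 4" for x
  have "bessel_ode \<nu> (\<lambda>x. of_real (test_fun m r x)) (\<lambda>x. of_real (test_fun' m r x)) (\<lambda>x. of_real (f2 x))
    (\<lambda>x. of_real (test_fun_image m r x))"
  proof (rule bessel_odeI_real)
    fix x :: real
    assume x: "0 < x"
    have pw: "x powr (m + 1) = x powr m * x" "x powr (m + 2) = x powr m * x\<^sup>2"
        "x powr (m - 1) = x powr m / x" "x powr (m - 2) = x powr m / x\<^sup>2"
      using x by (simp_all add: powr_add powr_diff)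
    have "(test_fun m r has_real_derivative
        m * x powr (m - 1) * (bump r x)\<^sup>2 + (2 * (- (2 * r\<^sup>2 * x) * (bump r x)\<^sup>2 * bump r x)) * x powr m) (at x)"
      unfolding test_fun_def[abs_def] using x
      by (auto intro!: derivative_eq_intros bump_derivative)
    then show "(test_fun m r has_real_derivative test_fun' m r x) (at x)"
      by (rule DERIV_cong) (simp add: test_fun'_def pw power2_eq_square power3_eq_cube)
    have "(test_fun' m r has_real_derivative
        (m * ((m - 1) * x powr (m - 1 - 1)) * (bump r x)\<^sup>2
          + (2 * (- (2 * r\<^sup>2 * x) * (bump r x)\<^sup>2 * bump r x)) * (m * x powr (m - 1)))
        - (4 * r\<^sup>2 * ((m + 1) * x powr (m + 1 - 1)) * bump r x ^ 3
          + (3 * (- (2 * r\<^sup>2 * x) * (bump r x)\<^sup>2 * (bump r x)\<^sup>2)) * (4 * r\<^sup>2 * x powr (m + 1)))) (at x)"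
      unfolding test_fun'_def[abs_def] using x
      by (auto intro!: derivative_eq_intros bump_derivative)
    then show "(test_fun' m r has_real_derivative f2 x) (at x)"
    proof (rule DERIV_cong)
      have pw': "x powr (m - 1 - 1) = x powr m / x\<^sup>2" "x powr (m + 1 - 1) = x powr m"
        using pw(4) by (simp_all add: diff_diff_eq)
      show "(m * ((m - 1) * x powr (m - 1 - 1)) * (bump r x)\<^sup>2
          + (2 * (- (2 * r\<^sup>2 * x) * (bump r x)\<^sup>2 * bump r x)) * (m * x powr (m - 1)))
        - (4 * r\<^sup>2 * ((m + 1) * x powr (m + 1 - 1)) * bump r x ^ 3
          + (3 * (- (2 * r\<^sup>2 * x) * (bump r x)\<^sup>2 * (bump r x)\<^sup>2)) * (4 * r\<^sup>2 * x powr (m + 1))) = f2 x"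
        unfolding f2_def pw' pw using x
        by (simp add: power2_eq_square power3_eq_cube power4_eq_xxxx field_simps)
    qed
    show "test_fun_image m r x = - f2 x + (\<nu>\<^sup>2 - 1/4) / x\<^sup>2 * test_fun m r x"
      unfolding test_fun_image_def f2_def test_fun_def pw m[symmetric] using x
      by (simp add: power2_eq_square field_simps)
  next
    show "continuous_on {0<..} f2"
      unfolding f2_def[abs_def] by (intro continuous_intros) auto
  qed
  then show ?thesis
    by blast
qed

lemma square_integrable_by_bump:
  fixes F :: "real \<Rightarrow> real"
  assumes F: "continuous_on {0<..} F" and bound: "\<And>x. 0 < x \<Longrightarrow> \<bar>F x\<bar> \<le> K * (x powr m * (bump 1 x)\<^sup>2)"
    and m: "-1/2 < m" "m < 3/2"
  shows "square_integrable (\<lambda>x. of_real (F x))"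
proof (rule square_integrable_by_powr)
  show "(\<lambda>x. complex_of_real (F x)) \<in> borel_measurable half_line"
    by (intro continuous_on_measurable_half_line continuous_intros F)
  show "-1 < 2 * m"
    using m by simp
  have sq: "(norm (complex_of_real (F x)))\<^sup>2 \<le> K\<^sup>2 * (x powr (2 * m) * bump 1 x ^ 4)" if "0 < x" for x
  proof -
    have "(norm (complex_of_real (F x)))\<^sup>2 \<le> (K * (x powr m * (bump 1 x)\<^sup>2))\<^sup>2"
      using bound[OF that] by (intro power_mono) auto
    also have "\<dots> = K\<^sup>2 * (x powr m * x powr m * bump 1 x ^ 4)"
      by (simp add: power_mult_distrib power2_eq_square power4_eq_xxxx mult_ac)
    also have "x powr m * x powr m = x powr (2 * m)"
      by (simp add: powr_add[symmetric])
    finally show ?thesis .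
  qed
  show "(norm (complex_of_real (F x)))\<^sup>2 \<le> K\<^sup>2 * x powr (2 * m)" if "0 < x" "x \<le> 1" for x
  proof (rule order_trans[OF sq[OF that(1)]])
    have "x powr (2 * m) * bump 1 x ^ 4 \<le> x powr (2 * m) * 1"
      using bump_pos[of 1 x] bump_le_1[of 1 x] by (intro mult_left_mono power_le_one) auto
    then show "K\<^sup>2 * (x powr (2 * m) * bump 1 x ^ 4) \<le> K\<^sup>2 * x powr (2 * m)"
      by (intro mult_left_mono) auto
  qed
  show "(norm (complex_of_real (F x)))\<^sup>2 \<le> K\<^sup>2 * x powr (-2)" if "1 < x" for x
  proof (rule order_trans[OF sq])
    have "bump 1 x \<le> x powr (-2)"
    proof -
      have "bump 1 x \<le> inverse (x\<^sup>2)"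
        unfolding bump_def using that by (intro le_imp_inverse_le) auto
      also have "\<dots> = x powr (-2)"
        using that by (simp add: powr_minus)
      finally show ?thesis .
    qed
    then have "bump 1 x ^ 4 \<le> (x powr (-2)) ^ 4"
      using bump_pos[of 1 x] by (intro power_mono) auto
    also have "(x powr (-2)) ^ 4 = x powr (-8)"
      using that by (simp add: powr_power)
    finally have "x powr (2 * m) * bump 1 x ^ 4 \<le> x powr (2 * m) * x powr (-8)"
      by (intro mult_left_mono) auto
    also have "\<dots> = x powr (2 * m - 8)"
      by (simp add: powr_add[symmetric])
    also have "\<dots> \<le> x powr (-2)"
      using that m by (intro powr_mono) auto
    finally show "K\<^sup>2 * (x powr (2 * m) * bump 1 x ^ 4) \<le> K\<^sup>2 * x powr (-2)"
      by (intro mult_left_mono) auto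
  qed (use that in simp)
qed

lemma half_line_scale:
  fixes h :: "real \<Rightarrow> 'a :: euclidean_space"
  assumes h: "integrable half_line h" and r: "0 < r"
  shows "integrable half_line (\<lambda>x. h (r * x))"
    and "integral\<^sup>L half_line (\<lambda>x. h (r * x)) = (1 / r) *\<^sub>R integral\<^sup>L half_line h"
proof -
  let ?h = "\<lambda>x. indicator {0<..} x *\<^sub>R h x"
  have eq: "(\<lambda>x. ?h (0 + r * x)) = (\<lambda>x. indicator {0<..} x *\<^sub>R h (r * x))"
    using r by (auto simp: indicator_def zero_less_mult_iff)
  have int: "integrable lebesgue ?h"
    using h by (subst (asm) integrable_restrict_space) simp_all
  have "integrable lebesgue (\<lambda>x. ?h (0 + r * x))"
    using r by (intro lebesgue_integrable_real_affine[OF int]) simp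
  then show "integrable half_line (\<lambda>x. h (r * x))"
    unfolding eq by (subst integrable_restrict_space) simp_all
  have "integral\<^sup>L lebesgue ?h = \<bar>r\<bar> *\<^sub>R integral\<^sup>L lebesgue (\<lambda>x. ?h (0 + r * x))"
    using r by (intro lebesgue_integral_real_affine) simp
  then have "integral\<^sup>L half_line h = r *\<^sub>R integral\<^sup>L half_line (\<lambda>x. h (r * x))"
    unfolding eq using r by (simp add: integral_restrict_space)
  then show "integral\<^sup>L half_line (\<lambda>x. h (r * x)) = (1 / r) *\<^sub>R integral\<^sup>L half_line h"
    using r by simp
qed

lemma square_integrable_test_fun:
  assumes m: "-1/2 < m" "m < 3/2"
  shows "square_integrable (\<lambda>x. of_real (test_fun m 1 x))"
    and "square_integrable (\<lambda>x. of_real (test_fun_image m 1 x))"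
proof -
  show "square_integrable (\<lambda>x. of_real (test_fun m 1 x))"
  proof (rule square_integrable_by_bump[OF _ _ m])
    show "continuous_on {0<..} (test_fun m 1)"
      unfolding test_fun_def[abs_def] by (intro continuous_intros) auto
    show "\<bar>test_fun m 1 x\<bar> \<le> 1 * (x powr m * (bump 1 x)\<^sup>2)" for x
      by (simp add: test_fun_def)
  qed
  show "square_integrable (\<lambda>x. of_real (test_fun_image m 1 x))"
  proof (rule square_integrable_by_bump[OF _ _ m])
    show "continuous_on {0<..} (test_fun_image m 1)"
      unfolding test_fun_image_def[abs_def] by (intro continuous_intros) auto
    fix x :: real
    let ?b = "bump 1 x"
    have b: "0 < ?b" "?b \<le> 1" "x\<^sup>2 * ?b \<le> 1"
      using bump_pos[of 1 x] bump_le_1[of 1 x] by (auto simp: bump_def divide_simps add_pos_nonneg)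
    have "\<bar>(8 * m + 4) * ?b - 24 * (x\<^sup>2 * ?b) * ?b\<bar> \<le> \<bar>(8 * m + 4) * ?b\<bar> + \<bar>24 * (x\<^sup>2 * ?b) * ?b\<bar>"
      by (rule abs_triangle_ineq4)
    also have "\<dots> = \<bar>8 * m + 4\<bar> * ?b + 24 * ((x\<^sup>2 * ?b) * ?b)"
      using b by (simp add: abs_mult)
    also have "\<dots> \<le> \<bar>8 * m + 4\<bar> * 1 + 24 * (1 * 1)"
      using b by (intro add_mono mult_left_mono mult_mono) auto
    finally have *: "\<bar>(8 * m + 4) * ?b - 24 * (x\<^sup>2 * ?b) * ?b\<bar> \<le> \<bar>8 * m + 4\<bar> + 24"
      by simp
    have "\<bar>test_fun_image m 1 x\<bar> = \<bar>(8 * m + 4) * ?b - 24 * (x\<^sup>2 * ?b) * ?b\<bar> * (x powr m * ?b\<^sup>2)"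
    proof -
      have "test_fun_image m 1 x = ((8 * m + 4) * ?b - 24 * (x\<^sup>2 * ?b) * ?b) * (x powr m * ?b\<^sup>2)"
        by (simp add: test_fun_image_def power2_eq_square power3_eq_cube power4_eq_xxxx algebra_simps)
      then show ?thesis
        by (simp add: abs_mult)
    qed
    also have "\<dots> \<le> (\<bar>8 * m + 4\<bar> + 24) * (x powr m * ?b\<^sup>2)"
      by (intro mult_right_mono *) auto
    finally show "\<bar>test_fun_image m 1 x\<bar> \<le> (\<bar>8 * m + 4\<bar> + 24) * (x powr m * ?b\<^sup>2)" .
  qed
qed

lemma test_fun_dilation:
  assumes "0 < r" "0 < x"
  shows "test_fun m r x = r powr (- m) * test_fun m 1 (r * x)"
    and "test_fun_image m r x = r powr (2 - m) * test_fun_image m 1 (r * x)"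
proof -
  have "r powr (- m) * r powr m = 1"
    using assms by (simp add: powr_add[symmetric])
  then have *: "x powr m = r powr (- m) * (r * x) powr m"
    using assms by (simp add: powr_mult mult.assoc[symmetric])
  have b: "bump r x = bump 1 (r * x)"
    by (simp add: bump_def)
  show "test_fun m r x = r powr (- m) * test_fun m 1 (r * x)"
    unfolding test_fun_def b by (subst *) simp
  have "r powr (2 - m) = r\<^sup>2 * r powr (- m)"
    using assms by (simp add: powr_diff powr_minus divide_inverse)
  then show "test_fun_image m r x = r powr (2 - m) * test_fun_image m 1 (r * x)"
    unfolding test_fun_image_def b by (subst *) simp
qed

definition test_vec :: "real \<Rightarrow> real \<Rightarrow> l2"
  where "test_vec m r = abs_l2 (\<lambda>x. of_real (test_fun m r x))"

definition test_vec_image :: "real \<Rightarrow> real \<Rightarrow> l2"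
  where "test_vec_image m r = abs_l2 (\<lambda>x. of_real (test_fun_image m r x))"

lemma l2_dilation:
  assumes f: "square_integrable f" and g: "square_integrable g" and r: "0 < r"
    and F: "\<And>x. 0 < x \<Longrightarrow> F x = of_real s * f (r * x)" "continuous_on {0<..} F"
    and G: "\<And>x. 0 < x \<Longrightarrow> G x = of_real t * g (r * x)" "continuous_on {0<..} G"
  shows "square_integrable F" "cinner (abs_l2 F) (abs_l2 G) = of_real (s * t / r) * cinner (abs_l2 f) (abs_l2 g)"
proof -
  have sq: "square_integrable F" if f: "square_integrable f" "\<And>x. 0 < x \<Longrightarrow> F x = of_real s * f (r * x)" "continuous_on {0<..} F"
    for f F s
    unfolding square_integrable_def
  proof
    show "F \<in> borel_measurable half_line"
      by (rule continuous_on_measurable_half_line[OF that(3)])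
    have "integrable half_line (\<lambda>x. s\<^sup>2 * (norm (f (r * x)))\<^sup>2)"
      by (intro integrable_mult_right half_line_scale(1)[OF square_integrable_integrable[OF f(1)] r])
    then show "integrable half_line (\<lambda>x. (norm (F x))\<^sup>2)"
      by (rule Bochner_Integration.integrable_cong[THEN iffD1, OF refl, rotated])
        (simp add: that(2) norm_mult power_mult_distrib)
  qed
  show F_sq: "square_integrable F"
    by (rule sq[OF f F])
  have G_sq: "square_integrable G"
    by (rule sq[OF g G])
  have "cinner (abs_l2 F) (abs_l2 G) = (\<integral>x. of_real (s * t) * (f (r * x) * cnj (g (r * x))) \<partial>half_line)"
    unfolding cinner_abs_l2[OF F_sq G_sq] by (intro Bochner_Integration.integral_cong) (auto simp: F(1) G(1))
  also have "\<dots> = of_real (s * t) * (\<integral>x. f (r * x) * cnj (g (r * x)) \<partial>half_line)"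
    by (rule integral_mult_right_zero)
  also have "(\<integral>x. f (r * x) * cnj (g (r * x)) \<partial>half_line) = (1 / r) *\<^sub>R (\<integral>x. f x * cnj (g x) \<partial>half_line)"
    by (rule half_line_scale(2)[OF integrable_mult_cnj[OF f g] r])
  finally show "cinner (abs_l2 F) (abs_l2 G) = of_real (s * t / r) * cinner (abs_l2 f) (abs_l2 g)"
    by (simp add: cinner_abs_l2 f g scaleR_conv_of_real)
qed

text \<open>The three exponents decide the limits used later: with \<open>m = 1/2 + \<nu>\<close> the first and the last
  are negative, with \<open>m = 1/2 - \<nu>\<close> the second and the last are positive.\<close>

lemma test_vec_scaling:
  assumes m: "-1/2 < m" "m < 3/2" and r: "0 < r"
  shows "square_integrable (\<lambda>x. of_real (test_fun m r x))"
    and "square_integrable (\<lambda>x. of_real (test_fun_image m r x))"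
    and "(norm (test_vec m r))\<^sup>2 = r powr (- 2 * m - 1) * (norm (test_vec m 1))\<^sup>2"
    and "(norm (test_vec_image m r))\<^sup>2 = r powr (3 - 2 * m) * (norm (test_vec_image m 1))\<^sup>2"
    and "cinner (test_vec_image m r) (test_vec m r)
      = of_real (r powr (1 - 2 * m)) * cinner (test_vec_image m 1) (test_vec m 1)"
proof -
  note sq = square_integrable_test_fun[OF m]
  have E: "complex_of_real (test_fun m r x) = of_real (r powr (- m)) * of_real (test_fun m 1 (r * x))"
    and I: "complex_of_real (test_fun_image m r x) = of_real (r powr (2 - m)) * of_real (test_fun_image m 1 (r * x))"
    if "0 < x" for x
    using test_fun_dilation[OF r that, of m] by simp_all
  have cE: "continuous_on {0<..} (\<lambda>x. complex_of_real (test_fun m r x))"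
    unfolding test_fun_def by (intro continuous_intros) auto
  have cI: "continuous_on {0<..} (\<lambda>x. complex_of_real (test_fun_image m r x))"
    unfolding test_fun_image_def by (intro continuous_intros) auto
  show "square_integrable (\<lambda>x. of_real (test_fun m r x))"
    by (rule l2_dilation(1)[OF sq(1) sq(1) r E cE E cE])
  show "square_integrable (\<lambda>x. of_real (test_fun_image m r x))"
    by (rule l2_dilation(1)[OF sq(2) sq(2) r I cI I cI])
  have rr: "r powr a * r powr b / r = r powr (a + b - 1)" for a b
    using r by (simp add: powr_add powr_diff)
  have "complex_of_real ((norm (test_vec m r))\<^sup>2) = of_real (r powr (- 2 * m - 1) * (norm (test_vec m 1))\<^sup>2)"
    using l2_dilation(2)[OF sq(1) sq(1) r E cE E cE, unfolded rr]
    unfolding of_real_mult cinner_self[symmetric] test_vec_def by simp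
  then show "(norm (test_vec m r))\<^sup>2 = r powr (- 2 * m - 1) * (norm (test_vec m 1))\<^sup>2"
    by (simp only: of_real_eq_iff)
  have "complex_of_real ((norm (test_vec_image m r))\<^sup>2) = of_real (r powr (3 - 2 * m) * (norm (test_vec_image m 1))\<^sup>2)"
    using l2_dilation(2)[OF sq(2) sq(2) r I cI I cI, unfolded rr]
    unfolding of_real_mult cinner_self[symmetric] test_vec_image_def by (simp add: algebra_simps)
  then show "(norm (test_vec_image m r))\<^sup>2 = r powr (3 - 2 * m) * (norm (test_vec_image m 1))\<^sup>2"
    by (simp only: of_real_eq_iff)
  show "cinner (test_vec_image m r) (test_vec m r)
      = of_real (r powr (1 - 2 * m)) * cinner (test_vec_image m 1) (test_vec m 1)"
    using l2_dilation(2)[OF sq(2) sq(1) r I cI E cE, unfolded rr]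
    unfolding test_vec_image_def test_vec_def by (simp add: algebra_simps)
qed

text \<open>The bracket of \<open>x\<^sup>m \<eta>\<close> and \<open>q\<close> is \<open>\<eta> [x\<^sup>m, q] - \<eta>' x\<^sup>m q\<close>, where \<open>\<eta> \<rightarrow> 1\<close> and \<open>\<eta>' = O(x)\<close>.\<close>

lemma test_vec_boundary_value:
  assumes mm: "m\<^sup>2 - m = \<nu>\<^sup>2 - 1/4" and m: "-1/2 < m" "m < 3/2" and r: "0 < r"
    and q: "square_integrable_solution \<nu> q q1"
    and w: "\<And>x. 0 < x \<Longrightarrow> x powr m * q1 x - m * x powr (m - 1) * q x = w"
    and lim: "((\<lambda>x. x powr (m + 1) * q x) \<longlongrightarrow> 0) (at_right 0)"
  shows "(test_vec m r, test_vec_image m r) \<in> bessel_maximal \<nu>"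
    and "bracket_0 (test_vec m r) q = of_real w"
proof -
  obtain f2 where ode: "bessel_ode \<nu> (\<lambda>x. of_real (test_fun m r x)) (\<lambda>x. of_real (test_fun' m r x)) f2
    (\<lambda>x. of_real (test_fun_image m r x))"
    using bessel_ode_test_fun[OF mm] by blast
  note sq = test_vec_scaling(1,2)[OF m r]
  show "(test_vec m r, test_vec_image m r) \<in> bessel_maximal \<nu>"
    unfolding test_vec_def test_vec_image_def by (rule bessel_maximalI[OF sq ode])
  have bump0: "(bump r \<longlongrightarrow> 1) (at_right 0)"
    using DERIV_isCont[OF bump_derivative[of r 0]] by (simp add: isCont_def bump_def filterlim_at_split)
  have "((\<lambda>x. complex_of_real ((bump r x)\<^sup>2 * w + 4 * r\<^sup>2 * bump r x ^ 3 * (x powr (m + 1) * q x)))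
      \<longlongrightarrow> of_real (1\<^sup>2 * w + 4 * r\<^sup>2 * 1 ^ 3 * 0)) (at_right 0)"
    by (intro tendsto_intros bump0 lim)
  then have lim': "((\<lambda>x. complex_of_real ((bump r x)\<^sup>2 * w + 4 * r\<^sup>2 * bump r x ^ 3 * (x powr (m + 1) * q x)))
      \<longlongrightarrow> of_real w) (at_right 0)"
    by simp
  have eq: "\<forall>\<^sub>F x in at_right 0. complex_of_real ((bump r x)\<^sup>2 * w + 4 * r\<^sup>2 * bump r x ^ 3 * (x powr (m + 1) * q x))
      = wronskian (\<lambda>x. of_real (test_fun m r x)) (\<lambda>x. of_real (test_fun' m r x)) (\<lambda>x. of_real (q x)) (\<lambda>x. of_real (q1 x)) x"
    unfolding eventually_at_right_field
  proof (intro exI[of _ 1] conjI allI impI)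
    fix x :: real
    assume "0 < x"
    have "(bump r x)\<^sup>2 * w + 4 * r\<^sup>2 * bump r x ^ 3 * (x powr (m + 1) * q x)
        = test_fun m r x * q1 x - test_fun' m r x * q x"
      unfolding w[OF \<open>0 < x\<close>, symmetric] test_fun_def test_fun'_def by (simp add: algebra_simps)
    then show "complex_of_real ((bump r x)\<^sup>2 * w + 4 * r\<^sup>2 * bump r x ^ 3 * (x powr (m + 1) * q x))
      = wronskian (\<lambda>x. of_real (test_fun m r x)) (\<lambda>x. of_real (test_fun' m r x)) (\<lambda>x. of_real (q x)) (\<lambda>x. of_real (q1 x)) x"
      unfolding wronskian_def complex_cnj_complex_of_real by (simp only: of_real_diff of_real_mult)
  qed simp
  obtain q2 where q2: "bessel_ode \<nu> (\<lambda>x. of_real (q x)) (\<lambda>x. of_real (q1 x)) q2 (\<lambda>_. 0)"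
    using q unfolding square_integrable_solution_def by blast
  show "bracket_0 (test_vec m r) q = of_real w"
    unfolding test_vec_def
    by (rule bracket_0_eq[OF ode sq(1) bessel_odeD(1)[OF q2] Lim_transform_eventually[OF lim' eq]])
qed

lemma square_integrable_solution_powr:
  assumes "m\<^sup>2 - m = \<nu>\<^sup>2 - 1/4" "-1/2 < m"
  shows "square_integrable_solution \<nu> (\<lambda>x. x powr m) (\<lambda>x. m * x powr (m - 1))"
  unfolding square_integrable_solution_def
  using bessel_ode_powr[OF assms(1)] square_integrable_powr_near_0[OF assms(2)] by blast

subsection \<open>The borderline case \<open>\<nu> = 0\<close>\<close>

lemma square_integrable_solution_log:
  "square_integrable_solution 0 (\<lambda>x. x powr (1/2) * ln x) (\<lambda>x. 1/2 * x powr (-1/2) * ln x + x powr (-1/2))"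
  unfolding square_integrable_solution_def
proof
  have "bessel_ode 0 (\<lambda>x. of_real (x powr (1/2) * ln x))
    (\<lambda>x. of_real (1/2 * x powr (-1/2) * ln x + x powr (-1/2))) (\<lambda>x. of_real (- 1/4 * x powr (-3/2) * ln x)) (\<lambda>_. of_real 0)"
  proof (rule bessel_odeI_real)
    fix x :: real
    assume x: "0 < x"
    have pw: "x powr (1/2) = x powr (-3/2) * x\<^sup>2" "x powr (-1/2) = x powr (-3/2) * x"
      using powr_add[of x "-3/2" 2] powr_add[of x "-3/2" 1] x by simp_all
    then have pw': "x powr (1/2) = x * (x * x powr - (3/2))" "x powr - (1/2) = x * x powr - (3/2)"
      by (simp_all add: power2_eq_square mult_ac)
    show "((\<lambda>x. x powr (1/2) * ln x) has_real_derivative 1/2 * x powr (-1/2) * ln x + x powr (-1/2)) (at x)"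
      using x by (auto intro!: derivative_eq_intros simp: pw' field_simps)
    show "((\<lambda>x. 1/2 * x powr (-1/2) * ln x + x powr (-1/2)) has_real_derivative - 1/4 * x powr (-3/2) * ln x) (at x)"
      using x by (auto intro!: derivative_eq_intros simp: pw' field_simps)
    show "0 = - (- 1/4 * x powr (-3/2) * ln x) + (0\<^sup>2 - 1/4) / x\<^sup>2 * (x powr (1/2) * ln x)"
      unfolding pw using x by (simp add: power2_eq_square)
  qed (auto intro!: continuous_intros)
  then show "\<exists>p2. bessel_ode 0 (\<lambda>x. of_real (x powr (1/2) * ln x))
    (\<lambda>x. of_real (1/2 * x powr (-1/2) * ln x + x powr (-1/2))) p2 (\<lambda>_. 0)"
    by auto
  show "square_integrable (\<lambda>x. if x \<le> 1 then of_real (x powr (1/2) * ln x) else 0)"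
  proof (rule square_integrable_by_powr[where C = 4 and \<alpha> = 0])
    have "{0<..1::real} \<in> sets half_line"
      by (auto simp: sets_restrict_space_iff)
    also have "{0<..1::real} = {x \<in> space half_line. x \<le> 1}"
      by auto
    finally have "{x \<in> space half_line. x \<le> 1} \<in> sets half_line" .
    then show "(\<lambda>x. if x \<le> 1 then complex_of_real (x powr (1/2) * ln x) else 0) \<in> borel_measurable half_line"
      by (intro measurable_If continuous_on_measurable_half_line continuous_intros) auto
    fix x :: real
    assume x: "0 < x" "x \<le> 1"
    have "- ln x \<le> 2 / x powr (1/2)"
    proof -
      have "- ln x = 2 * ln (1 / x powr (1/2))"
        using x by (simp add: ln_div ln_powr)
      also have "\<dots> \<le> 2 * (1 / x powr (1/2) - 1)"
        using x by (intro mult_left_mono ln_le_minus_one) auto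
      finally show ?thesis
        by simp
    qed
    then have "\<bar>x powr (1/2) * ln x\<bar> \<le> 2"
      using x by (simp add: abs_mult abs_of_nonpos field_simps)
    then have "\<bar>x powr (1/2) * ln x\<bar>\<^sup>2 \<le> 2\<^sup>2"
      by (intro power_mono) auto
    then show "(norm (if x \<le> 1 then complex_of_real (x powr (1/2) * ln x) else 0))\<^sup>2 \<le> 4 * x powr 0"
      using x by (simp only: if_True norm_of_real) simp
  qed auto
qed

text \<open>For \<open>\<nu> = 0\<close> and \<open>t = ln x\<close> one has \<open>\<tau> (x powr (1/2) \<cdot> \<psi> t) = - x powr (-3/2) \<cdot> \<psi>'' t\<close>, so the
  form is negative if \<open>\<psi>\<close> is negative and concave. The function \<open>\<psi> t = - ln (1 + c exp (- 2 t)) / 2\<close> is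
  both. It decays as \<open>t \<rightarrow> \<infinity>\<close>, and \<open>\<psi> t = t - ln c / 2 + o(1)\<close> as \<open>t \<rightarrow> -\<infinity>\<close>, so that by the choice
  of \<open>c\<close> every boundary condition other than \<open>\<Gamma>\<^sub>0 f = 0\<close> is met.\<close>

definition log_fun :: "real \<Rightarrow> real \<Rightarrow> real"
  where "log_fun c x = - (1/2) * x powr (1/2) * ln (1 + c / x\<^sup>2)"

definition log_fun' :: "real \<Rightarrow> real \<Rightarrow> real"
  where "log_fun' c x = - (1/4) * x powr (-1/2) * ln (1 + c / x\<^sup>2) + c * x powr (-1/2) / (x\<^sup>2 + c)"

definition log_fun_image :: "real \<Rightarrow> real \<Rightarrow> real"
  where "log_fun_image c x = 2 * c * x powr (1/2) / (x\<^sup>2 + c)\<^sup>2"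

context
  fixes c :: real
  assumes c: "0 < c"
begin

lemma log_fun_ode:
  "\<exists>f2. bessel_ode 0 (\<lambda>x. of_real (log_fun c x)) (\<lambda>x. of_real (log_fun' c x)) f2 (\<lambda>x. of_real (log_fun_image c x))"
proof -
  define f2 where "f2 x = 1/8 * x powr (-3/2) * ln (1 + c / x\<^sup>2) - 2 * c * x powr (1/2) / (x\<^sup>2 + c)\<^sup>2" for x
  have "bessel_ode 0 (\<lambda>x. of_real (log_fun c x)) (\<lambda>x. of_real (log_fun' c x)) (\<lambda>x. of_real (f2 x))
    (\<lambda>x. of_real (log_fun_image c x))"
  proof (rule bessel_odeI_real)
    fix x :: real
    assume x: "0 < x"
    have xc: "0 < x\<^sup>2 + c"
      using c by (simp add: add_nonneg_pos)
    have pw: "x powr (1/2) = x powr (-3/2) * x\<^sup>2" "x powr (-1/2) = x powr (-3/2) * x"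
      using powr_add[of x "-3/2" 2] powr_add[of x "-3/2" 1] x by simp_all
    have L: "((\<lambda>x. ln (1 + c / x\<^sup>2)) has_real_derivative - 2 * c / (x * (x\<^sup>2 + c))) (at x)"
    proof -
      have "0 < 1 + c / x\<^sup>2"
        using c x by (simp add: add_pos_nonneg)
      moreover have "1 + c / x\<^sup>2 = (x\<^sup>2 + c) / x\<^sup>2"
        using x by (simp add: field_simps)
      ultimately have "((\<lambda>x. ln (1 + c / x\<^sup>2)) has_real_derivative (- (c * (2 * x)) / (x\<^sup>2 * x\<^sup>2)) / (1 + c / x\<^sup>2)) (at x)"
        using x by (auto intro!: derivative_eq_intros simp: mult_ac)
      moreover have "(- (c * (2 * x)) / (x\<^sup>2 * x\<^sup>2)) / (1 + c / x\<^sup>2) = - 2 * c / (x * (x\<^sup>2 + c))"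
        unfolding \<open>1 + c / x\<^sup>2 = (x\<^sup>2 + c) / x\<^sup>2\<close> using x xc by (simp add: power2_eq_square)
      ultimately show ?thesis
        by simp
    qed
    have half: "((\<lambda>x. x powr (1/2)) has_real_derivative 1/2 * x powr (-1/2)) (at x)"
      and mhalf: "((\<lambda>x. x powr (-1/2)) has_real_derivative -1/2 * x powr (-3/2)) (at x)"
      using x by (auto intro!: derivative_eq_intros)
    have "(log_fun c has_real_derivative
        (- (1/2) * (1/2 * x powr (-1/2))) * ln (1 + c / x\<^sup>2) + (- 2 * c / (x * (x\<^sup>2 + c))) * (- (1/2) * x powr (1/2))) (at x)"
      unfolding log_fun_def[abs_def] by (intro DERIV_mult DERIV_cmult half L)
    then show "(log_fun c has_real_derivative log_fun' c x) (at x)"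
    proof (rule DERIV_cong)
      define D where "D = x\<^sup>2 + c"
      have "D \<noteq> 0"
        using xc by (simp add: D_def)
      define P where "P = x powr (-3/2)"
      show "(- (1/2) * (1/2 * x powr (-1/2))) * ln (1 + c / x\<^sup>2)
          + (- 2 * c / (x * (x\<^sup>2 + c))) * (- (1/2) * x powr (1/2)) = log_fun' c x"
        unfolding log_fun'_def pw D_def[symmetric] P_def[symmetric] using x \<open>D \<noteq> 0\<close>
        by (simp add: power2_eq_square field_simps)
    qed
    have den: "((\<lambda>x. x\<^sup>2 + c) has_real_derivative 2 * x) (at x)"
      by (auto intro!: derivative_eq_intros)
    have "(log_fun' c has_real_derivative
        ((- (1/4) * (-1/2 * x powr (-3/2))) * ln (1 + c / x\<^sup>2) + (- 2 * c / (x * (x\<^sup>2 + c))) * (- (1/4) * x powr (-1/2)))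
        + ((c * (-1/2 * x powr (-3/2))) * (x\<^sup>2 + c) - (c * x powr (-1/2)) * (2 * x)) / ((x\<^sup>2 + c) * (x\<^sup>2 + c))) (at x)"
      unfolding log_fun'_def[abs_def] by (intro DERIV_add DERIV_mult DERIV_cmult DERIV_divide mhalf L den) (use xc in simp)
    then show "(log_fun' c has_real_derivative f2 x) (at x)"
    proof (rule DERIV_cong)
      define D where "D = x\<^sup>2 + c"
      have "D \<noteq> 0"
        using xc by (simp add: D_def)
      define P where "P = x powr (-3/2)"
      show "((- (1/4) * (-1/2 * x powr (-3/2))) * ln (1 + c / x\<^sup>2) + (- 2 * c / (x * (x\<^sup>2 + c))) * (- (1/4) * x powr (-1/2)))
        + ((c * (-1/2 * x powr (-3/2))) * (x\<^sup>2 + c) - (c * x powr (-1/2)) * (2 * x)) / ((x\<^sup>2 + c) * (x\<^sup>2 + c)) = f2 x"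
        unfolding f2_def pw D_def[symmetric] P_def[symmetric] using x \<open>D \<noteq> 0\<close>
        by (simp add: power2_eq_square field_simps)
    qed
    show "log_fun_image c x = - f2 x + (0\<^sup>2 - 1/4) / x\<^sup>2 * log_fun c x"
      unfolding log_fun_image_def f2_def log_fun_def pw using x by (simp add: power2_eq_square)
  next
    have "x\<^sup>2 + c \<noteq> 0" "0 < 1 + c / x\<^sup>2" for x
      using c by (auto simp: add_nonneg_eq_0_iff add_pos_nonneg)
    then show "continuous_on {0<..} f2"
      unfolding f2_def[abs_def] by (intro continuous_intros) (auto simp: less_imp_neq[symmetric])
  qed
  then show ?thesis
    by blast
qed

lemma log_fun_continuous: "continuous_on {0<..} (log_fun c)" "continuous_on {0<..} (log_fun_image c)"
proof -
  have "x\<^sup>2 + c \<noteq> 0" "0 < 1 + c / x\<^sup>2" for x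
    using c by (auto simp: add_nonneg_eq_0_iff add_pos_nonneg)
  then show "continuous_on {0<..} (log_fun c)" "continuous_on {0<..} (log_fun_image c)"
    unfolding log_fun_def[abs_def] log_fun_image_def[abs_def]
    by (intro continuous_intros; auto simp: less_imp_neq[symmetric])+
qed

lemma log_fun_square_integrable:
  "square_integrable (\<lambda>x. of_real (log_fun c x))" "square_integrable (\<lambda>x. of_real (log_fun_image c x))"
proof -
  show "square_integrable (\<lambda>x. of_real (log_fun c x))"
  proof (rule square_integrable_by_powr[where C = "4 * (1 + c) + c\<^sup>2" and \<alpha> = 0])
    show "(\<lambda>x. complex_of_real (log_fun c x)) \<in> borel_measurable half_line"
      by (intro continuous_on_measurable_half_line continuous_intros log_fun_continuous)
    have sq: "(norm (complex_of_real (log_fun c x)))\<^sup>2 = x * (ln (1 + c / x\<^sup>2))\<^sup>2 / 4" if "0 < x" for x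
      using that unfolding log_fun_def norm_of_real power2_abs
      by (simp add: power_mult_distrib powr_half_sqrt power_divide)
    fix x :: real
    have L0: "0 \<le> ln (1 + c / x\<^sup>2)" if "0 < x"
      using c that by simp
    show "(norm (complex_of_real (log_fun c x)))\<^sup>2 \<le> (4 * (1 + c) + c\<^sup>2) * x powr 0" if x: "0 < x" "x \<le> 1"
    proof -
      define y where "y = sqrt (1 + c / x\<^sup>2)"
      have y: "1 \<le> y"
        using c by (simp add: y_def)
      have "(sqrt y) ^ 4 = ((sqrt y)\<^sup>2)\<^sup>2"
        by (simp flip: power_mult)
      also have "\<dots> = y\<^sup>2"
        using y by simp
      also have "\<dots> = 1 + c / x\<^sup>2"
        using c by (simp add: y_def)
      finally have "1 + c / x\<^sup>2 = (sqrt y) ^ 4" ..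
      then have "ln (1 + c / x\<^sup>2) = 4 * ln (sqrt y)"
        using y by (simp add: ln_realpow)
      also have "\<dots> \<le> 4 * sqrt y"
        using ln_le_minus_one[of "sqrt y"] y by simp
      finally have "(ln (1 + c / x\<^sup>2))\<^sup>2 \<le> (4 * sqrt y)\<^sup>2"
        using L0[OF x(1)] by (intro power_mono) auto
      also have "\<dots> = 16 * y"
        using y by (simp add: power_mult_distrib)
      finally have "x * (ln (1 + c / x\<^sup>2))\<^sup>2 / 4 \<le> 4 * (x * y)"
        using x by simp
      also have "x * y = sqrt (x\<^sup>2 * (1 + c / x\<^sup>2))"
        unfolding real_sqrt_mult y_def using x by simp
      also have "x\<^sup>2 * (1 + c / x\<^sup>2) = x\<^sup>2 + c"
        using x by (simp add: field_simps)
      also have "sqrt (x\<^sup>2 + c) \<le> 1 + c"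
      proof (rule real_le_lsqrt)
        have "x\<^sup>2 \<le> 1"
          using x by (simp add: power_le_one)
        then have "x\<^sup>2 + c \<le> 1 + 2 * c + c\<^sup>2"
          using c zero_le_power2[of c] by linarith
        also have "\<dots> = (1 + c)\<^sup>2"
          by (simp add: power2_sum)
        finally show "x\<^sup>2 + c \<le> (1 + c)\<^sup>2" .
      qed (use c in auto)
      finally show ?thesis
        unfolding sq[OF x(1)] using x by (simp add: add_increasing2)
    qed
    show "(norm (complex_of_real (log_fun c x)))\<^sup>2 \<le> (4 * (1 + c) + c\<^sup>2) * x powr (-2)" if x: "1 < x"
    proof -
      have "ln (1 + c / x\<^sup>2) \<le> c / x\<^sup>2"
        using c by (intro ln_add_one_self_le_self) simp
      then have "(ln (1 + c / x\<^sup>2))\<^sup>2 \<le> (c / x\<^sup>2)\<^sup>2"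
        using L0 x by (intro power_mono) auto
      then have "x * (ln (1 + c / x\<^sup>2))\<^sup>2 \<le> x * (c / x\<^sup>2)\<^sup>2"
        using x by (intro mult_left_mono) simp_all
      moreover have "0 \<le> x * (ln (1 + c / x\<^sup>2))\<^sup>2"
        using x by (intro mult_nonneg_nonneg) simp_all
      ultimately have "x * (ln (1 + c / x\<^sup>2))\<^sup>2 / 4 \<le> x * (c / x\<^sup>2)\<^sup>2"
        by linarith
      also have "\<dots> = c\<^sup>2 * (1 / x\<^sup>2) * (1 / x)"
        using x by (simp add: power2_eq_square)
      also have "\<dots> \<le> c\<^sup>2 * (1 / x\<^sup>2) * 1"
        using x by (intro mult_left_mono) auto
      also have "\<dots> \<le> (4 * (1 + c) + c\<^sup>2) * (1 / x\<^sup>2)"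
        using c by (simp add: divide_right_mono)
      also have "1 / x\<^sup>2 = x powr (-2)"
        using x by (simp add: powr_minus divide_inverse)
      finally show ?thesis
        unfolding sq[OF less_trans[OF zero_less_one x]] .
    qed
  qed simp
  show "square_integrable (\<lambda>x. of_real (log_fun_image c x))"
  proof (rule square_integrable_by_powr[where C = "4 / c\<^sup>2 + 4 * c\<^sup>2" and \<alpha> = 0])
    show "(\<lambda>x. complex_of_real (log_fun_image c x)) \<in> borel_measurable half_line"
      by (intro continuous_on_measurable_half_line continuous_intros log_fun_continuous)
    have sq: "(norm (complex_of_real (log_fun_image c x)))\<^sup>2 = 4 * c\<^sup>2 * x / (x\<^sup>2 + c) ^ 4" if "0 < x" for x
    proof -
      have "((x\<^sup>2 + c)\<^sup>2)\<^sup>2 = (x\<^sup>2 + c) ^ 4"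
        by (simp flip: power_mult)
      then show ?thesis
        using that unfolding log_fun_image_def norm_of_real power2_abs
        by (simp add: power_mult_distrib powr_half_sqrt power_divide)
    qed
    fix x :: real
    show "(norm (complex_of_real (log_fun_image c x)))\<^sup>2 \<le> (4 / c\<^sup>2 + 4 * c\<^sup>2) * x powr 0" if x: "0 < x" "x \<le> 1"
    proof -
      have "4 * c\<^sup>2 * x / (x\<^sup>2 + c) ^ 4 \<le> 4 * c\<^sup>2 * 1 / c ^ 4"
        using x c by (intro frac_le mult_left_mono power_mono) auto
      also have "\<dots> = 4 / c\<^sup>2"
        using c by (simp add: power2_eq_square power4_eq_xxxx)
      finally show ?thesis
        unfolding sq[OF x(1)] using x by (simp add: add_increasing2)
    qed
    show "(norm (complex_of_real (log_fun_image c x)))\<^sup>2 \<le> (4 / c\<^sup>2 + 4 * c\<^sup>2) * x powr (-2)" if x: "1 < x"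
    proof -
      have "4 * c\<^sup>2 * x / (x\<^sup>2 + c) ^ 4 \<le> 4 * c\<^sup>2 * x / (x\<^sup>2) ^ 4"
        using x c by (intro divide_left_mono power_mono) (auto intro!: mult_pos_pos zero_less_power add_pos_pos)
      also have "\<dots> = 4 * c\<^sup>2 * (x / (x\<^sup>2) ^ 4)"
        by simp
      also have "4 * c\<^sup>2 * (x / (x\<^sup>2) ^ 4) \<le> 4 * c\<^sup>2 * (1 / x\<^sup>2)"
      proof (rule mult_left_mono)
        have "x / (x\<^sup>2) ^ 4 = (1 / x\<^sup>2) * (1 / x ^ 5)"
          using x by (simp add: field_simps flip: power_mult power_add power_Suc)
        also have "\<dots> \<le> (1 / x\<^sup>2) * 1"
          using x by (intro mult_left_mono) auto
        finally show "x / (x\<^sup>2) ^ 4 \<le> 1 / x\<^sup>2"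
          by simp
      qed simp
      also have "4 * c\<^sup>2 * (1 / x\<^sup>2) \<le> (4 / c\<^sup>2 + 4 * c\<^sup>2) * (1 / x\<^sup>2)"
        by (intro mult_right_mono) auto
      also have "1 / x\<^sup>2 = x powr (-2)"
        using x by (simp add: powr_minus divide_inverse)
      finally show ?thesis
        unfolding sq[OF less_trans[OF zero_less_one x]] by simp
    qed
  qed simp
qed

definition log_vec :: l2
  where "log_vec = abs_l2 (\<lambda>x. of_real (log_fun c x))"

definition log_vec_image :: l2
  where "log_vec_image = abs_l2 (\<lambda>x. of_real (log_fun_image c x))"

lemma log_vec_maximal: "(log_vec, log_vec_image) \<in> bessel_maximal 0"
  unfolding log_vec_def log_vec_image_def
  using log_fun_ode bessel_maximalI[OF log_fun_square_integrable] by blast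

lemma log_vec_boundary_values:
  "bracket_0 log_vec (\<lambda>x. x powr (1/2)) = -1"
  "bracket_0 log_vec (\<lambda>x. x powr (1/2) * ln x) = of_real (- ln c / 2)"
proof -
  obtain f2 where ode: "bessel_ode 0 (\<lambda>x. of_real (log_fun c x)) (\<lambda>x. of_real (log_fun' c x)) f2
    (\<lambda>x. of_real (log_fun_image c x))"
    using log_fun_ode by blast
  have bracket: "bracket_0 log_vec q = of_real w"
    if q: "square_integrable_solution 0 q q1" and lim: "(h \<longlongrightarrow> w) (at_right 0)"
      and h: "\<And>x. 0 < x \<Longrightarrow> h x = log_fun c x * q1 x - log_fun' c x * q x" for q q1 h w
  proof -
    have "((\<lambda>x. complex_of_real (h x)) \<longlongrightarrow> of_real w) (at_right 0)"
      by (intro tendsto_of_real lim)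
    moreover have "\<forall>\<^sub>F x in at_right 0. complex_of_real (h x)
        = wronskian (\<lambda>x. of_real (log_fun c x)) (\<lambda>x. of_real (log_fun' c x)) (\<lambda>x. of_real (q x)) (\<lambda>x. of_real (q1 x)) x"
      unfolding eventually_at_right_field wronskian_def complex_cnj_complex_of_real
      by (intro exI[of _ 1]) (simp add: h)
    ultimately have lim': "(wronskian (\<lambda>x. of_real (log_fun c x)) (\<lambda>x. of_real (log_fun' c x))
        (\<lambda>x. of_real (q x)) (\<lambda>x. of_real (q1 x)) \<longlongrightarrow> of_real w) (at_right 0)"
      by (rule Lim_transform_eventually)
    obtain q2 where q2: "bessel_ode 0 (\<lambda>x. of_real (q x)) (\<lambda>x. of_real (q1 x)) q2 (\<lambda>_. 0)"
      using q unfolding square_integrable_solution_def by blast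
    show ?thesis
      unfolding log_vec_def by (rule bracket_0_eq[OF ode log_fun_square_integrable(1) bessel_odeD(1)[OF q2] lim'])
  qed
  have pw: "x powr (1/2) * x powr (-1/2) = 1" if "0 < x" for x :: real
    using that by (simp add: powr_add[symmetric])
  have "bracket_0 log_vec (\<lambda>x. x powr (1/2)) = of_real (-1)"
  proof (rule bracket)
    show "square_integrable_solution 0 (\<lambda>x. x powr (1/2)) (\<lambda>x. 1/2 * x powr (1/2 - 1))"
      by (rule square_integrable_solution_powr) (auto simp: power2_eq_square)
    show "((\<lambda>x. - c / (x\<^sup>2 + c)) \<longlongrightarrow> -1) (at_right 0)"
      using c by real_asymp
    fix x :: real
    assume x: "0 < x"
    have "log_fun c x * (1/2 * x powr (1/2 - 1)) - log_fun' c x * x powr (1/2)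
        = - (x powr (1/2) * x powr (-1/2)) * (c / (x\<^sup>2 + c))"
      by (simp add: log_fun_def log_fun'_def algebra_simps)
    then show "- c / (x\<^sup>2 + c) = log_fun c x * (1/2 * x powr (1/2 - 1)) - log_fun' c x * x powr (1/2)"
      unfolding pw[OF x] by simp
  qed
  then show "bracket_0 log_vec (\<lambda>x. x powr (1/2)) = -1"
    by simp
  show "bracket_0 log_vec (\<lambda>x. x powr (1/2) * ln x) = of_real (- ln c / 2)"
  proof (rule bracket[OF square_integrable_solution_log])
    show "((\<lambda>x. - (1/2) * ln (1 + c / x\<^sup>2) - c / (x\<^sup>2 + c) * ln x) \<longlongrightarrow> - ln c / 2) (at_right 0)"
      using c by real_asymp
    fix x :: real
    assume x: "0 < x"
    have "log_fun c x * (1/2 * x powr (-1/2) * ln x + x powr (-1/2)) - log_fun' c x * (x powr (1/2) * ln x)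
        = (x powr (1/2) * x powr (-1/2)) * (- (1/2) * ln (1 + c / x\<^sup>2) - c / (x\<^sup>2 + c) * ln x)"
      by (simp add: log_fun_def log_fun'_def algebra_simps)
    then show "- (1/2) * ln (1 + c / x\<^sup>2) - c / (x\<^sup>2 + c) * ln x
        = log_fun c x * (1/2 * x powr (-1/2) * ln x + x powr (-1/2)) - log_fun' c x * (x powr (1/2) * ln x)"
      unfolding pw[OF x] by simp
  qed
qed

lemma log_vec_form_negative: "cinner log_vec_image log_vec \<notin> \<real>\<^sub>\<ge>\<^sub>0"
proof
  assume pos: "cinner log_vec_image log_vec \<in> \<real>\<^sub>\<ge>\<^sub>0"
  let ?h = "\<lambda>x. - (log_fun_image c x * log_fun c x)"
  have int: "integrable half_line (\<lambda>x. complex_of_real (log_fun_image c x) * cnj (of_real (log_fun c x)))"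
    by (rule integrable_mult_cnj[OF log_fun_square_integrable(2,1)])
  have "integrable half_line (\<lambda>x. Re (complex_of_real (log_fun_image c x) * cnj (of_real (log_fun c x))))"
    by (rule integrable_Re[OF int])
  then have h: "integrable half_line ?h"
    by simp
  have h_pos: "0 < ?h x" if "0 < x" for x
  proof -
    have "?h x = c * (x powr (1/2) * (x powr (1/2) * ln (1 + c / x\<^sup>2))) / (x\<^sup>2 + c)\<^sup>2"
      by (simp add: log_fun_image_def log_fun_def)
    also have "0 < \<dots>"
      using c that by (intro divide_pos_pos mult_pos_pos zero_less_power add_nonneg_pos ln_gt_zero) auto
    finally show ?thesis .
  qed
  have "cinner log_vec_image log_vec = (\<integral>x. complex_of_real (- ?h x) \<partial>half_line)"
    unfolding log_vec_def log_vec_image_def cinner_abs_l2[OF log_fun_square_integrable(2,1)] by simp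
  also have "\<dots> = of_real (- (\<integral>x. ?h x \<partial>half_line))"
    unfolding integral_complex_of_real using Bochner_Integration.integral_minus[of half_line ?h] by simp
  finally have "(\<integral>x. ?h x \<partial>half_line) \<le> 0"
    using pos by simp
  moreover have "0 \<le> (\<integral>x. ?h x \<partial>half_line)"
    by (rule integral_nonneg_AE, rule AE_I2) (use h_pos less_imp_le in auto)
  ultimately have "AE x in half_line. ?h x = 0"
    using integral_nonneg_eq_0_iff_AE[OF h AE_I2] h_pos less_imp_le by fastforce
  then have "negligible {x. 0 < x \<and> ?h x \<noteq> 0}"
    by (rule AE_half_lineD)
  moreover have "{x. 0 < x \<and> ?h x \<noteq> 0} = {0<..}"
    using h_pos by force
  ultimately show False
    using open_not_negligible[of "{0::real<..}"] by auto
qed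

end

subsection \<open>The boundary triplet and the extremal extensions\<close>

lemma test_vec_powr_brackets:
  assumes m: "m + m' = 1" "m\<^sup>2 - m = \<nu>\<^sup>2 - 1/4" "-1/2 < m" "m < 3/2" and r: "0 < r"
  shows "(test_vec m r, test_vec_image m r) \<in> bessel_maximal \<nu>"
    and "bracket_0 (test_vec m r) (\<lambda>x. x powr m) = 0"
    and "bracket_0 (test_vec m r) (\<lambda>x. x powr m') = of_real (m' - m)"
proof -
  have m': "m' = 1 - m"
    using m(1) by simp
  have mm': "m'\<^sup>2 - m' = \<nu>\<^sup>2 - 1/4" "-1/2 < m'"
    using m(2-4) unfolding m' by (simp_all add: power2_eq_square algebra_simps)
  note p = square_integrable_solution_powr[OF m(2,3)] and q = square_integrable_solution_powr[OF mm']
  have "x powr m * (m' * x powr (m' - 1)) - m * x powr (m - 1) * x powr m' = m' - m" if "0 < x" for x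
  proof -
    have "x powr m * x powr (m' - 1) = 1" "x powr (m - 1) * x powr m' = 1"
      using that by (simp_all add: powr_add[symmetric] m')
    then have "m' * (x powr m * x powr (m' - 1)) - m * (x powr (m - 1) * x powr m') = m' - m"
      by simp
    then show ?thesis
      by (simp add: mult_ac)
  qed
  moreover have "((\<lambda>x. x powr (m + 1) * x powr m') \<longlongrightarrow> 0) (at_right 0)"
    unfolding powr_add[symmetric] m' by real_asymp
  ultimately show "(test_vec m r, test_vec_image m r) \<in> bessel_maximal \<nu>"
    and "bracket_0 (test_vec m r) (\<lambda>x. x powr m') = of_real (m' - m)"
    using test_vec_boundary_value[OF m(2-4) r q] by auto
  have "((\<lambda>x. x powr (m + 1) * x powr m) \<longlongrightarrow> 0) (at_right 0)"
    unfolding powr_add[symmetric] using m(3) by real_asymp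
  then show "bracket_0 (test_vec m r) (\<lambda>x. x powr m) = 0"
    using test_vec_boundary_value(2)[OF m(2-4) r p, of 0] by (simp add: mult_ac)
qed

lemma bessel_Gamma_boundary_triplet:
  assumes \<nu>: "0 \<le> \<nu>" "\<nu> < 1"
  shows "boundary_triplet (adjoint_op (bessel_minimal \<nu>)) (bessel_Gamma0 \<nu>) (bessel_Gamma1 \<nu>)"
proof (cases "\<nu> = 0")
  case False
  then have pos: "0 < \<nu>"
    using \<nu> by simp
  define m m' where "m = 1/2 + \<nu>" and "m' = 1/2 - \<nu>"
  have mm: "m\<^sup>2 - m = \<nu>\<^sup>2 - 1/4" "m'\<^sup>2 - m' = \<nu>\<^sup>2 - 1/4" and m: "-1/2 < m" "m < 3/2" "-1/2 < m'" "m' < 3/2"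
    using \<nu> by (auto simp: m_def m'_def power2_eq_square algebra_simps)
  note p = square_integrable_solution_powr[OF mm(1) m(1)] and q = square_integrable_solution_powr[OF mm(2) m(3)]
  have sum: "m + m' = 1" "m' + m = 1" "m' - m = - 2 * \<nu>" "m - m' = 2 * \<nu>"
    by (simp_all add: m_def m'_def)
  have w: "x powr m * (m' * x powr (m' - 1)) - m * x powr (m - 1) * x powr m' = - 2 * \<nu>" if "0 < x" for x
  proof -
    have "x powr m * x powr (m' - 1) = 1" "x powr (m - 1) * x powr m' = 1"
      using that by (simp_all add: powr_add[symmetric] m_def m'_def)
    then have "m' * (x powr m * x powr (m' - 1)) - m * (x powr (m - 1) * x powr m') = - 2 * \<nu>"
      using sum by simp
    then show ?thesis
      by (simp add: mult_ac)
  qed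
  note e = test_vec_powr_brackets[OF sum(1) mm(1) m(1,2) zero_less_one, unfolded sum(3)]
  note d = test_vec_powr_brackets[OF sum(2) mm(2) m(3,4) zero_less_one, unfolded sum(4)]
  have "boundary_triplet (bessel_maximal \<nu>) (\<lambda>u. bracket_0 u (\<lambda>x. x powr m))
      (\<lambda>u. bracket_0 u (\<lambda>x. x powr m') / of_real (- 2 * \<nu>))"
    using bessel_boundary_triplet[OF p q w _ e(1,2) _ d(1)] d(3) e(3) pos by simp
  moreover have "bessel_Gamma0 \<nu> = (\<lambda>u. bracket_0 u (\<lambda>x. x powr m))"
    by (rule ext) (simp add: bessel_Gamma0_def m_def)
  moreover have "bessel_Gamma1 \<nu> = (\<lambda>u. bracket_0 u (\<lambda>x. x powr m') / of_real (- 2 * \<nu>))"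
    using False by (intro ext) (simp add: bessel_Gamma1_def m'_def field_simps)
  ultimately show ?thesis
    by (simp add: adjoint_bessel_minimal)
next
  case True
  have mm: "(1/2)\<^sup>2 - 1/2 = (0::real)\<^sup>2 - 1/4" and m: "-1/2 < (1/2::real)" "1/2 < (3/2::real)"
    by (simp_all add: power2_eq_square)
  note p = square_integrable_solution_powr[OF mm m(1)] and q = square_integrable_solution_log
  have w: "x powr (1/2) * (1/2 * x powr (-1/2) * ln x + x powr (-1/2)) - 1/2 * x powr (1/2 - 1) * (x powr (1/2) * ln x) = 1"
    if "0 < x" for x :: real
  proof -
    have "x powr (1/2) * x powr (-1/2) = 1"
      using that by (simp add: powr_add[symmetric])
    then show ?thesis
      by (simp add: algebra_simps)
  qed
  have lim: "((\<lambda>x::real. x powr (1/2 + 1) * x powr (1/2)) \<longlongrightarrow> 0) (at_right 0)"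
      "((\<lambda>x::real. x powr (1/2 + 1) * (x powr (1/2) * ln x)) \<longlongrightarrow> 0) (at_right 0)"
    by real_asymp+
  have e: "(test_vec (1/2) 1, test_vec_image (1/2) 1) \<in> bessel_maximal 0" "bracket_0 (test_vec (1/2) 1) (\<lambda>x. x powr (1/2)) = 0"
      "bracket_0 (test_vec (1/2) 1) (\<lambda>x. x powr (1/2) * ln x) \<noteq> 0"
    using test_vec_boundary_value[OF mm m zero_less_one p _ lim(1), of 0]
      test_vec_boundary_value(2)[OF mm m zero_less_one q w lim(2)] by (auto simp: mult_ac)
  have d: "(log_vec 1, log_vec_image 1) \<in> bessel_maximal 0" "bracket_0 (log_vec 1) (\<lambda>x. x powr (1/2)) \<noteq> 0"
    using log_vec_maximal[of 1] log_vec_boundary_values(1)[of 1] by simp_all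
  have "boundary_triplet (bessel_maximal 0) (\<lambda>u. bracket_0 u (\<lambda>x. x powr (1/2)))
      (\<lambda>u. bracket_0 u (\<lambda>x. x powr (1/2) * ln x) / of_real 1)"
    by (rule bessel_boundary_triplet[OF p q w _ e d]) simp_all
  moreover have "bessel_Gamma0 0 = (\<lambda>u. bracket_0 u (\<lambda>x. x powr (1/2)))"
    by (rule ext) (simp add: bessel_Gamma0_def)
  moreover have "bessel_Gamma1 0 = (\<lambda>u. bracket_0 u (\<lambda>x. x powr (1/2) * ln x) / of_real 1)"
    by (rule ext) (simp add: bessel_Gamma1_def)
  ultimately show ?thesis
    by (simp add: adjoint_bessel_minimal True)
qed

text \<open>Applied with \<open>\<mu> = \<nu>\<close> to \<open>\<Gamma>\<^sub>0\<close> and with \<open>\<mu> = - \<nu>\<close> to \<open>\<Gamma>\<^sub>1\<close>.\<close>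

lemma bessel_kernel_extension:
  assumes bt: "boundary_triplet (adjoint_op (bessel_minimal \<nu>)) \<Gamma> \<Gamma>'"
    and \<mu>: "-1 < \<mu>" "\<mu> < 1" "\<mu>\<^sup>2 = \<nu>\<^sup>2"
    and \<Gamma>: "\<And>u. \<Gamma> u = 0 \<Longrightarrow> bracket_0 u (\<lambda>x. x powr (1/2 + \<mu>)) = 0"
  shows "nonneg_self_adjoint_extension (bessel_minimal \<nu>) {(f, f') \<in> adjoint_op (bessel_minimal \<nu>). \<Gamma> f = 0}"
  unfolding nonneg_self_adjoint_extension_def
proof (intro conjI)
  let ?A = "bessel_minimal \<nu>" and ?B = "{(f, f') \<in> adjoint_op (bessel_minimal \<nu>). \<Gamma> f = 0}"
  show "self_adjoint_op ?B"
    by (rule self_adjoint_boundary_kernel[OF bt bessel_minimal_symmetric bessel_minimal_dense])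
  show "?A \<subseteq> ?B"
    using bessel_minimal_symmetric boundary_values_zero_on_operator(1)[OF bt bessel_minimal_symmetric bessel_minimal_dense]
    by blast
  show "nonneg_op ?B"
    unfolding nonneg_op_def
  proof (intro ballI, clarify)
    fix u v
    assume "(u, v) \<in> adjoint_op ?A" and "\<Gamma> u = 0"
    then have uv: "(u, v) \<in> bessel_maximal \<nu>"
      by (simp add: adjoint_bessel_minimal)
    obtain f f1 f2 g where f: "u = abs_l2 f" "v = abs_l2 g" "square_integrable f" "square_integrable g"
        "bessel_ode \<nu> f f1 f2 g"
      using bessel_maximal_cases[OF uv] .
    have mm: "(1/2 + \<mu>)\<^sup>2 - (1/2 + \<mu>) = \<nu>\<^sup>2 - 1/4"
      unfolding \<mu>(3)[symmetric] by (simp add: power2_eq_square algebra_simps)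
    have "square_integrable_solution \<nu> (\<lambda>x. x powr (1/2 + \<mu>)) (\<lambda>x. (1/2 + \<mu>) * x powr (1/2 + \<mu> - 1))"
      using \<mu> by (intro square_integrable_solution_powr mm) simp
    from wronskian_tendsto_bracket_0[OF f(5,3,4) this]
    have "(wronskian f f1 (\<lambda>x. of_real (x powr (1/2 + \<mu>))) (\<lambda>x. of_real ((1/2 + \<mu>) * x powr (1/2 + \<mu> - 1)))
        \<longlongrightarrow> 0) (at_right 0)"
      using \<Gamma>[OF \<open>\<Gamma> u = 0\<close>] f(1) by simp
    from bessel_form_nonneg[OF f(5,3,4) \<mu> refl this] show "cinner v u \<in> \<real>\<^sub>\<ge>\<^sub>0"
      by (simp add: f)
  qed
qed

lemma l2_tendsto_0:
  fixes X :: "nat \<Rightarrow> l2"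
  assumes "(\<lambda>n. (norm (X n))\<^sup>2) \<longlonglongrightarrow> 0"
  shows "X \<longlonglongrightarrow> 0"
proof -
  have "(\<lambda>n. sqrt ((norm (X n))\<^sup>2)) \<longlonglongrightarrow> sqrt 0"
    by (rule tendsto_real_sqrt[OF assms])
  then show ?thesis
    by (simp add: tendsto_norm_zero_iff)
qed

text \<open>Dilations \<open>r \<rightarrow> \<infinity>\<close> of the test function with \<open>m = 1/2 + \<nu>\<close> concentrate it at the origin without
  changing its boundary values, and both its norm and its form tend to zero.\<close>

lemma bessel_friedrichs_extension:
  assumes \<nu>: "0 < \<nu>" "\<nu> < 1"
  shows "friedrichs_extension (bessel_minimal \<nu>)
    = {(f, f') \<in> adjoint_op (bessel_minimal \<nu>). bessel_Gamma0 \<nu> f = 0}"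
proof (rule friedrichs_extension_eqI)
  let ?A = "bessel_minimal \<nu>" and ?B = "{(f, f') \<in> adjoint_op (bessel_minimal \<nu>). bessel_Gamma0 \<nu> f = 0}"
  have bt: "boundary_triplet (adjoint_op ?A) (bessel_Gamma0 \<nu>) (bessel_Gamma1 \<nu>)"
    using \<nu> by (intro bessel_Gamma_boundary_triplet) auto
  show B: "nonneg_self_adjoint_extension ?A ?B"
    using \<nu> by (intro bessel_kernel_extension[OF bt, of \<nu>]) (auto simp: bessel_Gamma0_def)
  define m m' where "m = 1/2 + \<nu>" and "m' = 1/2 - \<nu>"
  have m: "m + m' = 1" "m\<^sup>2 - m = \<nu>\<^sup>2 - 1/4" "-1/2 < m" "m < 3/2" and diff: "m' - m = - 2 * \<nu>"
    using \<nu> by (auto simp: m_def m'_def power2_eq_square algebra_simps)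
  have r: "0 < real (Suc n)" for n
    by simp
  define e where "e n = test_vec m (real (Suc n))" for n
  define e' where "e' n = test_vec_image m (real (Suc n))" for n
  have e: "(e n, e' n) \<in> adjoint_op ?A" "bessel_Gamma0 \<nu> (e n) = 0" "bessel_Gamma1 \<nu> (e n) = 1" for n
  proof -
    note V = test_vec_powr_brackets[OF m r, unfolded diff]
    show "(e n, e' n) \<in> adjoint_op ?A" "bessel_Gamma0 \<nu> (e n) = 0" "bessel_Gamma1 \<nu> (e n) = 1"
      using V \<nu> unfolding e_def e'_def bessel_Gamma0_def bessel_Gamma1_def adjoint_bessel_minimal
      by (auto simp: mult_ac m_def m'_def)
  qed
  fix C
  assume C: "nonneg_self_adjoint_extension ?A C"
  show "dominates_resolvent C ?B"
  proof (rule friedrichs_dominates[OF B C])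
    fix u v
    assume "(u, v) \<in> ?B"
    then have uv: "(u, v) \<in> adjoint_op ?A" "bessel_Gamma0 \<nu> u = 0"
      by auto
    define a where "a = bessel_Gamma1 \<nu> u"
    have "(u - scaleC a (e n), v - scaleC a (e' n)) \<in> adjoint_op (adjoint_op ?A)" for n
    proof -
      have ae: "(scaleC a (e n), scaleC a (e' n)) \<in> adjoint_op ?A"
        by (rule adjoint_op_scaleC[OF e(1)])
      note bts = bt bessel_minimal_symmetric bessel_minimal_dense
      show ?thesis
      proof (rule boundary_values_zero_imp_biadjoint[OF bts])
        show "(u - scaleC a (e n), v - scaleC a (e' n)) \<in> adjoint_op ?A"
          by (rule adjoint_op_diff[OF uv(1) ae])
        show "bessel_Gamma0 \<nu> (u - scaleC a (e n)) = 0"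
          unfolding boundary_triplet_diff(1)[OF bts uv(1) ae] boundary_triplet_scale(1)[OF bts e(1)]
          by (simp add: uv e)
        show "bessel_Gamma1 \<nu> (u - scaleC a (e n)) = 0"
          unfolding boundary_triplet_diff(2)[OF bts uv(1) ae] boundary_triplet_scale(2)[OF bts e(1)]
          by (simp add: e a_def)
      qed
    qed
    moreover have "(\<lambda>n. scaleC a (e n)) \<longlonglongrightarrow> 0"
    proof (rule l2_tendsto_0)
      have "(\<lambda>n. real (Suc n) powr (- 2 * m - 1)) \<longlonglongrightarrow> 0"
        unfolding m_def using \<nu> by real_asymp
      then have "(\<lambda>n. (norm a)\<^sup>2 * (real (Suc n) powr (- 2 * m - 1) * (norm (test_vec m 1))\<^sup>2)) \<longlonglongrightarrow> 0"
        by (intro tendsto_mult_right_zero tendsto_mult_left_zero)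
      then show "(\<lambda>n. (norm (scaleC a (e n)))\<^sup>2) \<longlonglongrightarrow> 0"
        unfolding norm_scaleC power_mult_distrib e_def test_vec_scaling(3)[OF m(3,4) r] .
    qed
    moreover have "(\<lambda>n. cinner (scaleC a (e' n)) (scaleC a (e n))) \<longlonglongrightarrow> 0"
    proof -
      have "(\<lambda>n. real (Suc n) powr (1 - 2 * m)) \<longlonglongrightarrow> 0"
        unfolding m_def using \<nu> by real_asymp
      from tendsto_of_real[OF this]
      have "(\<lambda>n. complex_of_real (real (Suc n) powr (1 - 2 * m))) \<longlonglongrightarrow> 0"
        by simp
      then have "(\<lambda>n. cnj a * (a * (complex_of_real (real (Suc n) powr (1 - 2 * m)) * cinner (test_vec_image m 1) (test_vec m 1)))) \<longlonglongrightarrow> 0"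
        by (intro tendsto_mult_right_zero tendsto_mult_left_zero)
      then show ?thesis
        unfolding cinner_scaleC_left cinner_scaleC_right e_def e'_def test_vec_scaling(5)[OF m(3,4) r] .
    qed
    ultimately show "\<exists>e e' :: nat \<Rightarrow> l2. (\<forall>n. (u - e n, v - e' n) \<in> adjoint_op (adjoint_op ?A)) \<and>
        e \<longlonglongrightarrow> 0 \<and> (\<lambda>n. cinner (e' n) (e n)) \<longlonglongrightarrow> 0"
      by (intro exI[of _ "\<lambda>n. scaleC a (e n)"] exI[of _ "\<lambda>n. scaleC a (e' n)"] conjI allI)
  qed
qed

text \<open>Dilations \<open>r \<rightarrow> 0\<close> of the test function with \<open>m = 1/2 - \<nu>\<close> spread it out; now its image and its
  form tend to zero.\<close>

lemma bessel_krein_extension: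
  assumes \<nu>: "0 < \<nu>" "\<nu> < 1"
  shows "krein_extension (bessel_minimal \<nu>)
    = {(f, f') \<in> adjoint_op (bessel_minimal \<nu>). bessel_Gamma1 \<nu> f = 0}"
proof (rule krein_extension_eqI)
  let ?A = "bessel_minimal \<nu>" and ?B = "{(f, f') \<in> adjoint_op (bessel_minimal \<nu>). bessel_Gamma1 \<nu> f = 0}"
  have bt: "boundary_triplet (adjoint_op ?A) (bessel_Gamma0 \<nu>) (bessel_Gamma1 \<nu>)"
    using \<nu> by (intro bessel_Gamma_boundary_triplet) auto
  show B: "nonneg_self_adjoint_extension ?A ?B"
    using \<nu> by (intro bessel_kernel_extension[OF boundary_triplet_swap[OF bt], of "- \<nu>"]) (auto simp: bessel_Gamma1_def)
  define m m' where "m = 1/2 - \<nu>" and "m' = 1/2 + \<nu>"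
  have m: "m + m' = 1" "m\<^sup>2 - m = \<nu>\<^sup>2 - 1/4" "-1/2 < m" "m < 3/2" and diff: "m' - m = 2 * \<nu>"
    using \<nu> by (auto simp: m_def m'_def power2_eq_square algebra_simps)
  have r: "0 < inverse (real (Suc n))" for n
    by simp
  define e where "e n = test_vec m (inverse (real (Suc n)))" for n
  define e' where "e' n = test_vec_image m (inverse (real (Suc n)))" for n
  have e: "(e n, e' n) \<in> adjoint_op ?A" "bessel_Gamma0 \<nu> (e n) = of_real (2 * \<nu>)" "bessel_Gamma1 \<nu> (e n) = 0" for n
  proof -
    note V = test_vec_powr_brackets[OF m r, unfolded diff]
    show "(e n, e' n) \<in> adjoint_op ?A" "bessel_Gamma0 \<nu> (e n) = of_real (2 * \<nu>)" "bessel_Gamma1 \<nu> (e n) = 0"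
      using V \<nu> unfolding e_def e'_def bessel_Gamma0_def bessel_Gamma1_def adjoint_bessel_minimal
      by (auto simp: mult_ac m_def m'_def)
  qed
  fix C
  assume C: "nonneg_self_adjoint_extension ?A C"
  show "dominates_resolvent ?B C"
  proof (rule krein_dominates[OF B C])
    fix u v
    assume "(u, v) \<in> ?B"
    then have uv: "(u, v) \<in> adjoint_op ?A" "bessel_Gamma1 \<nu> u = 0"
      by auto
    define a where "a = bessel_Gamma0 \<nu> u / of_real (2 * \<nu>)"
    have "(u - scaleC a (e n), v - scaleC a (e' n)) \<in> adjoint_op (adjoint_op ?A)" for n
    proof -
      have ae: "(scaleC a (e n), scaleC a (e' n)) \<in> adjoint_op ?A"
        by (rule adjoint_op_scaleC[OF e(1)])
      note bts = bt bessel_minimal_symmetric bessel_minimal_dense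
      show ?thesis
      proof (rule boundary_values_zero_imp_biadjoint[OF bts])
        show "(u - scaleC a (e n), v - scaleC a (e' n)) \<in> adjoint_op ?A"
          by (rule adjoint_op_diff[OF uv(1) ae])
        show "bessel_Gamma0 \<nu> (u - scaleC a (e n)) = 0"
          unfolding boundary_triplet_diff(1)[OF bts uv(1) ae] boundary_triplet_scale(1)[OF bts e(1)]
          using \<nu> by (simp add: e a_def)
        show "bessel_Gamma1 \<nu> (u - scaleC a (e n)) = 0"
          unfolding boundary_triplet_diff(2)[OF bts uv(1) ae] boundary_triplet_scale(2)[OF bts e(1)]
          by (simp add: uv e)
      qed
    qed
    moreover have "(\<lambda>n. scaleC a (e' n)) \<longlonglongrightarrow> 0"
    proof (rule l2_tendsto_0)
      have "(\<lambda>n. inverse (real (Suc n)) powr (3 - 2 * m)) \<longlonglongrightarrow> 0"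
        unfolding m_def using \<nu> by real_asymp
      then have "(\<lambda>n. (norm a)\<^sup>2 * (inverse (real (Suc n)) powr (3 - 2 * m) * (norm (test_vec_image m 1))\<^sup>2)) \<longlonglongrightarrow> 0"
        by (intro tendsto_mult_right_zero tendsto_mult_left_zero)
      then show "(\<lambda>n. (norm (scaleC a (e' n)))\<^sup>2) \<longlonglongrightarrow> 0"
        unfolding norm_scaleC power_mult_distrib e'_def test_vec_scaling(4)[OF m(3,4) r] .
    qed
    moreover have "(\<lambda>n. cinner (scaleC a (e' n)) (scaleC a (e n))) \<longlonglongrightarrow> 0"
    proof -
      have "(\<lambda>n. inverse (real (Suc n)) powr (1 - 2 * m)) \<longlonglongrightarrow> 0"
        unfolding m_def using \<nu> by real_asymp
      from tendsto_of_real[OF this]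
      have "(\<lambda>n. complex_of_real (inverse (real (Suc n)) powr (1 - 2 * m))) \<longlonglongrightarrow> 0"
        by simp
      then have "(\<lambda>n. cnj a * (a * (complex_of_real (inverse (real (Suc n)) powr (1 - 2 * m)) * cinner (test_vec_image m 1) (test_vec m 1)))) \<longlonglongrightarrow> 0"
        by (intro tendsto_mult_right_zero tendsto_mult_left_zero)
      then show ?thesis
        unfolding cinner_scaleC_left cinner_scaleC_right e_def e'_def test_vec_scaling(5)[OF m(3,4) r] .
    qed
    ultimately show "\<exists>e e' :: nat \<Rightarrow> l2. (\<forall>n. (u - e n, v - e' n) \<in> adjoint_op (adjoint_op ?A)) \<and>
        e' \<longlonglongrightarrow> 0 \<and> (\<lambda>n. cinner (e' n) (e n)) \<longlonglongrightarrow> 0"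
      by (intro exI[of _ "\<lambda>n. scaleC a (e n)"] exI[of _ "\<lambda>n. scaleC a (e' n)"] conjI allI)
  qed
qed

text \<open>An extension containing \<open>f\<close> with \<open>\<Gamma>\<^sub>0 f = -1\<close> and \<open>\<Gamma>\<^sub>1 f = \<theta>\<close> contains every function with these
  boundary values, in particular \<open>log_vec (exp (- 2 \<theta>))\<close>, whose form is negative.\<close>

lemma bessel_borderline_unique_extension:
  assumes C: "nonneg_self_adjoint_extension (bessel_minimal 0) C"
  shows "C = {(f, f') \<in> adjoint_op (bessel_minimal 0). bessel_Gamma0 0 f = 0}" (is "C = ?B")
proof (rule self_adjoint_subset_eq)
  let ?A = "bessel_minimal 0"
  have bt: "boundary_triplet (adjoint_op ?A) (bessel_Gamma0 0) (bessel_Gamma1 0)"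
    by (rule bessel_Gamma_boundary_triplet) auto
  note bts = bt bessel_minimal_symmetric bessel_minimal_dense
  show "self_adjoint_op C"
    using C by (simp add: nonneg_self_adjoint_extension_def)
  show "self_adjoint_op ?B"
    by (rule self_adjoint_boundary_kernel[OF bts])
  have CA: "C \<subseteq> adjoint_op ?A"
    by (rule nonneg_extension_subset_adjoint[OF C])
  show "C \<subseteq> ?B"
  proof (rule subrelI, rule ccontr)
    fix u v
    assume uv: "(u, v) \<in> C" and "(u, v) \<notin> ?B"
    then have G: "bessel_Gamma0 0 u \<noteq> 0"
      using CA by auto
    define s where "s = - inverse (bessel_Gamma0 0 u)"
    define \<theta> where "\<theta> = bessel_Gamma1 0 (scaleC s u)"
    have "adjoint_op C = C"
      using C by (simp add: nonneg_self_adjoint_extension_def self_adjoint_op_def)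
    then have su: "(scaleC s u, scaleC s v) \<in> C"
      using adjoint_op_scaleC[of u v C s] uv by simp
    have su': "(scaleC s u, scaleC s v) \<in> adjoint_op ?A"
      using su CA by blast
    have G0: "bessel_Gamma0 0 (scaleC s u) = -1"
      using boundary_triplet_scale(1)[OF bts, of u v s] uv CA G by (auto simp: s_def)
    have "cinner (scaleC s v) (scaleC s u) = cinner (scaleC s u) (scaleC s v)"
      using nonneg_extension_nonneg[OF C su] cinner_commute[of "scaleC s u" "scaleC s v"]
      by (auto simp: complex_nonneg_Reals_iff complex_eq_iff)
    then have "\<theta> = cnj \<theta>"
      using boundary_triplet_green[OF bts su' su'] by (simp add: G0 \<theta>_def)
    then have \<theta>: "\<theta> = of_real (Re \<theta>)"
      by (simp add: complex_eq_iff)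
    define c where "c = exp (- 2 * Re \<theta>)"
    have c: "0 < c" "- ln c / 2 = Re \<theta>"
      by (simp_all add: c_def)
    have k: "(log_vec c, log_vec_image c) \<in> adjoint_op ?A"
      using log_vec_maximal[OF c(1)] by (simp add: adjoint_bessel_minimal)
    have kv: "bessel_Gamma0 0 (log_vec c) = -1" "bessel_Gamma1 0 (log_vec c) = \<theta>"
      using log_vec_boundary_values(1)[OF c(1)] log_vec_boundary_values(2)[OF c(1), unfolded c(2) \<theta>[symmetric]]
      by (simp_all add: bessel_Gamma0_def bessel_Gamma1_def)
    have "(log_vec c - scaleC s u, log_vec_image c - scaleC s v) \<in> adjoint_op (adjoint_op ?A)"
      by (rule boundary_values_zero_imp_biadjoint[OF bts adjoint_op_diff[OF k su']])
        (simp_all add: boundary_triplet_diff[OF bts k su'] G0 kv \<theta>_def)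
    then have "(log_vec c - scaleC s u, log_vec_image c - scaleC s v) \<in> C"
      using nonneg_extension_minimal[OF C] by blast
    from adjoint_op_add[of _ _ C, unfolded \<open>adjoint_op C = C\<close>, OF this su]
    have "(log_vec c, log_vec_image c) \<in> C"
      by simp
    then show False
      using nonneg_extension_nonneg[OF C] log_vec_form_negative[OF c(1)] by blast
  qed
qed

lemma bessel_borderline_extremal_extensions:
  "friedrichs_extension (bessel_minimal 0) = {(f, f') \<in> adjoint_op (bessel_minimal 0). bessel_Gamma0 0 f = 0}"
  "krein_extension (bessel_minimal 0) = {(f, f') \<in> adjoint_op (bessel_minimal 0). bessel_Gamma0 0 f = 0}"
proof -
  let ?A = "bessel_minimal 0" and ?B = "{(f, f') \<in> adjoint_op (bessel_minimal 0). bessel_Gamma0 0 f = 0}"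
  have B: "nonneg_self_adjoint_extension ?A ?B"
    by (rule bessel_kernel_extension[OF bessel_Gamma_boundary_triplet, of 0 0]) (auto simp: bessel_Gamma0_def)
  show "friedrichs_extension ?A = ?B"
    using dominates_resolvent_refl[OF B] bessel_borderline_unique_extension by (intro friedrichs_extension_eqI[OF B]) auto
  show "krein_extension ?A = ?B"
    using dominates_resolvent_refl[OF B] bessel_borderline_unique_extension by (intro krein_extension_eqI[OF B]) auto
qed

theorem proposition5p6:
  fixes \<nu> :: real
  assumes "0 \<le> \<nu>" and "\<nu> < 1"
  shows
    "boundary_triplet (adjoint_op (bessel_minimal \<nu>)) (bessel_Gamma0 \<nu>) (bessel_Gamma1 \<nu>) \<and>
     (Domain (friedrichs_extension (bessel_minimal \<nu>))
        = ker_on (Domain (adjoint_op (bessel_minimal \<nu>))) (bessel_Gamma0 \<nu>) \<and>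
      ker_on (Domain (adjoint_op (bessel_minimal \<nu>))) (bessel_Gamma0 \<nu>)
        = {u \<in> Domain (adjoint_op (bessel_minimal \<nu>)). bracket_0 u (\<lambda>x. x powr (1/2 + \<nu>)) = 0}) \<and>
     (0 < \<nu> \<longrightarrow>
      Domain (krein_extension (bessel_minimal \<nu>))
        = {u \<in> Domain (adjoint_op (bessel_minimal \<nu>)). bracket_0 u (\<lambda>x. x powr (1/2 - \<nu>)) = 0}) \<and>
     (\<nu> = 0 \<longrightarrow>
      Domain (krein_extension (bessel_minimal 0))
        = {u \<in> Domain (adjoint_op (bessel_minimal 0)). bracket_0 u (\<lambda>x. x powr (1/2)) = 0} \<and>
      {u \<in> Domain (adjoint_op (bessel_minimal 0)). bracket_0 u (\<lambda>x. x powr (1/2)) = 0}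
        = ker_on (Domain (adjoint_op (bessel_minimal 0))) (bessel_Gamma0 0) \<and>
      friedrichs_extension (bessel_minimal 0) = krein_extension (bessel_minimal 0))"
proof (intro conjI impI)
  have dom: "Domain {(f, f') \<in> T. P f} = {u \<in> Domain T. P u}" for T :: l2_op and P
    by auto
  show "boundary_triplet (adjoint_op (bessel_minimal \<nu>)) (bessel_Gamma0 \<nu>) (bessel_Gamma1 \<nu>)"
    by (rule bessel_Gamma_boundary_triplet[OF assms])
  have "friedrichs_extension (bessel_minimal \<nu>) = {(f, f') \<in> adjoint_op (bessel_minimal \<nu>). bessel_Gamma0 \<nu> f = 0}"
    using bessel_friedrichs_extension[of \<nu>] bessel_borderline_extremal_extensions(1) assms by (cases "\<nu> = 0") auto
  then show "Domain (friedrichs_extension (bessel_minimal \<nu>))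
      = ker_on (Domain (adjoint_op (bessel_minimal \<nu>))) (bessel_Gamma0 \<nu>)"
    by (simp only: dom ker_on_def)
  show "ker_on (Domain (adjoint_op (bessel_minimal \<nu>))) (bessel_Gamma0 \<nu>)
      = {u \<in> Domain (adjoint_op (bessel_minimal \<nu>)). bracket_0 u (\<lambda>x. x powr (1/2 + \<nu>)) = 0}"
    by (simp only: ker_on_def bessel_Gamma0_def)
  show "Domain (krein_extension (bessel_minimal \<nu>))
      = {u \<in> Domain (adjoint_op (bessel_minimal \<nu>)). bracket_0 u (\<lambda>x. x powr (1/2 - \<nu>)) = 0}" if "0 < \<nu>"
    unfolding bessel_krein_extension[OF that assms(2)] dom using that by (simp add: bessel_Gamma1_def)
  show "Domain (krein_extension (bessel_minimal 0))
      = {u \<in> Domain (adjoint_op (bessel_minimal 0)). bracket_0 u (\<lambda>x. x powr (1/2)) = 0}"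
    unfolding bessel_borderline_extremal_extensions dom by (simp add: bessel_Gamma0_def)
  show "{u \<in> Domain (adjoint_op (bessel_minimal 0)). bracket_0 u (\<lambda>x. x powr (1/2)) = 0}
      = ker_on (Domain (adjoint_op (bessel_minimal 0))) (bessel_Gamma0 0)"
    by (simp add: ker_on_def bessel_Gamma0_def)
  show "friedrichs_extension (bessel_minimal 0) = krein_extension (bessel_minimal 0)"
    unfolding bessel_borderline_extremal_extensions ..
qed

end
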